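(* Let $\gamma\in(\frac23,2)$, let $\psi$ be a smooth wave with leading coefficient $A$ on a warped product spacetime $(\overline M,\overline g)$ associated with $\gamma$, and let $N\ge 0$ be an integer. (i) If the spacetime is of type $-1$ and $h(t)=\int_t^\infty a(s)^{-3}\,ds$, then $a(t)^6E_N(t,\psi-Ah)\to0$ as $t\to0$. (ii) If the spacetime is of type $0$, then $\displaystyle\lim_{t\to0}t^{\frac4\gamma}E_N\left(t,\psi(t,\cdot)-A\cdot t^{1-\frac2\gamma}\right)=0$.
   Context: $(M,g)$ is a closed three-dimensional smooth Riemannian manifold with Levi-Civita connection $\nabla$, Laplace-Beltrami operator $\Delta=g^{ij}\nabla_i\nabla_j$ and volume measure $\mathrm{vol}_M$. A warped product spacetime is $\overline M=(0,\infty)\times M$ with $\overline g=-dt^2+a(t)^2g$. It is of type $0$ (associated with $\gamma$) if $a(t)=t^{\frac{2}{3\gamma}}$ (normalised by scaling). It is of type $-1$ if, for some constant $B>0$, $a$ is the unique function continuous on $[0,\infty)$, positive and smooth on $(0,\infty)$, with $a(0)=0$ and $\dot a=\sqrt{\frac{8\pi B}{3}a^{2-3\gamma}+1}$ on $(0,\infty)$. A smooth wave is $\psi\in C^\infty(\overline M)$ with $-\partial_t^2\psi+a^{-2}\Delta\psi-3\frac{\dot a}{a}\partial_t\psi=0$. Energies: for smooth $\phi:\overline M\to\mathbb{R}$, $E(t,\phi)=\int_M |\partial_t\phi(t,\cdot)|^2+a(t)^{-2}|\nabla\phi(t,\cdot)|_g^2\,\mathrm{vol}_M$ and $E_N(t,\phi)=E(t,\Delta^N\phi)$,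 $E_0=E$. Leading coefficient: for a smooth wave $\psi$ and $\gamma<2$, $A\in C^\infty(M)$ denotes the unique smooth function with $\psi(t,x)/\chi(t)\to A(x)$ as $t\downarrow0$ uniformly in $x\in M$, where $\chi(t)=t^{1-\frac2\gamma}$ in type $0$ and $\chi(t)=\int_t^\infty a(s)^{-3}ds$ in type $-1$ (such $A$ always exists). *)

theory Defs
  imports "HOL-Analysis.Analysis"
begin

section \<open>Smooth maps between Euclidean spaces\<close>

text \<open>These notions are only meant for open domains, where the Frechet derivative is unique.\<close>

primrec Ck_on ::
  "nat \<Rightarrow> 'a::euclidean_space set \<Rightarrow> ('a \<Rightarrow> 'b::real_normed_vector) \<Rightarrow> bool" where
  "Ck_on 0 S f \<longleftrightarrow> continuous_on S f"
| "Ck_on (Suc k) S f \<longleftrightarrow>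
     (\<forall>x\<in>S. f differentiable (at x)) \<and>
     (\<forall>v. Ck_on k S (\<lambda>x. frechet_derivative f (at x) v))"

definition smooth_on :: "'a::euclidean_space set \<Rightarrow> ('a \<Rightarrow> 'b::real_normed_vector) \<Rightarrow> bool" where
  "smooth_on S f \<longleftrightarrow> (\<forall>k. Ck_on k S f)"

definition partial :: "3 \<Rightarrow> (real^3 \<Rightarrow> real) \<Rightarrow> real^3 \<Rightarrow> real" where
  "partial i u x = frechet_derivative u (at x) (axis i 1)"

section \<open>Closed three-dimensional smooth manifolds\<close>

text \<open>
  A chart is a domain together with a coordinate map; the values of the coordinate map
  outside the domain are irrelevant.  A manifold is a set \<open>M\<close>, topologised as a subspace of the
  ambient Hausdorff type, with an arbitrary (not necessarily maximal) smooth atlas.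
  Every closed manifold arises in this way, and connectedness is not required.
\<close>

type_synonym 'a chart = "'a set \<times> ('a \<Rightarrow> real^3)"

abbreviation chart_dom :: "'a chart \<Rightarrow> 'a set" where
  "chart_dom c \<equiv> fst c"

abbreviation chart_img :: "'a chart \<Rightarrow> (real^3) set" where
  "chart_img c \<equiv> snd c ` fst c"

definition chart_inv :: "'a chart \<Rightarrow> real^3 \<Rightarrow> 'a" where
  "chart_inv c = inv_into (fst c) (snd c)"

definition transition :: "'a chart \<Rightarrow> 'a chart \<Rightarrow> real^3 \<Rightarrow> real^3" where
  "transition c d = (\<lambda>x. snd d (chart_inv c x))"

definition is_chart :: "'a::t2_space set \<Rightarrow> 'a chart \<Rightarrow> bool" where
  "is_chart M c \<longleftrightarrow>
     openin (top_of_set M) (chart_dom c) \<and> open (chart_img c) \<and>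
     homeomorphism (chart_dom c) (chart_img c) (snd c) (chart_inv c)"

definition smooth_atlas :: "'a::t2_space set \<Rightarrow> 'a chart set \<Rightarrow> bool" where
  "smooth_atlas M \<A> \<longleftrightarrow>
     (\<forall>c\<in>\<A>. is_chart M c) \<and> (\<Union>c\<in>\<A>. chart_dom c) = M \<and>
     (\<forall>c\<in>\<A>. \<forall>d\<in>\<A>. smooth_on (snd c ` (chart_dom c \<inter> chart_dom d)) (transition c d))"

definition closed_3manifold :: "'a::t2_space set \<Rightarrow> 'a chart set \<Rightarrow> bool" where
  "closed_3manifold M \<A> \<longleftrightarrow> compact M \<and> smooth_atlas M \<A>"

definition smooth_function :: "'a chart set \<Rightarrow> ('a \<Rightarrow> real) \<Rightarrow> bool" where
  "smooth_function \<A> f \<longleftrightarrow> (\<forall>c\<in>\<A>. smooth_on (chart_img c) (\<lambda>x. f (chart_inv c x)))"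

text \<open>Smooth functions on the product \<open>(0, \<infinity>) \<times> M\<close>, written in curried form.\<close>

definition smooth_spacetime_function :: "'a chart set \<Rightarrow> (real \<Rightarrow> 'a \<Rightarrow> real) \<Rightarrow> bool" where
  "smooth_spacetime_function \<A> \<phi> \<longleftrightarrow>
     (\<forall>c\<in>\<A>. smooth_on ({0<..} \<times> chart_img c) (\<lambda>(t, x). \<phi> t (chart_inv c x)))"

section \<open>Riemannian metrics\<close>

text \<open>
  A Riemannian metric is a smooth, symmetric, positive definite covariant 2-tensor field, given by
  its matrix of components \<open>g c x = (g\<^sub>i\<^sub>j(x))\<close> in every chart \<open>c\<close> of the atlas at the coordinate
  point \<open>x\<close>; the last condition is the tensor transformation law.
\<close>

type_synonym 'a metric = "'a chart \<Rightarrow> real^3 \<Rightarrow> real^3^3"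

definition riemannian_metric :: "'a chart set \<Rightarrow> 'a metric \<Rightarrow> bool" where
  "riemannian_metric \<A> g \<longleftrightarrow>
     (\<forall>c\<in>\<A>. smooth_on (chart_img c) (g c) \<and>
        (\<forall>x\<in>chart_img c. transpose (g c x) = g c x \<and> (\<forall>v. v \<noteq> 0 \<longrightarrow> v \<bullet> (g c x *v v) > 0))) \<and>
     (\<forall>c\<in>\<A>. \<forall>d\<in>\<A>. \<forall>x\<in>snd c ` (chart_dom c \<inter> chart_dom d). \<forall>u v.
        u \<bullet> (g c x *v v) =
          frechet_derivative (transition c d) (at x) u \<bullet>
            (g d (transition c d x) *v frechet_derivative (transition c d) (at x) v))"

definition closed_riemannian_3manifold ::
  "'a::t2_space set \<Rightarrow> 'a chart set \<Rightarrow> 'a metric \<Rightarrow> bool" where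
  "closed_riemannian_3manifold M \<A> g \<longleftrightarrow> closed_3manifold M \<A> \<and> riemannian_metric \<A> g"

text \<open>
  The volume measure is the unique Borel measure on \<open>M\<close> that is \<open>\<surd>(det g) dx\<close> in every chart.
\<close>

definition riemannian_volume ::
  "'a::t2_space set \<Rightarrow> 'a chart set \<Rightarrow> 'a metric \<Rightarrow> 'a measure \<Rightarrow> bool" where
  "riemannian_volume M \<A> g vol \<longleftrightarrow>
     space vol = M \<and> sets vol = sets (restrict_space borel M) \<and>
     (\<forall>c\<in>\<A>. \<forall>S\<in>sets vol. S \<subseteq> chart_dom c \<longrightarrow>
        emeasure vol S = (\<integral>\<^sup>+x\<in>snd c ` S. ennreal (sqrt (det (g c x))) \<partial>lborel))"

text \<open>
  Coordinate expressions for a metric \<open>G\<close> and a function \<open>u\<close> on an open subset of coordinate space: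
  Christoffel symbols \<open>\<Gamma>\<^sup>k\<^sub>i\<^sub>j\<close> of the Levi-Civita connection, second covariant derivative
  \<open>\<nabla>\<^sub>i\<nabla>\<^sub>j u\<close>, its trace, and the squared norm of the gradient.
\<close>

definition christoffel :: "(real^3 \<Rightarrow> real^3^3) \<Rightarrow> 3 \<Rightarrow> 3 \<Rightarrow> 3 \<Rightarrow> real^3 \<Rightarrow> real" where
  "christoffel G k i j x =
     (1/2) * (\<Sum>l\<in>UNIV. matrix_inv (G x) $ k $ l *
        (partial i (\<lambda>y. G y $ j $ l) x + partial j (\<lambda>y. G y $ i $ l) x
          - partial l (\<lambda>y. G y $ i $ j) x))"

definition covariant_hessian ::
  "(real^3 \<Rightarrow> real^3^3) \<Rightarrow> (real^3 \<Rightarrow> real) \<Rightarrow> 3 \<Rightarrow> 3 \<Rightarrow> real^3 \<Rightarrow> real" where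
  "covariant_hessian G u i j x =
     partial i (partial j u) x - (\<Sum>k\<in>UNIV. christoffel G k i j x * partial k u x)"

definition coord_laplacian :: "(real^3 \<Rightarrow> real^3^3) \<Rightarrow> (real^3 \<Rightarrow> real) \<Rightarrow> real^3 \<Rightarrow> real" where
  "coord_laplacian G u x =
     (\<Sum>i\<in>UNIV. \<Sum>j\<in>UNIV. matrix_inv (G x) $ i $ j * covariant_hessian G u i j x)"

definition coord_grad_norm2 :: "(real^3 \<Rightarrow> real^3^3) \<Rightarrow> (real^3 \<Rightarrow> real) \<Rightarrow> real^3 \<Rightarrow> real" where
  "coord_grad_norm2 G u x =
     (\<Sum>i\<in>UNIV. \<Sum>j\<in>UNIV. matrix_inv (G x) $ i $ j * partial i u x * partial j u x)"

text \<open>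
  On the manifold these are evaluated in some chart around the point; for smooth functions the
  values do not depend on the chart.
\<close>

definition chart_at :: "'a chart set \<Rightarrow> 'a \<Rightarrow> 'a chart" where
  "chart_at \<A> p = (SOME c. c \<in> \<A> \<and> p \<in> chart_dom c)"

definition laplacian :: "'a chart set \<Rightarrow> 'a metric \<Rightarrow> ('a \<Rightarrow> real) \<Rightarrow> 'a \<Rightarrow> real" where
  "laplacian \<A> g f p =
     (let c = chart_at \<A> p in coord_laplacian (g c) (\<lambda>x. f (chart_inv c x)) (snd c p))"

definition grad_norm2 :: "'a chart set \<Rightarrow> 'a metric \<Rightarrow> ('a \<Rightarrow> real) \<Rightarrow> 'a \<Rightarrow> real" where
  "grad_norm2 \<A> g f p =
     (let c = chart_at \<A> p in coord_grad_norm2 (g c) (\<lambda>x. f (chart_inv c x)) (snd c p))"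

section \<open>Warped product spacetimes and waves\<close>

definition type_zero :: "real \<Rightarrow> (real \<Rightarrow> real) \<Rightarrow> bool" where
  "type_zero \<gamma> a \<longleftrightarrow> (\<forall>t>0. a t = t powr (2 / (3 * \<gamma>)))"

definition type_minus_one :: "real \<Rightarrow> (real \<Rightarrow> real) \<Rightarrow> bool" where
  "type_minus_one \<gamma> a \<longleftrightarrow>
     (\<exists>B>0. continuous_on {0..} a \<and> a 0 = 0 \<and> (\<forall>t>0. a t > 0) \<and> smooth_on {0<..} a \<and>
        (\<forall>t>0. (a has_real_derivative
                  sqrt (8 * pi * B / 3 * a t powr (2 - 3 * \<gamma>) + 1)) (at t)))"

definition smooth_wave ::
  "'a set \<Rightarrow> 'a chart set \<Rightarrow> 'a metric \<Rightarrow> (real \<Rightarrow> real) \<Rightarrow> (real \<Rightarrow> 'a \<Rightarrow> real) \<Rightarrow> bool" where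
  "smooth_wave M \<A> g a \<psi> \<longleftrightarrow>
     smooth_spacetime_function \<A> \<psi> \<and>
     (\<forall>t>0. \<forall>p\<in>M.
        - deriv (deriv (\<lambda>s. \<psi> s p)) t + laplacian \<A> g (\<psi> t) p / (a t)\<^sup>2
          - 3 * (deriv a t / a t) * deriv (\<lambda>s. \<psi> s p) t = 0)"

definition energy ::
  "'a chart set \<Rightarrow> 'a metric \<Rightarrow> 'a measure \<Rightarrow> (real \<Rightarrow> real) \<Rightarrow> real \<Rightarrow> (real \<Rightarrow> 'a \<Rightarrow> real) \<Rightarrow> real"
  where
  "energy \<A> g vol a t \<phi> =
     (LINT p|vol. (deriv (\<lambda>s. \<phi> s p) t)\<^sup>2 + grad_norm2 \<A> g (\<phi> t) p / (a t)\<^sup>2)"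

definition energy_N ::
  "'a chart set \<Rightarrow> 'a metric \<Rightarrow> 'a measure \<Rightarrow> (real \<Rightarrow> real) \<Rightarrow> nat \<Rightarrow> real \<Rightarrow> (real \<Rightarrow> 'a \<Rightarrow> real)
    \<Rightarrow> real"
  where
  "energy_N \<A> g vol a N t \<phi> = energy \<A> g vol a t (\<lambda>s. (laplacian \<A> g ^^ N) (\<phi> s))"

definition leading_coefficient ::
  "'a set \<Rightarrow> 'a chart set \<Rightarrow> (real \<Rightarrow> real) \<Rightarrow> (real \<Rightarrow> 'a \<Rightarrow> real) \<Rightarrow> ('a \<Rightarrow> real) \<Rightarrow> bool" where
  "leading_coefficient M \<A> \<omega> \<psi> A \<longleftrightarrow>
     smooth_function \<A> A \<and> uniform_limit M (\<lambda>t p. \<psi> t p / \<omega> t) A (at_right 0)"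

definition chi_type_zero :: "real \<Rightarrow> real \<Rightarrow> real" where
  "chi_type_zero \<gamma> t = t powr (1 - 2 / \<gamma>)"

definition chi_type_minus_one :: "(real \<Rightarrow> real) \<Rightarrow> real \<Rightarrow> real" where
  "chi_type_minus_one a t = integral {t..} (\<lambda>s. 1 / (a s) ^ 3)"

end

theory Submission
  imports Defs
begin

text \<open>
  The proof is an energy argument. Put \<open>U\<^sub>n = \<Delta>\<^sup>n \<psi>\<close>. Then \<open>\<partial>\<^sub>t (a\<^sup>3 \<partial>\<^sub>t U\<^sub>n) = a U\<^sub>n\<^sub>+\<^sub>1\<close>, and \<open>a\<^sup>6 E\<^sub>n(t, \<psi>)\<close> is nondecreasing
  in \<open>t\<close>, so \<open>a\<^sup>3 \<partial>\<^sub>t U\<^sub>n\<close> stays bounded in \<open>L\<^sup>2\<close> and integration in time bounds the norm of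
  \<open>U\<^sub>n\<close> by a multiple of \<open>1 + \<chi>\<close>. Since \<open>a \<chi>\<close> is integrable near the singularity, the momentum
  \<open>a\<^sup>3 \<partial>\<^sub>t U\<^sub>n\<close> converges in \<open>L\<^sup>2\<close>; pairing with test functions, onto which the powers of \<open>\<Delta>\<close> can be
  moved, identifies its limit through the uniform limit \<open>A\<close> of \<open>\<psi> / \<chi>\<close>. The gradient part of the energy
  is controlled by \<open>a\<^sup>4 \<chi>\<^sup>2\<close>, which tends to zero.

  On the manifold this needs only Green's identity and differentiation under the integral.
  Chart invariance of \<open>\<Delta>\<close> and its commutation with \<open>\<partial>\<^sub>t\<close> are obtained weakly, by testing
  against functions, which avoids all second-order coordinate computations.
\<close>

section \<open>Calculus of continuously differentiable functions\<close>

text \<open>The hypothesis on \<open>A\<close> is convergence in the supremum norm, which says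
  nothing about derivatives of \<open>\<psi> / X\<close>; hence the detour through pairings with
  test functions. No limit has to be constructed in L^2: the candidate
  \<open>- k \<Delta>^n A\<close> for the limit of the momentum is known beforehand, so the
  deviation \<open>V\<close> from it is estimated directly, with its own value at one fixed time as
  test function. The price is that level \<open>n\<close> is controlled by the size of level
  \<open>n + 1\<close>. This loss of derivatives is harmless because the wave is smooth and the
  energy bound holds at each level separately, without an induction that would have to close. Both
  types of spacetime are instances of one argument about a function \<open>X\<close> with
  \<open>X' = - k / a^3\<close>, that is, a spatially constant solution of the wave equation. The
  range of \<open>\<gamma>\<close> enters through \<open>e = 3 \<gamma> / 2\<close>:
  \<open>e < 3\<close> makes \<open>X\<close> blow up at the singularity, \<open>e > 1\<close> makes
  \<open>a X\<close> integrable there.\<close>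

lemma Ck_on_lower: "Ck_on (Suc k) S f \<Longrightarrow> Ck_on k S f"
proof (induction k arbitrary: f)
  case 0
  then show ?case
    by (auto intro!: continuous_at_imp_continuous_on differentiable_imp_continuous_within)
next
  case (Suc k)
  then show ?case by (metis Ck_on.simps(2))
qed

lemma Ck_on_le: "Ck_on k S f \<Longrightarrow> j \<le> k \<Longrightarrow> Ck_on j S f"
  by (induction k) (auto simp: le_Suc_eq simp del: Ck_on.simps dest: Ck_on_lower)

lemma Ck_on_subset: "Ck_on k S f \<Longrightarrow> T \<subseteq> S \<Longrightarrow> Ck_on k T f"
  by (induction k arbitrary: f) (auto intro: continuous_on_subset)

lemma Ck_on_continuous: "Ck_on k S f \<Longrightarrow> continuous_on S f"
  using Ck_on_le[of k S f 0] by simp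

lemma Ck_on_differentiable: "Ck_on k S f \<Longrightarrow> 0 < k \<Longrightarrow> x \<in> S \<Longrightarrow> f differentiable (at x)"
  by (cases k) auto

lemma Ck_on_has_derivative:
  "Ck_on k S f \<Longrightarrow> 0 < k \<Longrightarrow> x \<in> S \<Longrightarrow> (f has_derivative frechet_derivative f (at x)) (at x)"
  by (metis Ck_on_differentiable frechet_derivative_works)

text \<open>Differentiability is not assumed: \<open>frechet_derivative\<close> is a choice from the
  set of derivatives at the point, and the two functions have the same set.\<close>

lemma frechet_derivative_eq_on_open:
  assumes "open S" "x \<in> S" "\<And>y. y \<in> S \<Longrightarrow> f y = g y"
  shows "frechet_derivative f (at x) = frechet_derivative g (at x)"
proof -
  have "(f has_derivative f') (at x) \<longleftrightarrow> (g has_derivative f') (at x)" for f'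
    using assms by (metis has_derivative_transform_within_open)
  then show ?thesis unfolding frechet_derivative_def by simp
qed

lemma Ck_on_cong:
  assumes "open S" "\<And>x. x \<in> S \<Longrightarrow> f x = g x" "Ck_on k S f"
  shows "Ck_on k S g"
  using assms(2,3)
proof (induction k arbitrary: f g)
  case 0
  then show ?case using continuous_on_cong by fastforce
next
  case (Suc k)
  have eq: "frechet_derivative f (at x) = frechet_derivative g (at x)" if "x \<in> S" for x
    using frechet_derivative_eq_on_open[OF assms(1) that] Suc.prems(1) by blast
  have "g differentiable (at x)" if "x \<in> S" for x
  proof -
    have "(f has_derivative frechet_derivative f (at x)) (at x)"
      using Suc.prems(2) that frechet_derivative_works by auto
    then have "(g has_derivative frechet_derivative f (at x)) (at x)"
      using assms(1) that Suc.prems(1) by (metis has_derivative_transform_within_open)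
    then show ?thesis unfolding differentiable_def by blast
  qed
  moreover have "Ck_on k S (\<lambda>x. frechet_derivative g (at x) v)" for v
    using Suc.IH[of "\<lambda>x. frechet_derivative f (at x) v"] eq Suc.prems(2) by simp
  ultimately show ?case by simp
qed

text \<open>Lets a derivative be given by any explicit formula, so that inductions on the order can
  avoid the choice in \<open>frechet_derivative\<close>.\<close>

lemma Ck_on_SucI:
  assumes "open S" "\<And>x. x \<in> S \<Longrightarrow> (f has_derivative f' x) (at x)"
    and "\<And>v. Ck_on k S (\<lambda>x. f' x v)"
  shows "Ck_on (Suc k) S f"
proof -
  have eq: "frechet_derivative f (at x) = f' x" if "x \<in> S" for x
    using assms(2)[OF that] by (metis frechet_derivative_at)
  have "f differentiable (at x)" if "x \<in> S" for x
    using assms(2)[OF that] unfolding differentiable_def by blast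
  then show ?thesis using eq Ck_on_cong[OF assms(1) _ assms(3)] by simp
qed

lemma Ck_on_SucD: "Ck_on (Suc k) S f \<Longrightarrow> Ck_on k S (\<lambda>x. frechet_derivative f (at x) v)"
  by simp

lemma Ck_on_Un:
  assumes "open S" "open T" "Ck_on k S f" "Ck_on k T f"
  shows "Ck_on k (S \<union> T) f"
  using assms(3,4)
  by (induction k arbitrary: f) (auto simp: continuous_on_open_Un assms(1,2))

lemma Ck_on_const: "Ck_on k S (\<lambda>x. c)"
  by (induction k arbitrary: c) auto

lemma Ck_on_bounded_linear:
  assumes "open S" "bounded_linear h" "Ck_on k S f"
  shows "Ck_on k S (\<lambda>x. h (f x))"
  using assms(3)
proof (induction k arbitrary: f)
  case 0
  then show ?case using bounded_linear.continuous_on[OF assms(2)] by simp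
next
  case (Suc k)
  show ?case
    by (rule Ck_on_SucI[OF assms(1), of _ "\<lambda>x v. h (frechet_derivative f (at x) v)"])
      (use Suc Ck_on_has_derivative[OF Suc.prems] in
        \<open>auto intro: bounded_linear.has_derivative[OF assms(2)]\<close>)
qed

lemma Ck_on_add:
  assumes "open S" "Ck_on k S f" "Ck_on k S g"
  shows "Ck_on k S (\<lambda>x. f x + g x)"
  using assms(2,3)
proof (induction k arbitrary: f g)
  case 0
  then show ?case by (simp add: continuous_on_add)
next
  case (Suc k)
  show ?case
    by (rule Ck_on_SucI[OF assms(1), of _ "\<lambda>x v. frechet_derivative f (at x) v + frechet_derivative g (at x) v"])
      (use Suc Ck_on_has_derivative[OF Suc.prems(1)] Ck_on_has_derivative[OF Suc.prems(2)] in
        \<open>auto intro: has_derivative_add\<close>)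
qed

lemma Ck_on_sum:
  assumes "open S" "\<And>i. i \<in> I \<Longrightarrow> Ck_on k S (f i)"
  shows "Ck_on k S (\<lambda>x. \<Sum>i\<in>I. f i x)"
  using assms(2)
  by (induction I rule: infinite_finite_induct) (auto intro: Ck_on_const Ck_on_add[OF assms(1)])

lemma Ck_on_bounded_bilinear:
  assumes "open S" "bounded_bilinear p" "Ck_on k S f" "Ck_on k S g"
  shows "Ck_on k S (\<lambda>x. p (f x) (g x))"
  using assms(3,4)
proof (induction k arbitrary: f g)
  case 0
  then show ?case by (simp add: bounded_bilinear.continuous_on[OF assms(2)])
next
  case (Suc k)
  have "Ck_on k S f" "Ck_on k S g" using Suc.prems Ck_on_lower by blast+
  then have "Ck_on k S (\<lambda>x. p (f x) (frechet_derivative g (at x) v) + p (frechet_derivative f (at x) v) (g x))" for v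
    using Suc by (intro Ck_on_add[OF assms(1)] Suc.IH) auto
  then show ?case
    by (intro Ck_on_SucI[OF assms(1), of _ "\<lambda>x v. p (f x) (frechet_derivative g (at x) v) + p (frechet_derivative f (at x) v) (g x)"])
      (use Ck_on_has_derivative[OF Suc.prems(1)] Ck_on_has_derivative[OF Suc.prems(2)] in
        \<open>auto intro: bounded_bilinear.FDERIV[OF assms(2)]\<close>)
qed

lemmas Ck_on_mult = Ck_on_bounded_bilinear[OF _ bounded_bilinear_mult]
lemmas Ck_on_scaleR = Ck_on_bounded_bilinear[OF _ bounded_bilinear_scaleR]
lemmas Ck_on_inner = Ck_on_bounded_bilinear[OF _ bounded_bilinear_inner]

lemma Ck_on_minus: "open S \<Longrightarrow> Ck_on k S f \<Longrightarrow> Ck_on k S (\<lambda>x. - f x)"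
  by (rule Ck_on_bounded_linear[OF _ bounded_linear_minus[OF bounded_linear_ident]])

lemma Ck_on_diff:
  "open S \<Longrightarrow> Ck_on k S f \<Longrightarrow> Ck_on k S g \<Longrightarrow> Ck_on k S (\<lambda>x. f x - g x)"
  using Ck_on_add[of S k f "\<lambda>x. - g x"] Ck_on_minus[of S k g] by simp

lemma Ck_on_ident: "open S \<Longrightarrow> Ck_on k S (\<lambda>x. x)"
  by (cases k) (auto intro!: Ck_on_SucI[of _ _ "\<lambda>x v. v"] Ck_on_const continuous_on_id simp del: Ck_on.simps(2))

lemma Ck_on_prod:
  fixes f :: "_ \<Rightarrow> _ \<Rightarrow> real"
  assumes "open S" "\<And>i. i \<in> I \<Longrightarrow> Ck_on k S (f i)"
  shows "Ck_on k S (\<lambda>x. \<Prod>i\<in>I. f i x)"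
  using assms(2)
  by (induction I rule: infinite_finite_induct) (auto intro: Ck_on_const Ck_on_mult[OF assms(1)])

lemma Ck_on_compose:
  fixes f :: "'b::euclidean_space \<Rightarrow> 'c::real_normed_vector" and g :: "'a::euclidean_space \<Rightarrow> 'b"
  assumes "open S" "open T" "Ck_on k T f" "Ck_on k S g" "g ` S \<subseteq> T"
  shows "Ck_on k S (\<lambda>x. f (g x))"
  using assms(3,4)
proof (induction k arbitrary: f)
  case 0
  then show ?case using assms(5) by (auto intro: continuous_on_compose2)
next
  case (Suc k)
  \<comment> \<open>In the chain rule the direction fed to the derivative of \<open>f\<close> varies
    with \<open>x\<close>. Expanding it in the basis leaves derivatives of \<open>f\<close> in fixed
    directions, to which the induction hypothesis applies.\<close>
  let ?D = "\<lambda>x v. \<Sum>b\<in>Basis. (frechet_derivative g (at x) v \<bullet> b) *\<^sub>R frechet_derivative f (at (g x)) b"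
  have g: "Ck_on k S g" using Suc.prems Ck_on_lower by blast
  have *: "(f has_derivative frechet_derivative f (at (g x))) (at (g x))"
    "(g has_derivative frechet_derivative g (at x)) (at x)" if "x \<in> S" for x
    using that assms(5) by (auto intro!: Ck_on_has_derivative[OF Suc.prems(1)] Ck_on_has_derivative[OF Suc.prems(2)])
  have D: "frechet_derivative f (at (g x)) (frechet_derivative g (at x) v) = ?D x v" if "x \<in> S" for x v
    using *(1)[OF that, THEN has_derivative_linear]
    by (subst euclidean_representation[symmetric, of "frechet_derivative g (at x) v"])
      (simp only: linear_sum linear_scale)
  have "((\<lambda>x. f (g x)) has_derivative ?D x) (at x)" if "x \<in> S" for x
    using has_derivative_compose[OF *(2)[OF that] *(1)[OF that]] D[OF that] by simp
  moreover have "Ck_on k S (\<lambda>x. ?D x v)" for v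
    using Suc.prems
    by (intro Ck_on_sum Ck_on_scaleR Ck_on_inner Ck_on_const assms(1) Suc.IH[OF _ g]) auto
  ultimately show ?case by (rule Ck_on_SucI[OF assms(1)])
qed

lemma Ck_on_inverse:
  fixes f :: "_ \<Rightarrow> real"
  assumes "open S" "Ck_on k S f" "\<And>x. x \<in> S \<Longrightarrow> f x \<noteq> 0"
  shows "Ck_on k S (\<lambda>x. inverse (f x))"
  using assms(2)
proof (induction k)
  case 0
  then show ?case using assms(3) by (auto intro: continuous_on_inverse)
next
  case (Suc k)
  let ?D = "\<lambda>x v. - (inverse (f x) * frechet_derivative f (at x) v * inverse (f x))"
  have "Ck_on k S f" using Suc.prems Ck_on_lower by blast
  then have "Ck_on k S (\<lambda>x. ?D x v)" for v
    using Suc by (intro Ck_on_minus Ck_on_mult assms(1)) auto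
  moreover have "((\<lambda>x. inverse (f x)) has_derivative ?D x) (at x)" if "x \<in> S" for x
    using assms(3)[OF that] Ck_on_has_derivative[OF Suc.prems _ that]
    by (intro Deriv.has_derivative_inverse) auto
  ultimately show ?case by (intro Ck_on_SucI[OF assms(1), of _ ?D]) auto
qed

lemma Ck_on_divide:
  fixes f g :: "_ \<Rightarrow> real"
  assumes "open S" "Ck_on k S f" "Ck_on k S g" "\<And>x. x \<in> S \<Longrightarrow> g x \<noteq> 0"
  shows "Ck_on k S (\<lambda>x. f x / g x)"
  unfolding divide_inverse using assms by (intro Ck_on_mult Ck_on_inverse)

lemma Ck_on_sqrt:
  fixes f :: "_ \<Rightarrow> real"
  assumes "open S" "Ck_on k S f" "\<And>x. x \<in> S \<Longrightarrow> f x > 0"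
  shows "Ck_on k S (\<lambda>x. sqrt (f x))"
proof -
  have "Ck_on k {0<..} sqrt"
  proof (induction k)
    case 0
    then show ?case by (auto intro: continuous_intros)
  next
    case (Suc k)
    have "(sqrt has_derivative (\<lambda>v. v * (inverse (sqrt x) / 2))) (at x)" if "x \<in> {0<..}" for x
      using DERIV_real_sqrt[of x] that by (auto simp: has_field_derivative_def elim!: has_derivative_eq_rhs)
    then show ?case
      using Suc by (intro Ck_on_SucI[where f'="\<lambda>x v. v * (inverse (sqrt x) / 2)"] Ck_on_mult Ck_on_divide Ck_on_inverse Ck_on_const) auto
  qed
  then show ?thesis by (intro Ck_on_compose[OF assms(1) open_greaterThan _ assms(2)]) (use assms(3) in auto)
qed

lemma smooth_onD: "smooth_on S f \<Longrightarrow> Ck_on k S f"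
  by (simp add: smooth_on_def)

lemma Ck_on_zero_extension:
  assumes "open S" "closed K" "K \<subseteq> W" "open W" "Ck_on k W f" "\<And>x. x \<notin> K \<Longrightarrow> f x = 0"
  shows "Ck_on k S f"
proof -
  have "Ck_on k (- K) f"
    by (rule Ck_on_cong[of _ "\<lambda>x. 0"]) (use assms Ck_on_const in auto)
  then have "Ck_on k (W \<union> - K) f" using assms by (intro Ck_on_Un) auto
  then show ?thesis by (rule Ck_on_subset) (use assms in auto)
qed


section \<open>The divergence theorem for compact support\<close>

lemma has_derivative_along:
  fixes F :: "'a::real_normed_vector \<Rightarrow> real"
  assumes "(F has_derivative D) (at (x + t *\<^sub>R v))"
  shows "((\<lambda>t. F (x + t *\<^sub>R v)) has_real_derivative D v) (at t)"
proof -
  have "((\<lambda>t. x + t *\<^sub>R v) has_derivative (\<lambda>t. t *\<^sub>R v)) (at t)"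
    by (auto intro!: derivative_eq_intros)
  from has_derivative_compose[OF this assms] show ?thesis
    using linear_scale[OF has_derivative_linear[OF assms]]
    by (auto simp: has_field_derivative_def elim!: has_derivative_eq_rhs)
qed

text \<open>Lebesgue measure is translation invariant, so every difference quotient of
  \<open>F\<close> has integral zero; dominated convergence passes this on to the
  derivative.\<close>

lemma integral_directional_derivative_eq_0:
  fixes F :: "'a::euclidean_space \<Rightarrow> real"
  assumes F: "Ck_on (Suc 0) UNIV F" and K: "compact K" and F0: "\<And>x. x \<notin> K \<Longrightarrow> F x = 0"
  shows "integral\<^sup>L lborel (\<lambda>x. frechet_derivative F (at x) v) = 0"
proof -
  let ?D = "\<lambda>x. frechet_derivative F (at x) v"
  have cF: "continuous_on UNIV F" using Ck_on_continuous[OF F] .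
  have cD: "continuous_on UNIV ?D" using F by simp
  have FD: "(F has_derivative frechet_derivative F (at x)) (at x)" for x
    using Ck_on_has_derivative[OF F] by simp
  have D0: "?D x = 0" if "x \<notin> K" for x
    using frechet_derivative_eq_on_open[of "- K" x F "\<lambda>x. 0"] that F0 open_Compl[OF compact_imp_closed[OF K]] by auto
  have "bounded (?D ` K)"
    by (rule compact_imp_bounded[OF compact_continuous_image[OF continuous_on_subset[OF cD subset_UNIV] K]])
  then obtain B where Bpos: "B > 0" and B: "\<And>x. x \<in> K \<Longrightarrow> \<bar>?D x\<bar> \<le> B"
    unfolding bounded_pos by auto
  then have B: "\<bar>?D x\<bar> \<le> B" for x using D0[of x] by (cases "x \<in> K") auto
  from compact_imp_bounded[OF K] obtain R where R: "\<And>x. x \<in> K \<Longrightarrow> norm x \<le> R" unfolding bounded_iff by auto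
  \<comment> \<open>The steps \<open>h n\<close> are at most 1, so translation moves a point by at
    most \<open>norm v\<close>, and this ball contains the supports of all difference
    quotients.\<close>
  define K' where "K' = cball (0::'a) (R + norm v)"
  have KK': "K \<subseteq> K'" unfolding K'_def using R by (force intro: add_increasing2)
  define h where "h n = inverse (real (Suc n))" for n
  have h: "0 < h n" "h n \<le> 1" for n unfolding h_def by (auto simp: field_simps)
  define s where "s n x = (F (x + h n *\<^sub>R v) - F x) / h n" for n x
  have intF: "integrable lborel F"
  proof -
    have "integrable lborel (\<lambda>x. indicator K x *\<^sub>R F x)"
      by (rule borel_integrable_compact[OF K]) (rule continuous_on_subset[OF cF subset_UNIV])
    then show ?thesis
      by (rule Bochner_Integration.integrable_cong[THEN iffD1, rotated 2]) (auto simp: indicator_def F0)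
  qed
  have mF: "F \<in> borel_measurable borel" "?D \<in> borel_measurable borel"
    using cF cD by (auto intro: borel_measurable_continuous_onI)
  have tr: "integral\<^sup>L lborel (\<lambda>x. F (x + c)) = integral\<^sup>L lborel F"
    and itr: "integrable lborel (\<lambda>x. F (x + c))" for c
  proof -
    have "integral\<^sup>L lborel F = integral\<^sup>L (distr lborel borel ((+) c)) F" by (simp add: lborel_distr_plus)
    also have "\<dots> = integral\<^sup>L lborel (\<lambda>x. F (c + x))"
      by (subst integral_distr) (use mF in auto)
    finally show "integral\<^sup>L lborel (\<lambda>x. F (x + c)) = integral\<^sup>L lborel F" by (simp add: add.commute)
    have "integrable (distr lborel borel ((+) c)) F" using intF by (simp add: lborel_distr_plus)
    then have "integrable lborel (\<lambda>x. F (c + x))"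
      by (subst (asm) integrable_distr_eq) (use mF in auto)
    then show "integrable lborel (\<lambda>x. F (x + c))" by (simp add: add.commute)
  qed
  have "integral\<^sup>L lborel (s n) = 0" for n
    unfolding s_def using tr itr intF by simp
  moreover have "(\<lambda>n. integral\<^sup>L lborel (s n)) \<longlonglongrightarrow> integral\<^sup>L lborel ?D"
  proof (rule integral_dominated_convergence[where w="\<lambda>x. indicator K' x *\<^sub>R B"])
    show "integrable lborel (\<lambda>x. indicator K' x *\<^sub>R B)"
      by (rule borel_integrable_compact) (auto simp: K'_def)
    show "s n \<in> borel_measurable lborel" for n
      unfolding s_def using mF by measurable
    show "?D \<in> borel_measurable lborel" using mF by simp
    show "AE x in lborel. (\<lambda>n. s n x) \<longlonglongrightarrow> ?D x"
    proof (rule AE_I2)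
      fix x
      have "((\<lambda>t. F (x + t *\<^sub>R v)) has_real_derivative ?D x) (at 0)"
        by (rule has_derivative_along) (use FD in simp)
      then have "((\<lambda>t. (F (x + t *\<^sub>R v) - F x) / t) \<longlongrightarrow> ?D x) (at 0)"
        by (simp add: DERIV_def)
      moreover have "filterlim h (at 0) sequentially"
        unfolding filterlim_at h_def using LIMSEQ_inverse_real_of_nat by auto
      ultimately show "(\<lambda>n. s n x) \<longlonglongrightarrow> ?D x"
        unfolding s_def by (rule filterlim_compose)
    qed
    show "AE x in lborel. norm (s n x) \<le> indicator K' x *\<^sub>R B" for n
    proof (rule AE_I2)
      fix x
      have "\<exists>z. 0 < z \<and> z < h n \<and> F (x + h n *\<^sub>R v) - F (x + 0 *\<^sub>R v) = (h n - 0) * ?D (x + z *\<^sub>R v)"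
        by (rule MVT2) (use h in \<open>auto intro: has_derivative_along FD\<close>)
      then obtain z where z: "0 < z" "z < h n" "F (x + h n *\<^sub>R v) - F x = h n * ?D (x + z *\<^sub>R v)" by auto
      then have sn: "s n x = ?D (x + z *\<^sub>R v)" unfolding s_def using h[of n] by simp
      have "x \<in> K'" if "?D (x + z *\<^sub>R v) \<noteq> 0"
      proof -
        have "norm (x + z *\<^sub>R v) \<le> R" using R D0 that by blast
        moreover have "norm (z *\<^sub>R v) \<le> norm v" using z h[of n] by (simp add: mult_left_le_one_le)
        moreover have "norm x \<le> norm (x + z *\<^sub>R v) + norm (z *\<^sub>R v)"
          using norm_triangle_ineq4[of "x + z *\<^sub>R v" "z *\<^sub>R v"] by simp
        ultimately show ?thesis unfolding K'_def by simp
      qed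
      then show "norm (s n x) \<le> indicator K' x *\<^sub>R B"
        unfolding sn using B[of "x + z *\<^sub>R v"] Bpos by (cases "?D (x + z *\<^sub>R v) = 0") (auto simp: indicator_def)
    qed
  qed
  ultimately show ?thesis by (simp add: LIMSEQ_const_iff)
qed

section \<open>Inverses and determinants of matrices\<close>

lemma matrix_inv_unique:
  fixes A B :: "real^'n^'n"
  assumes "A ** B = mat 1" "B ** A = mat 1"
  shows "matrix_inv A = B"
proof -
  have "A ** matrix_inv A = mat 1 \<and> matrix_inv A ** A = mat 1"
    unfolding matrix_inv_def by (rule someI) (use assms in auto)
  then have "B ** (A ** matrix_inv A) = B" by simp
  then show ?thesis by (simp add: matrix_mul_assoc assms)
qed

lemma matrix_inv_right_left:
  fixes A :: "real^'n^'n"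
  assumes "det A \<noteq> 0"
  shows "A ** matrix_inv A = mat 1" "matrix_inv A ** A = mat 1"
proof -
  obtain B where "A ** B = mat 1 \<and> B ** A = mat 1"
    using assms invertible_det_nz[of A] unfolding invertible_def by auto
  then have "A ** matrix_inv A = mat 1 \<and> matrix_inv A ** A = mat 1"
    unfolding matrix_inv_def by (rule someI)
  then show "A ** matrix_inv A = mat 1" "matrix_inv A ** A = mat 1" by auto
qed

text \<open>Exhibits the entries of the inverse as quotients of polynomials in the entries of
  \<open>A\<close>, from which their smoothness follows.\<close>

lemma matrix_inv_cramer:
  fixes A :: "real^'n^'n"
  assumes "det A \<noteq> 0"
  shows "matrix_inv A $ i $ j = det (\<chi> r s. if s = i then axis j 1 $ r else A $ r $ s) / det A"
proof -
  have "A *v (matrix_inv A *v axis j 1) = axis j 1"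
    by (simp add: matrix_vector_mul_assoc matrix_inv_right_left[OF assms])
  then have "matrix_inv A *v axis j 1 = (\<chi> k. det (\<chi> r s. if s = k then axis j 1 $ r else A $ r $ s) / det A)"
    using cramer[OF assms, of "matrix_inv A *v axis j 1" "axis j 1"] by simp
  moreover have "(matrix_inv A *v axis j 1) $ i = matrix_inv A $ i $ j"
    by (simp add: matrix_vector_mult_basis column_def)
  ultimately show ?thesis by simp
qed

lemma det_nonzero_posdef:
  fixes A :: "real^'n^'n"
  assumes "\<And>v. v \<noteq> 0 \<Longrightarrow> v \<bullet> (A *v v) > 0"
  shows "det A \<noteq> 0"
proof -
  have "A *v x = 0 \<Longrightarrow> x = 0" for x using assms[of x] by force
  then have "invertible A" using matrix_left_invertible_ker invertible_left_inverse by blast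
  then show ?thesis by (simp add: invertible_det_nz)
qed

text \<open>On the segment from the identity to \<open>A\<close> the determinant never vanishes.\<close>

lemma det_pos_posdef:
  fixes A :: "real^'n^'n"
  assumes A: "\<And>v. v \<noteq> 0 \<Longrightarrow> v \<bullet> (A *v v) > 0"
  shows "det A > 0"
proof (rule ccontr)
  assume neg: "\<not> det A > 0"
  define B where "B t = (\<chi> i j. (1 - t) * (mat 1 :: real^'n^'n) $ i $ j + t * A $ i $ j)" for t :: real
  have Bv: "B t *v v = (1 - t) *\<^sub>R v + t *\<^sub>R (A *v v)" for t v
  proof -
    have "B t = (1 - t) *\<^sub>R mat 1 + t *\<^sub>R A" unfolding B_def by (simp add: vec_eq_iff)
    then show ?thesis
      by (metis matrix_vector_mul_lid matrix_vector_mult_add_rdistrib scaleR_matrix_vector_assoc)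
  qed
  have nz: "det (B t) \<noteq> 0" if "0 \<le> t" "t \<le> 1" for t
  proof (rule det_nonzero_posdef)
    fix v :: "real^'n" assume v: "v \<noteq> 0"
    then have "v \<bullet> v > 0" "v \<bullet> (A *v v) > 0" using A by auto
    moreover have "v \<bullet> (B t *v v) = (1 - t) * (v \<bullet> v) + t * (v \<bullet> (A *v v))"
      by (simp add: Bv inner_add_right)
    ultimately show "v \<bullet> (B t *v v) > 0" using that
      by (smt (verit, best) mult_nonneg_nonneg mult_pos_pos)
  qed
  have "continuous_on {0..1} (\<lambda>t. det (B t))"
    unfolding det_def B_def by (intro continuous_intros)
  moreover have "B 1 = A" "B 0 = mat 1" unfolding B_def by (simp_all add: vec_eq_iff)
  ultimately obtain t where "0 \<le> t" "t \<le> 1" "det (B t) = 0"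
    using IVT2'[of "\<lambda>t. det (B t)" 1 0 0] neg by auto
  with nz show False by blast
qed

lemma Ck_on_vec_nth:
  assumes "open S" "Ck_on k S f" shows "Ck_on k S (\<lambda>x. f x $ i)"
  using Ck_on_bounded_linear[OF assms(1) bounded_linear_vec_nth assms(2)] .

lemma Ck_on_det:
  fixes G :: "_ \<Rightarrow> real^'n^'n"
  assumes "open S" "\<And>i j. Ck_on k S (\<lambda>x. G x $ i $ j)"
  shows "Ck_on k S (\<lambda>x. det (G x))"
  unfolding det_def by (intro Ck_on_sum Ck_on_mult Ck_on_prod Ck_on_const assms)

lemma Ck_on_matrix_inv:
  fixes G :: "_ \<Rightarrow> real^'n^'n"
  assumes S: "open S" and G: "Ck_on k S G" and nz: "\<And>x. x \<in> S \<Longrightarrow> det (G x) \<noteq> 0"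
  shows "Ck_on k S (\<lambda>x. matrix_inv (G x) $ i $ j)"
proof -
  have e: "Ck_on k S (\<lambda>x. G x $ r $ s)" for r s using Ck_on_vec_nth[OF S Ck_on_vec_nth[OF S G]] .
  have "Ck_on k S (\<lambda>x. det (\<chi> r s. if s = i then axis j 1 $ r else G x $ r $ s) / det (G x))"
  proof (intro Ck_on_divide S Ck_on_det e nz)
    fix r s show "Ck_on k S (\<lambda>x. (\<chi> r s. if s = i then axis j 1 $ r else G x $ r $ s) $ r $ s)"
      by (cases "s = i") (simp_all add: e Ck_on_const)
  qed
  then show ?thesis by (rule Ck_on_cong[OF S, rotated]) (simp add: matrix_inv_cramer[OF nz])
qed


section \<open>Green's identity in coordinates\<close>

lemma partial_has_derivative: "(u has_derivative D) (at x) \<Longrightarrow> partial i u x = D (axis i 1)"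
  unfolding partial_def by (metis frechet_derivative_at)

lemma partial_cong:
  "open S \<Longrightarrow> x \<in> S \<Longrightarrow> (\<And>y. y \<in> S \<Longrightarrow> u y = v y) \<Longrightarrow> partial i u x = partial i v x"
  unfolding partial_def by (metis frechet_derivative_eq_on_open)

lemma partial_mult:
  "u differentiable (at x) \<Longrightarrow> v differentiable (at x) \<Longrightarrow>
    partial i (\<lambda>y. u y * v y) x = u x * partial i v x + partial i u x * v x"
  by (subst partial_has_derivative[OF has_derivative_mult])
    (auto simp: partial_def frechet_derivative_works[symmetric])

lemma partial_const [simp]: "partial i (\<lambda>y. c) x = 0"
  by (simp add: partial_def)

lemma partial_sum:
  assumes "\<And>j. j \<in> I \<Longrightarrow> u j differentiable (at x)"
  shows "partial i (\<lambda>y. \<Sum>j\<in>I. u j y) x = (\<Sum>j\<in>I. partial i (u j) x)"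
proof -
  have "((\<lambda>y. \<Sum>j\<in>I. u j y) has_derivative (\<lambda>v. \<Sum>j\<in>I. frechet_derivative (u j) (at x) v)) (at x)"
    using assms by (intro has_derivative_sum) (simp add: frechet_derivative_works[symmetric])
  from partial_has_derivative[OF this] show ?thesis by (simp add: partial_def)
qed

lemma differentiable_vec_nth2:
  fixes G :: "_ \<Rightarrow> real^'n^'m"
  assumes "G differentiable (at x)" shows "(\<lambda>y. G y $ i $ j) differentiable (at x)"
proof -
  obtain D where "(G has_derivative D) (at x)" using assms unfolding differentiable_def by blast
  from bounded_linear.has_derivative[OF bounded_linear_vec_nth
      bounded_linear.has_derivative[OF bounded_linear_vec_nth this]]
  show ?thesis unfolding differentiable_def by blast
qed

text \<open>Jacobi's formula. In dimension three the determinant is an explicit polynomial that can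
  be differentiated termwise; the coefficients found are the numerators in Cramer's rule.\<close>

lemma partial_det:
  fixes G :: "real^3 \<Rightarrow> real^3^3"
  assumes "G differentiable (at x)" "det (G x) \<noteq> 0"
  shows "partial l (\<lambda>y. det (G y)) x =
    det (G x) * (\<Sum>i\<in>UNIV. \<Sum>j\<in>UNIV. matrix_inv (G x) $ j $ i * partial l (\<lambda>y. G y $ i $ j) x)"
proof -
  have d: "(\<lambda>y. G y $ i $ j) differentiable (at x)" for i j
    by (rule differentiable_vec_nth2[OF assms(1)])
  have D: "((\<lambda>y. G y $ i $ j) has_derivative frechet_derivative (\<lambda>y. G y $ i $ j) (at x)) (at x)" for i j
    using d frechet_derivative_works by blast
  have *: "((\<lambda>y. det (G y)) has_derivative (\<lambda>v.
     \<Sum>i\<in>UNIV. \<Sum>j\<in>UNIV. det (\<chi> r s. if s = j then axis i 1 $ r else G x $ r $ s)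
       * frechet_derivative (\<lambda>y. G y $ i $ j) (at x) v)) (at x)"
    unfolding det_3 by (rule derivative_eq_intros D refl)+
      (simp add: fun_eq_iff sum_3 axis_def algebra_simps)
  show ?thesis
    unfolding partial_has_derivative[OF *] sum_distrib_left
    using assms(2) by (simp add: matrix_inv_cramer partial_def)
qed

locale coordinate_metric =
  fixes V :: "(real^3) set" and G :: "real^3 \<Rightarrow> real^3^3"
  assumes V: "open V"
    and smooth: "smooth_on V G"
    and sym: "x \<in> V \<Longrightarrow> transpose (G x) = G x"
    and posdef: "x \<in> V \<Longrightarrow> v \<noteq> 0 \<Longrightarrow> v \<bullet> (G x *v v) > 0"
begin

definition ginv :: "3 \<Rightarrow> 3 \<Rightarrow> real^3 \<Rightarrow> real" where
  "ginv i j x = matrix_inv (G x) $ i $ j"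

definition rho :: "real^3 \<Rightarrow> real" where
  "rho x = sqrt (det (G x))"

text \<open>The inner product of two gradients, not a vector field.\<close>

definition grad :: "(real^3 \<Rightarrow> real) \<Rightarrow> (real^3 \<Rightarrow> real) \<Rightarrow> real^3 \<Rightarrow> real" where
  "grad u v x = (\<Sum>i\<in>UNIV. \<Sum>j\<in>UNIV. ginv i j x * partial i u x * partial j v x)"

lemma det_pos: "x \<in> V \<Longrightarrow> det (G x) > 0"
  using det_pos_posdef posdef by blast

lemma rho_pos: "x \<in> V \<Longrightarrow> rho x > 0"
  using det_pos by (simp add: rho_def)

lemma Ck_G: "Ck_on k V (\<lambda>x. G x $ i $ j)"
  using Ck_on_vec_nth[OF V Ck_on_vec_nth[OF V smooth_onD[OF smooth]]] .

lemma Ck_ginv: "Ck_on k V (ginv i j)"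
  unfolding ginv_def[abs_def]
  by (rule Ck_on_matrix_inv[OF V smooth_onD[OF smooth]]) (use det_pos in force)

lemma Ck_rho: "Ck_on k V rho"
  unfolding rho_def[abs_def] by (intro Ck_on_sqrt V Ck_on_det Ck_G det_pos)

lemma Ck_partial: "Ck_on (Suc k) S u \<Longrightarrow> Ck_on k S (partial i u)"
  unfolding partial_def[abs_def] by (rule Ck_on_SucD)

lemma G_sym: "x \<in> V \<Longrightarrow> G x $ i $ j = G x $ j $ i"
  using arg_cong[OF sym[of x], of "\<lambda>A. A $ i $ j"] by (simp add: transpose_def)

lemma ginv_sym:
  assumes "x \<in> V" shows "ginv i j x = ginv j i x"
proof -
  have nz: "det (G x) \<noteq> 0" using det_pos[OF assms] by simp
  have "matrix_inv (G x) = transpose (matrix_inv (G x))"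
  proof (rule matrix_inv_unique)
    show "G x ** transpose (matrix_inv (G x)) = mat 1"
      using arg_cong[OF matrix_inv_right_left(2)[OF nz], of transpose]
      by (simp add: matrix_transpose_mul sym[OF assms])
    show "transpose (matrix_inv (G x)) ** G x = mat 1"
      using arg_cong[OF matrix_inv_right_left(1)[OF nz], of transpose]
      by (simp add: matrix_transpose_mul sym[OF assms])
  qed
  from arg_cong[OF this, of "\<lambda>A. A $ i $ j"] show ?thesis
    unfolding ginv_def by (simp add: transpose_def)
qed

lemma ginv_G:
  assumes "x \<in> V" shows "(\<Sum>a\<in>UNIV. ginv i a x * G x $ a $ j) = (if i = j then 1 else 0)"
    "(\<Sum>a\<in>UNIV. G x $ i $ a * ginv a j x) = (if i = j then 1 else 0)"
proof -
  have nz: "det (G x) \<noteq> 0" using det_pos[OF assms] by simp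
  show "(\<Sum>a\<in>UNIV. ginv i a x * G x $ a $ j) = (if i = j then 1 else 0)"
    using arg_cong[OF matrix_inv_right_left(2)[OF nz], of "\<lambda>A. A $ i $ j"]
    by (simp add: matrix_matrix_mult_def mat_def ginv_def)
  show "(\<Sum>a\<in>UNIV. G x $ i $ a * ginv a j x) = (if i = j then 1 else 0)"
    using arg_cong[OF matrix_inv_right_left(1)[OF nz], of "\<lambda>A. A $ i $ j"]
    by (simp add: matrix_matrix_mult_def mat_def ginv_def)
qed

lemma diff_ginv: "x \<in> V \<Longrightarrow> ginv i j differentiable (at x)"
  using Ck_on_differentiable[OF Ck_ginv[of 1]] by simp

lemma diff_G: "x \<in> V \<Longrightarrow> (\<lambda>y. G y $ i $ j) differentiable (at x)"
  using Ck_on_differentiable[OF Ck_G[of 1]] by simp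

lemma diff_rho: "x \<in> V \<Longrightarrow> rho differentiable (at x)"
  using Ck_on_differentiable[OF Ck_rho[of 1]] by simp

text \<open>Differentiate the identity that the inverse matrix times \<open>G\<close> is constant,
  then multiply by the inverse once more.\<close>

lemma partial_ginv:
  assumes x: "x \<in> V"
  shows "partial l (ginv i j) x =
    - (\<Sum>a\<in>UNIV. \<Sum>b\<in>UNIV. ginv i a x * ginv j b x * partial l (\<lambda>y. G y $ a $ b) x)"
proof -
  let ?dG = "\<lambda>a b. partial l (\<lambda>y. G y $ a $ b) x"
  let ?dI = "\<lambda>a. partial l (ginv i a) x"
  have *: "(\<Sum>a\<in>UNIV. ginv i a x * ?dG a b + ?dI a * G x $ a $ b) = 0" for b
  proof -
    have "partial l (\<lambda>y. \<Sum>a\<in>UNIV. ginv i a y * G y $ a $ b) x = 0"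
      using partial_cong[OF V x, of "\<lambda>y. \<Sum>a\<in>UNIV. ginv i a y * G y $ a $ b" "\<lambda>y. if i = b then 1 else 0"] ginv_G(1)
      by simp
    moreover have "partial l (\<lambda>y. \<Sum>a\<in>UNIV. ginv i a y * G y $ a $ b) x
      = (\<Sum>a\<in>UNIV. ginv i a x * ?dG a b + ?dI a * G x $ a $ b)"
      by (subst partial_sum) (auto intro!: differentiable_mult simp: partial_mult diff_ginv[OF x] diff_G[OF x])
    ultimately show ?thesis by simp
  qed
  have "?dI j = (\<Sum>a\<in>UNIV. ?dI a * (\<Sum>b\<in>UNIV. G x $ a $ b * ginv b j x))"
    by (simp add: ginv_G(2)[OF x] if_distrib[of "(*) _"] cong: if_cong)
  also have "\<dots> = (\<Sum>b\<in>UNIV. ginv b j x * (\<Sum>a\<in>UNIV. ?dI a * G x $ a $ b))"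
    by (simp add: sum_distrib_left sum_distrib_right mult_ac) (rule sum.swap)
  also have "\<dots> = (\<Sum>b\<in>UNIV. ginv b j x * - (\<Sum>a\<in>UNIV. ginv i a x * ?dG a b))"
  proof -
    have "(\<Sum>a\<in>UNIV. ?dI a * G x $ a $ b) = - (\<Sum>a\<in>UNIV. ginv i a x * ?dG a b)" for b
      using *[of b] by (simp add: sum.distrib eq_neg_iff_add_eq_0 add.commute)
    then show ?thesis by simp
  qed
  also have "\<dots> = - (\<Sum>a\<in>UNIV. \<Sum>b\<in>UNIV. ginv i a x * ginv j b x * ?dG a b)"
    by (subst sum.swap) (simp add: sum_distrib_left sum_distrib_right sum_negf mult_ac ginv_sym[OF x, of _ j])
  finally show ?thesis .
qed

lemma partial_rho:
  assumes x: "x \<in> V"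
  shows "partial l rho x =
    rho x / 2 * (\<Sum>a\<in>UNIV. \<Sum>b\<in>UNIV. ginv a b x * partial l (\<lambda>y. G y $ a $ b) x)"
proof -
  have dp: "det (G x) > 0" using det_pos[OF x] .
  have dG: "G differentiable (at x)"
    using Ck_on_differentiable[OF smooth_onD[OF smooth, of 1]] x by simp
  have dd: "(\<lambda>y. det (G y)) differentiable (at x)"
    using Ck_on_differentiable[OF Ck_on_det[OF V Ck_G, of 1]] x by simp
  have "(rho has_derivative (\<lambda>v. frechet_derivative (\<lambda>y. det (G y)) (at x) v * (inverse (sqrt (det (G x))) / 2))) (at x)"
    unfolding rho_def[abs_def]
    using has_derivative_compose[OF dd[unfolded frechet_derivative_works] DERIV_real_sqrt[OF dp, unfolded has_field_derivative_def]]
    by (auto elim!: has_derivative_eq_rhs simp: mult.commute)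
  then have "partial l rho x = partial l (\<lambda>y. det (G y)) x * (inverse (sqrt (det (G x))) / 2)"
    by (subst partial_has_derivative) (auto simp: partial_def)
  also have "\<dots> = det (G x) * inverse (sqrt (det (G x))) / 2 * (\<Sum>a\<in>UNIV. \<Sum>b\<in>UNIV. ginv b a x * partial l (\<lambda>y. G y $ a $ b) x)"
    using partial_det[OF dG] dp by (simp add: ginv_def)
  also have "det (G x) * inverse (sqrt (det (G x))) = rho x"
    using dp unfolding rho_def by (metis divide_inverse less_eq_real_def real_div_sqrt)
  finally show ?thesis by (simp add: ginv_sym[OF x])
qed

text \<open>The contracted Christoffel symbols are the first-order coefficients of the Laplacian.
  Identifying them with a divergence is what puts \<open>coord_laplacian\<close> into divergence
  form.\<close>

lemma divergence_ginv:
  assumes x: "x \<in> V"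
  shows "(\<Sum>i\<in>UNIV. partial i (\<lambda>y. rho y * ginv i k y) x) =
    - rho x * (\<Sum>i\<in>UNIV. \<Sum>j\<in>UNIV. ginv i j x * christoffel G k i j x)"
proof -
  define h where "h i j = ginv i j x" for i j
  define d where "d l i j = partial l (\<lambda>y. G y $ i $ j) x" for l i j
  define r where "r = rho x"
  have h: "h i j = h j i" for i j unfolding h_def using ginv_sym[OF x] .
  have d: "d l i j = d l j i" for l i j
    unfolding d_def by (rule partial_cong[OF V x G_sym])
  have p: "partial i (\<lambda>y. rho y * ginv i k y) x =
     r * - (\<Sum>a\<in>UNIV. \<Sum>b\<in>UNIV. h i a * h k b * d i a b) + r / 2 * (\<Sum>a\<in>UNIV. \<Sum>b\<in>UNIV. h a b * d i a b) * h i k" for i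
    by (simp add: partial_mult diff_rho[OF x] diff_ginv[OF x] partial_ginv[OF x] partial_rho[OF x] h_def d_def r_def)
  have c: "christoffel G k i j x = (1/2) * (\<Sum>l\<in>UNIV. h k l * (d i j l + d j i l - d l i j))" for i j
    unfolding christoffel_def h_def d_def ginv_def ..
  \<comment> \<open>Oriented as rewrite rules, the symmetries give equal entries of \<open>h\<close>
    and \<open>d\<close> one name; what remains is a polynomial identity in these entries.\<close>
  have e: "h 2 1 = h 1 2" "h 3 1 = h 1 3" "h 3 2 = h 2 3" "h 1 k = h k 1" "h 2 k = h k 2" "h 3 k = h k 3"
    "d l 2 1 = d l 1 2" "d l 3 1 = d l 1 3" "d l 3 2 = d l 2 3" for l
    using h d by blast+
  show ?thesis
    unfolding p c r_def[symmetric] h_def[symmetric] sum_3 e by (simp add: field_simps)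
qed

text \<open>The product rule for the divergence of \<open>f\<close> times the gradient of
  \<open>u\<close>, weighted by \<open>rho\<close>. By \<open>divergence_ginv\<close> the
  derivatives of the coefficients supply exactly the first-order part of the Laplacian.\<close>

lemma divergence_grad:
  assumes x: "x \<in> V" and f: "f differentiable (at x)" and u: "Ck_on 2 V u"
  shows "(\<Sum>i\<in>UNIV. partial i (\<lambda>y. f y * (\<Sum>j\<in>UNIV. rho y * ginv i j y * partial j u y)) x) =
    rho x * (f x * coord_laplacian G u x + grad f u x)"
proof -
  have du: "partial j u differentiable (at x)" for j
    using Ck_on_differentiable[OF Ck_partial[of 1 V u]] u x by (simp add: numeral_2_eq_2)
  have dr: "(\<lambda>y. rho y * ginv i j y) differentiable (at x)" for i j
    by (intro differentiable_mult diff_rho diff_ginv x)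
  have dru: "(\<lambda>y. rho y * ginv i j y * partial j u y) differentiable (at x)" for i j
    by (intro differentiable_mult dr du)
  have ds: "(\<lambda>y. \<Sum>j\<in>UNIV. rho y * ginv i j y * partial j u y) differentiable (at x)" for i
    by (intro differentiable_sum ballI dru) simp
  have "(\<Sum>i\<in>UNIV. partial i (\<lambda>y. f y * (\<Sum>j\<in>UNIV. rho y * ginv i j y * partial j u y)) x)
    = (\<Sum>i\<in>UNIV. f x * (\<Sum>j\<in>UNIV. rho x * ginv i j x * partial i (partial j u) x + partial i (\<lambda>y. rho y * ginv i j y) x * partial j u x))
     + rho x * grad f u x"
    unfolding partial_mult[OF f ds] partial_sum[OF dru] partial_mult[OF dr du] grad_def
    by (simp add: sum.distrib sum_distrib_left sum_distrib_right mult_ac)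
  also have "(\<Sum>i\<in>UNIV. f x * (\<Sum>j\<in>UNIV. rho x * ginv i j x * partial i (partial j u) x + partial i (\<lambda>y. rho y * ginv i j y) x * partial j u x))
     = f x * (rho x * (\<Sum>i\<in>UNIV. \<Sum>j\<in>UNIV. ginv i j x * partial i (partial j u) x)
        + (\<Sum>j\<in>UNIV. partial j u x * (\<Sum>i\<in>UNIV. partial i (\<lambda>y. rho y * ginv i j y) x)))"
    unfolding sum_3 by (simp add: algebra_simps)
  also have "\<dots> = rho x * f x * coord_laplacian G u x"
    unfolding divergence_ginv[OF x] coord_laplacian_def covariant_hessian_def ginv_def[symmetric] sum_3
    by (simp add: algebra_simps)
  finally show ?thesis by (simp add: algebra_simps)
qed

lemma green_compact_support:
  assumes f: "Ck_on 1 V f" and u: "Ck_on 2 V u" and K: "compact K" "K \<subseteq> V"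
    and f0: "\<And>x. x \<in> V \<Longrightarrow> x \<notin> K \<Longrightarrow> f x = 0"
  shows "integral\<^sup>L lborel (\<lambda>x. indicator V x * (rho x * (f x * coord_laplacian G u x + grad f u x))) = 0"
proof -
  \<comment> \<open>The components of the vector field \<open>f rho grad u\<close>, extended by
    zero. They are \<open>C^1\<close> on the whole space since they vanish off the compact set
    \<open>K\<close> inside the open set \<open>V\<close>.\<close>
  define F where "F i x = (if x \<in> V then f x * (\<Sum>j\<in>UNIV. rho x * ginv i j x * partial j u x) else 0)" for i x
  have F0: "F i x = 0" if "x \<notin> K" for i x using that f0 K by (auto simp: F_def)
  have cf: "Ck_on 1 V (\<lambda>x. f x * (\<Sum>j\<in>UNIV. rho x * ginv i j x * partial j u x))" for i
    using u by (intro Ck_on_mult Ck_on_sum V f Ck_rho Ck_ginv Ck_partial) (simp add: numeral_2_eq_2)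
  have FV: "Ck_on 1 V (F i)" for i
    by (rule Ck_on_cong[OF V _ cf[of i]]) (simp add: F_def)
  have F1: "Ck_on 1 UNIV (F i)" for i
    by (rule Ck_on_zero_extension[OF open_UNIV compact_imp_closed[OF K(1)] K(2) V FV F0])
  have int0: "integral\<^sup>L lborel (partial i (F i)) = 0" for i
    unfolding partial_def[abs_def]
    by (rule integral_directional_derivative_eq_0[OF F1[unfolded One_nat_def] K(1) F0])
  have cp: "continuous_on UNIV (partial i (F i))" for i
    using Ck_partial[of 0 UNIV "F i" i] F1[of i] by simp
  have p0: "partial i (F i) x = 0" if "x \<notin> K" for i x
    using partial_cong[of "- K" x "F i" "\<lambda>x. 0"] that F0 open_Compl[OF compact_imp_closed[OF K(1)]] by simp
  have ig: "integrable lborel (partial i (F i))" for i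
  proof -
    have "integrable lborel (\<lambda>x. indicator K x *\<^sub>R partial i (F i) x)"
      by (rule borel_integrable_compact[OF K(1) continuous_on_subset[OF cp subset_UNIV]])
    then show ?thesis
      by (rule Bochner_Integration.integrable_cong[THEN iffD1, rotated 2]) (auto simp: indicator_def p0)
  qed
  have "indicator V x * (rho x * (f x * coord_laplacian G u x + grad f u x)) = (\<Sum>i\<in>UNIV. partial i (F i) x)" for x
  proof (cases "x \<in> V")
    case True
    have "partial i (F i) x = partial i (\<lambda>y. f y * (\<Sum>j\<in>UNIV. rho y * ginv i j y * partial j u y)) x" for i
      by (rule partial_cong[OF V True]) (simp add: F_def)
    then show ?thesis
      using divergence_grad[OF True _ u] Ck_on_differentiable[OF f _ True] True by simp
  next
    case False
    then have "x \<notin> K" using K by auto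
    then show ?thesis using False by (simp add: p0)
  qed
  then show ?thesis using int0 ig by simp
qed

end


section \<open>Closed Riemannian manifolds\<close>

lemma at_within_openin:
  assumes "openin (top_of_set M) U" "p \<in> U"
  shows "at p within U = at p within M"
proof -
  obtain T where T: "open T" "U = M \<inter> T" using assms(1) by (auto simp: openin_open)
  then show ?thesis using assms(2) by (intro at_within_nhd[of p T]) auto
qed

text \<open>The profile of the bump functions. Green's identity asks for only one derivative of the
  test function, so this replaces the usual smooth exponential cutoff.\<close>

lemma Ck_on_max0_square: "Ck_on 1 UNIV (\<lambda>s::real. (max 0 s)\<^sup>2)"
  unfolding One_nat_def
proof (rule Ck_on_SucI[where f' = "\<lambda>s v. v * (2 * max 0 s)"])
  fix s :: real
  have "((\<lambda>s. (max 0 s)\<^sup>2) has_real_derivative 2 * max 0 s) (at s)"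
  proof (cases "s = 0")
    case True
    have "((\<lambda>h::real. (max 0 h)\<^sup>2 / h) \<longlongrightarrow> 0) (at 0)"
    proof (rule Lim_null_comparison)
      show "\<forall>\<^sub>F h in at 0. norm ((max 0 h)\<^sup>2 / h) \<le> \<bar>h\<bar>"
        by (auto simp: max_def power2_eq_square)
      show "((\<lambda>h::real. \<bar>h\<bar>) \<longlongrightarrow> 0) (at 0)" by (rule tendsto_rabs_zero) auto
    qed
    with True show ?thesis by (simp add: DERIV_def)
  next
    case False
    show ?thesis
    proof (cases "s > 0")
      case True
      then have "((\<lambda>s. s\<^sup>2) has_real_derivative 2 * max 0 s) (at s)"
        by (auto intro!: derivative_eq_intros)
      then show ?thesis
        by (rule has_field_derivative_transform_within_open[of _ _ _ "{0<..}"]) (use True in auto)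
    next
      case 2: False
      have "((\<lambda>s. 0) has_real_derivative 2 * max 0 s) (at s)" using 2 by simp
      then show ?thesis
        by (rule has_field_derivative_transform_within_open[of _ _ _ "{..<0}"]) (use 2 False in auto)
    qed
  qed
  then show "((\<lambda>s. (max 0 s)\<^sup>2) has_derivative (\<lambda>v. v * (2 * max 0 s))) (at s)"
    by (auto simp: has_field_derivative_def elim!: has_derivative_eq_rhs)
next
  show "Ck_on 0 UNIV (\<lambda>x. v * (2 * max 0 x))" for v :: real
    by (auto intro!: continuous_intros)
qed auto

locale closed_riemannian =
  fixes M :: "'a::t2_space set" and \<A> :: "'a chart set" and g :: "'a metric" and vol :: "'a measure"
  assumes closed_riemannian: "closed_riemannian_3manifold M \<A> g"
    and volume: "riemannian_volume M \<A> g vol"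
begin

lemma compact_M: "compact M"
  using closed_riemannian by (simp add: closed_riemannian_3manifold_def closed_3manifold_def)

lemma atlas: "smooth_atlas M \<A>"
  using closed_riemannian by (simp add: closed_riemannian_3manifold_def closed_3manifold_def)

lemma metric: "riemannian_metric \<A> g"
  using closed_riemannian by (simp add: closed_riemannian_3manifold_def)

lemma chart:
  assumes "c \<in> \<A>"
  shows "openin (top_of_set M) (chart_dom c)" "open (chart_img c)"
    "homeomorphism (chart_dom c) (chart_img c) (snd c) (chart_inv c)"
  using atlas assms by (auto simp: smooth_atlas_def is_chart_def)

lemma chart_dom_subset: "c \<in> \<A> \<Longrightarrow> chart_dom c \<subseteq> M"
  using chart(1) openin_imp_subset by blast

lemma ex_chart: "p \<in> M \<Longrightarrow> \<exists>c\<in>\<A>. p \<in> chart_dom c"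
  using atlas by (auto simp: smooth_atlas_def)

lemma chart_inv_snd [simp]: "c \<in> \<A> \<Longrightarrow> p \<in> chart_dom c \<Longrightarrow> chart_inv c (snd c p) = p"
  using chart(3) by (rule homeomorphism_apply1)

lemma snd_chart_inv [simp]: "c \<in> \<A> \<Longrightarrow> x \<in> chart_img c \<Longrightarrow> snd c (chart_inv c x) = x"
  using chart(3) by (rule homeomorphism_apply2)

lemma chart_inv_in: "c \<in> \<A> \<Longrightarrow> x \<in> chart_img c \<Longrightarrow> chart_inv c x \<in> chart_dom c"
  by auto

lemma continuous_chart: "c \<in> \<A> \<Longrightarrow> continuous_on (chart_dom c) (snd c)"
  using chart(3) by (simp add: homeomorphism_def)

lemma continuous_chart_inv: "c \<in> \<A> \<Longrightarrow> continuous_on (chart_img c) (chart_inv c)"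
  using chart(3) by (simp add: homeomorphism_def)

lemma coordinate_metric: "c \<in> \<A> \<Longrightarrow> coordinate_metric (chart_img c) (g c)"
  using metric chart(2) by unfold_locales (auto simp: riemannian_metric_def)

lemma chart_at:
  assumes "p \<in> M" shows "chart_at \<A> p \<in> \<A>" "p \<in> chart_dom (chart_at \<A> p)"
proof -
  have "chart_at \<A> p \<in> \<A> \<and> p \<in> chart_dom (chart_at \<A> p)"
    unfolding chart_at_def by (rule someI_ex) (use ex_chart[OF assms] in blast)
  then show "chart_at \<A> p \<in> \<A>" "p \<in> chart_dom (chart_at \<A> p)" by auto
qed

lemma open_chart_image:
  assumes c: "c \<in> \<A>" and W: "openin (top_of_set M) W" "W \<subseteq> chart_dom c"
  shows "open (snd c ` W)"
proof -
  have "openin (top_of_set (chart_dom c)) W"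
    using W chart_dom_subset[OF c] by (metis openin_subset_trans)
  then have "openin (top_of_set (chart_img c)) (snd c ` W)"
    using homeomorphism_imp_open_map[OF chart(3)[OF c]] by blast
  then show ?thesis using chart(2)[OF c] by (metis openin_open_eq)
qed

lemma openin_overlap:
  "c \<in> \<A> \<Longrightarrow> d \<in> \<A> \<Longrightarrow> openin (top_of_set M) (chart_dom c \<inter> chart_dom d)"
  by (intro openin_Int chart)

lemma openin_chart_inv_image:
  assumes c: "c \<in> \<A>" and U: "open U" "U \<subseteq> chart_img c"
  shows "openin (top_of_set M) (chart_inv c ` U)"
proof -
  have "openin (top_of_set (chart_img c)) U" using U by (metis open_subset)
  then have "openin (top_of_set (chart_dom c)) (chart_inv c ` U)"
    using homeomorphism_imp_open_map[OF homeomorphism_symD[OF chart(3)[OF c]]] by blast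
  then show ?thesis using chart(1)[OF c] openin_trans by blast
qed

lemma compact_chart_inv_image:
  assumes "c \<in> \<A>" "compact K" "K \<subseteq> chart_img c"
  shows "compact (chart_inv c ` K)"
  using assms by (intro compact_continuous_image continuous_on_subset[OF continuous_chart_inv]) auto

lemma Ck_transition:
  "c \<in> \<A> \<Longrightarrow> d \<in> \<A> \<Longrightarrow> Ck_on k (snd c ` (chart_dom c \<inter> chart_dom d)) (transition c d)"
  using atlas by (auto simp: smooth_atlas_def smooth_on_def)

definition Ck :: "nat \<Rightarrow> ('a \<Rightarrow> real) \<Rightarrow> bool" where
  "Ck k f \<longleftrightarrow> (\<forall>c\<in>\<A>. Ck_on k (chart_img c) (\<lambda>x. f (chart_inv c x)))"

lemma CkD: "Ck k f \<Longrightarrow> c \<in> \<A> \<Longrightarrow> Ck_on k (chart_img c) (\<lambda>x. f (chart_inv c x))"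
  by (simp add: Ck_def)

lemma smooth_function_Ck: "smooth_function \<A> f \<longleftrightarrow> (\<forall>k. Ck k f)"
  by (auto simp: smooth_function_def smooth_on_def Ck_def)

lemma Ck_le: "Ck k f \<Longrightarrow> j \<le> k \<Longrightarrow> Ck j f"
  by (auto simp: Ck_def intro: Ck_on_le)

lemma Ck_const: "Ck k (\<lambda>p. a)"
  by (simp add: Ck_def Ck_on_const)

lemma Ck_add: "Ck k f \<Longrightarrow> Ck k h \<Longrightarrow> Ck k (\<lambda>p. f p + h p)"
  by (auto simp: Ck_def intro!: Ck_on_add chart)

lemma Ck_mult: "Ck k f \<Longrightarrow> Ck k h \<Longrightarrow> Ck k (\<lambda>p. f p * h p)"
  by (auto simp: Ck_def intro!: Ck_on_mult chart)

lemma Ck_diff: "Ck k f \<Longrightarrow> Ck k h \<Longrightarrow> Ck k (\<lambda>p. f p - h p)"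
  by (auto simp: Ck_def intro!: Ck_on_diff chart)

lemma Ck_sum: "(\<And>i. i \<in> I \<Longrightarrow> Ck k (f i)) \<Longrightarrow> Ck k (\<lambda>p. \<Sum>i\<in>I. f i p)"
  by (auto simp: Ck_def intro!: Ck_on_sum chart)

lemma Ck_divide:
  "Ck k f \<Longrightarrow> Ck k h \<Longrightarrow> (\<And>p. p \<in> M \<Longrightarrow> h p \<noteq> 0) \<Longrightarrow> Ck k (\<lambda>p. f p / h p)"
  unfolding Ck_def by (intro ballI Ck_on_divide chart) (use chart_dom_subset chart_inv_in in blast)+

lemma continuous_Ck:
  assumes "Ck k f" shows "continuous_on M f"
proof (unfold continuous_on_eq_continuous_within, rule ballI)
  fix p assume "p \<in> M"
  then obtain c where c: "c \<in> \<A>" "p \<in> chart_dom c" using ex_chart by blast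
  have "continuous_on (chart_dom c) (\<lambda>q. f (chart_inv c (snd c q)))"
    by (rule continuous_on_compose2[OF Ck_on_continuous[OF CkD[OF assms c(1)]] continuous_chart[OF c(1)]]) simp
  then have "continuous_on (chart_dom c) f"
    by (rule continuous_on_eq) (use c in simp)
  then have "continuous (at p within chart_dom c) f" using c by (simp add: continuous_on_eq_continuous_within)
  then show "continuous (at p within M) f"
    using at_within_openin[OF chart(1)[OF c(1)] c(2)] by (simp add: continuous_within)
qed

lemma transition_in:
  "c \<in> \<A> \<Longrightarrow> d \<in> \<A> \<Longrightarrow> p \<in> chart_dom c \<Longrightarrow> transition c d (snd c p) = snd d p"
  by (simp add: transition_def)

text \<open>Regularity seen in one chart gives regularity in every chart \<open>d\<close>: the
  domain of \<open>d\<close> is covered by its intersection with \<open>W\<close>, where the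
  transition map applies, and by the complement of \<open>K\<close>, where \<open>f\<close>
  vanishes. The latter is open because compact sets in a Hausdorff space are closed.\<close>

lemma Ck_supported:
  assumes c: "c \<in> \<A>" and W: "openin (top_of_set M) W" "W \<subseteq> chart_dom c"
    and f: "Ck_on k (snd c ` W) (\<lambda>x. f (chart_inv c x))"
    and K: "compact K" "K \<subseteq> W" and f0: "\<And>p. p \<in> M \<Longrightarrow> p \<notin> K \<Longrightarrow> f p = 0"
  shows "Ck k f"
  unfolding Ck_def
proof
  fix d assume d: "d \<in> \<A>"
  let ?U = "snd d ` (chart_dom d \<inter> W)" and ?V = "snd d ` (chart_dom d - K)"
  have oU: "open ?U" by (intro open_chart_image d openin_Int chart W) auto
  have "openin (top_of_set M) (chart_dom d \<inter> (M - K))"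
    using chart(1)[OF d] compact_imp_closed[OF K(1)]
    by (intro openin_Int) (auto simp: Diff_eq openin_open_Int)
  moreover have "chart_dom d \<inter> (M - K) = chart_dom d - K" using chart_dom_subset[OF d] by auto
  ultimately have oV: "open ?V" by (intro open_chart_image d) auto
  have "Ck_on k ?U (\<lambda>x. f (chart_inv d x))"
  proof (rule Ck_on_cong[OF oU])
    show "Ck_on k ?U (\<lambda>y. f (chart_inv c (transition d c y)))"
      by (rule Ck_on_compose[OF oU open_chart_image[OF c W] f Ck_on_subset[OF Ck_transition[OF d c]]])
        (use W in \<open>auto simp: transition_in[OF d c]\<close>)
    show "f (chart_inv c (transition d c x)) = f (chart_inv d x)" if "x \<in> ?U" for x
      using that W c d by (auto simp: transition_def)
  qed
  moreover have "Ck_on k ?V (\<lambda>x. f (chart_inv d x))"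
    by (rule Ck_on_cong[OF oV _ Ck_on_const[of _ _ 0]]) (use d f0 chart_dom_subset[OF d] in auto)
  ultimately have "Ck_on k (?U \<union> ?V) (\<lambda>x. f (chart_inv d x))" by (intro Ck_on_Un oU oV)
  moreover have "?U \<union> ?V = chart_img d" using K by auto
  ultimately show "Ck_on k (chart_img d) (\<lambda>x. f (chart_inv d x))" by simp
qed

section \<open>Bump functions on coordinate balls\<close>

definition bump :: "'a chart \<Rightarrow> real^3 \<Rightarrow> real \<Rightarrow> 'a \<Rightarrow> real" where
  "bump c x r p = (if p \<in> chart_dom c then (max 0 (r\<^sup>2 - (snd c p - x) \<bullet> (snd c p - x)))\<^sup>2 else 0)"

lemma bump_nonneg: "bump c x r p \<ge> 0"
  by (simp add: bump_def)

lemma bump_pos: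
  assumes "c \<in> \<A>" "p \<in> chart_inv c ` ball x r" "ball x r \<subseteq> chart_img c"
  shows "bump c x r p > 0"
proof -
  obtain y where y: "y \<in> ball x r" "p = chart_inv c y" using assms by auto
  then have "y \<in> chart_img c" using assms by auto
  then have "p \<in> chart_dom c" "snd c p = y" using y assms chart_inv_in by (auto simp del: image_iff)
  moreover have "(norm (y - x))\<^sup>2 < r\<^sup>2"
    using y by (intro power_strict_mono) (auto simp: dist_norm norm_minus_commute)
  ultimately show ?thesis unfolding bump_def by (simp add: power2_norm_eq_inner)
qed

lemma bump_zero:
  assumes "c \<in> \<A>" "r > 0" "p \<notin> chart_inv c ` cball x r"
  shows "bump c x r p = 0"
proof (cases "p \<in> chart_dom c")
  case True
  then have "snd c p \<notin> cball x r" using assms by (metis chart_inv_snd imageI)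
  then have "r\<^sup>2 \<le> (norm (snd c p - x))\<^sup>2"
    using assms(2) by (intro power_mono) (auto simp: dist_norm norm_minus_commute)
  then show ?thesis by (simp add: bump_def power2_norm_eq_inner)
qed (simp add: bump_def)

lemma Ck_on_bump:
  assumes "c \<in> \<A>" shows "Ck_on 1 (chart_img c) (\<lambda>y. bump c x r (chart_inv c y))"
proof (rule Ck_on_cong[OF chart(2)[OF assms]])
  show "Ck_on 1 (chart_img c) (\<lambda>y. (max 0 (r\<^sup>2 - (y - x) \<bullet> (y - x)))\<^sup>2)"
    by (rule Ck_on_compose[OF chart(2)[OF assms] open_UNIV Ck_on_max0_square])
      (intro Ck_on_diff Ck_on_const Ck_on_inner Ck_on_ident chart assms, auto)
qed (use assms in \<open>auto simp: bump_def\<close>)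

lemma Ck_bump:
  assumes "c \<in> \<A>" "r > 0" "cball x r \<subseteq> chart_img c"
  shows "Ck 1 (bump c x r)"
proof (rule Ck_supported[OF assms(1) chart(1)[OF assms(1)] order_refl Ck_on_bump[OF assms(1)]])
  show "compact (chart_inv c ` cball x r)"
    by (intro compact_chart_inv_image assms) auto
  show "chart_inv c ` cball x r \<subseteq> chart_dom c" using assms chart_inv_in by blast
qed (use bump_zero assms in auto)

end


section \<open>Inner product of gradients and its chart invariance\<close>

lemma has_derivative_axis_expansion:
  fixes D :: "real^3 \<Rightarrow> real"
  assumes "linear D" shows "D w = (\<Sum>i\<in>UNIV. w $ i * D (axis i 1))"
proof -
  have "D w = D (\<Sum>i\<in>UNIV. w $ i *\<^sub>R axis i 1)"
    using basis_expansion[of w] by (simp add: scalar_mult_eq_scaleR)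
  then show ?thesis by (simp add: linear_sum[OF assms] linear_scale[OF assms])
qed

context closed_riemannian
begin

abbreviation in_chart :: "'a chart \<Rightarrow> ('a \<Rightarrow> real) \<Rightarrow> real^3 \<Rightarrow> real" where
  "in_chart c u \<equiv> \<lambda>x. u (chart_inv c x)"

definition cgrad :: "'a chart \<Rightarrow> ('a \<Rightarrow> real) \<Rightarrow> ('a \<Rightarrow> real) \<Rightarrow> 'a \<Rightarrow> real" where
  "cgrad c u v p = coordinate_metric.grad (g c) (in_chart c u) (in_chart c v) (snd c p)"

definition claplace :: "'a chart \<Rightarrow> ('a \<Rightarrow> real) \<Rightarrow> 'a \<Rightarrow> real" where
  "claplace c u p = coord_laplacian (g c) (in_chart c u) (snd c p)"

lemma cgrad_matrix:
  assumes "c \<in> \<A>"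
  shows "cgrad c u v p = (\<chi> i. partial i (in_chart c u) (snd c p)) \<bullet>
    (matrix_inv (g c (snd c p)) *v (\<chi> i. partial i (in_chart c v) (snd c p)))"
proof -
  interpret coordinate_metric "chart_img c" "g c" by (rule coordinate_metric[OF assms])
  show ?thesis unfolding cgrad_def grad_def ginv_def
    by (simp add: inner_vec_def matrix_vector_mult_def sum_distrib_left mult_ac)
qed

text \<open>Differentials transform by \<open>transpose J\<close>, the metric by
  \<open>transpose J\<close> and \<open>J\<close>, hence its inverse by \<open>J\<close> and
  \<open>transpose J\<close>, and the factors cancel. Only first derivatives occur, so the direct
  computation stays short.\<close>

lemma cgrad_invariant:
  assumes c: "c \<in> \<A>" and d: "d \<in> \<A>" and p: "p \<in> chart_dom c" "p \<in> chart_dom d"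
    and u: "Ck 1 u" and v: "Ck 1 v"
  shows "cgrad c u v p = cgrad d u v p"
proof -
  interpret C: coordinate_metric "chart_img c" "g c" by (rule coordinate_metric[OF c])
  interpret D: coordinate_metric "chart_img d" "g d" by (rule coordinate_metric[OF d])
  let ?O = "snd c ` (chart_dom c \<inter> chart_dom d)"
  let ?x = "snd c p" and ?y = "snd d p" and ?\<tau> = "transition c d"
  define J where "J = (\<chi> i j. frechet_derivative ?\<tau> (at ?x) (axis j 1) $ i)"
  have oO: "open ?O" by (intro open_chart_image openin_overlap c d) auto
  have x: "?x \<in> ?O" "?x \<in> chart_img c" "?y \<in> chart_img d" using p by auto
  have \<tau>x: "?\<tau> ?x = ?y" using transition_in[OF c d p(1)] .
  have d\<tau>: "(?\<tau> has_derivative frechet_derivative ?\<tau> (at ?x)) (at ?x)"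
    by (rule Ck_on_has_derivative[OF Ck_transition[OF c d, of 1] _ x(1)]) simp
  have chain: "(\<chi> i. partial i (in_chart c w) ?x) = transpose J *v (\<chi> i. partial i (in_chart d w) ?y)"
    if w: "Ck 1 w" for w
  proof -
    have dw: "(in_chart d w has_derivative frechet_derivative (in_chart d w) (at ?y)) (at (?\<tau> ?x))"
      unfolding \<tau>x by (rule Ck_on_has_derivative[OF CkD[OF w d] _ x(3)]) simp
    have "partial j (in_chart c w) ?x = partial j (\<lambda>x. in_chart d w (?\<tau> x)) ?x" for j
      by (rule partial_cong[OF oO x(1)]) (use c d in \<open>auto simp: transition_def\<close>)
    also have "partial j (\<lambda>x. in_chart d w (?\<tau> x)) ?x
      = frechet_derivative (in_chart d w) (at ?y) (frechet_derivative ?\<tau> (at ?x) (axis j 1))" for j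
      by (rule partial_has_derivative[OF has_derivative_compose[OF d\<tau> dw]])
    also have "\<dots> j = (\<Sum>i\<in>UNIV. J $ i $ j * partial i (in_chart d w) ?y)" for j
      by (subst has_derivative_axis_expansion[OF has_derivative_linear[OF dw]])
        (simp add: J_def partial_def)
    finally show ?thesis
      by (simp add: vec_eq_iff matrix_vector_mult_def transpose_def)
  qed
  have Gc: "g c ?x = transpose J ** g d ?y ** J"
  proof -
    have "axis i 1 \<bullet> (g c ?x *v axis j 1) = axis i 1 \<bullet> ((transpose J ** g d ?y ** J) *v axis j 1)" for i j
    proof -
      have J: "frechet_derivative ?\<tau> (at ?x) (axis j 1) = J *v axis j 1" for j
        by (simp add: vec_eq_iff J_def matrix_vector_mult_basis column_def)
      have "axis i 1 \<bullet> (g c ?x *v axis j 1) = (J *v axis i 1) \<bullet> (g d ?y *v (J *v axis j 1))"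
        using metric c d x(1) J \<tau>x unfolding riemannian_metric_def by metis
      also have "\<dots> = axis i 1 \<bullet> (transpose J *v (g d ?y *v (J *v axis j 1)))"
        by (metis dot_lmul_matrix inner_commute transpose_matrix_vector vector_transpose_matrix)
      finally show ?thesis by (simp add: matrix_vector_mul_assoc matrix_mul_assoc del: transpose_matrix_vector)
    qed
    then show ?thesis
      by (simp add: vec_eq_iff inner_axis' matrix_vector_mult_basis column_def)
  qed
  have nz: "det (g c ?x) \<noteq> 0" "det (g d ?y) \<noteq> 0" using C.det_pos[OF x(2)] D.det_pos[OF x(3)] by auto
  \<comment> \<open>Invertibility of the Jacobian is read off from the transformation law:
    \<open>det J\<close> is a factor of the nonzero \<open>det (g c ?x)\<close>.\<close>
  have dJ: "det J \<noteq> 0" using nz(1) unfolding Gc by (auto simp: det_mul)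
  have dJt: "det (transpose J) \<noteq> 0" using dJ by simp
  let ?I = "matrix_inv (g c ?x)"
  have "matrix_inv (g d ?y) = J ** ?I ** transpose J"
  proof (rule matrix_inv_unique)
    have "transpose J ** g d ?y ** (J ** ?I) = mat 1"
      using matrix_inv_right_left(1)[OF nz(1)] unfolding Gc by (simp add: matrix_mul_assoc)
    then have 1: "g d ?y ** (J ** ?I) ** transpose J = mat 1"
      using matrix_left_right_inverse[of "transpose J"] by (simp add: matrix_mul_assoc[symmetric])
    then show "g d ?y ** (J ** ?I ** transpose J) = mat 1" by (simp add: matrix_mul_assoc)
    then show "J ** ?I ** transpose J ** g d ?y = mat 1"
      using matrix_left_right_inverse by blast
  qed
  moreover have "cgrad c u v p = (transpose J *v (\<chi> i. partial i (in_chart d u) ?y)) \<bullet>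
      (?I *v (transpose J *v (\<chi> i. partial i (in_chart d v) ?y)))"
    unfolding cgrad_matrix[OF c] chain[OF u] chain[OF v] ..
  moreover have "(transpose J *v a) \<bullet> b = a \<bullet> (J *v b)" for a b :: "real^3"
    by (simp add: dot_lmul_matrix)
  ultimately show ?thesis
    unfolding cgrad_matrix[OF d] by (simp add: matrix_vector_mul_assoc matrix_mul_assoc del: transpose_matrix_vector)
qed

definition gradient :: "('a \<Rightarrow> real) \<Rightarrow> ('a \<Rightarrow> real) \<Rightarrow> 'a \<Rightarrow> real" where
  "gradient u v p = cgrad (chart_at \<A> p) u v p"

lemma gradient_eq: "c \<in> \<A> \<Longrightarrow> p \<in> chart_dom c \<Longrightarrow> Ck 1 u \<Longrightarrow> Ck 1 v \<Longrightarrow> gradient u v p = cgrad c u v p"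
  unfolding gradient_def using chart_dom_subset chart_at cgrad_invariant by blast

lemma grad_norm2_eq:
  assumes "p \<in> M" shows "grad_norm2 \<A> g u p = gradient u u p"
proof -
  interpret coordinate_metric "chart_img (chart_at \<A> p)" "g (chart_at \<A> p)"
    by (rule coordinate_metric[OF chart_at(1)[OF assms]])
  show ?thesis
    by (simp add: grad_norm2_def coord_grad_norm2_def gradient_def cgrad_def grad_def ginv_def Let_def)
qed

lemma Ck_on_in_chart_cgrad:
  assumes c: "c \<in> \<A>" and S: "open S" "S \<subseteq> chart_img c"
    and u: "Ck_on (Suc k) S (in_chart c u)" and v: "Ck_on (Suc k) S (in_chart c v)"
  shows "Ck_on k S (in_chart c (cgrad c u v))"
proof -
  interpret coordinate_metric "chart_img c" "g c" by (rule coordinate_metric[OF c])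
  have "Ck_on k S (grad (in_chart c u) (in_chart c v))"
    unfolding grad_def[abs_def]
    by (intro Ck_on_sum Ck_on_mult S Ck_partial u v Ck_on_subset[OF Ck_ginv])
  then show ?thesis by (rule Ck_on_cong[OF S(1), rotated]) (use c S in \<open>auto simp: cgrad_def subset_iff\<close>)
qed

lemma Ck_on_in_chart_claplace:
  assumes c: "c \<in> \<A>" and S: "open S" "S \<subseteq> chart_img c"
    and u: "Ck_on (Suc (Suc k)) S (in_chart c u)"
  shows "Ck_on k S (in_chart c (claplace c u))"
proof -
  interpret coordinate_metric "chart_img c" "g c" by (rule coordinate_metric[OF c])
  have gi: "Ck_on j S (ginv a b)" for j a b by (rule Ck_on_subset[OF Ck_ginv S(2)])
  have pG: "Ck_on k S (partial l (\<lambda>y. g c y $ a $ b))" for a b l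
    by (intro Ck_partial Ck_on_subset[OF Ck_G S(2)])
  have "Ck_on k S (coord_laplacian (g c) (in_chart c u))"
    unfolding coord_laplacian_def[abs_def] covariant_hessian_def christoffel_def ginv_def[symmetric]
    by (intro Ck_on_sum Ck_on_mult Ck_on_diff Ck_on_add S Ck_partial gi pG Ck_on_const u Ck_on_lower[OF u])
  then show ?thesis by (rule Ck_on_cong[OF S(1), rotated]) (use c S in \<open>auto simp: claplace_def subset_iff\<close>)
qed


section \<open>The volume measure and integration in charts\<close>

definition dens :: "'a chart \<Rightarrow> real^3 \<Rightarrow> real" where
  "dens c x = sqrt (det (g c x))"

lemma dens_rho:
  assumes "c \<in> \<A>" shows "coordinate_metric.rho (g c) = dens c"
proof -
  interpret coordinate_metric "chart_img c" "g c" by (rule coordinate_metric[OF assms])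
  show ?thesis by (simp add: fun_eq_iff dens_def rho_def)
qed

lemma dens_pos: "c \<in> \<A> \<Longrightarrow> x \<in> chart_img c \<Longrightarrow> dens c x > 0"
  using coordinate_metric.rho_pos[OF coordinate_metric] by (simp add: dens_rho)

lemma continuous_dens: "c \<in> \<A> \<Longrightarrow> continuous_on (chart_img c) (dens c)"
  using Ck_on_continuous[OF coordinate_metric.Ck_rho[OF coordinate_metric, of c 0]] by (simp add: dens_rho)

lemma space_vol: "space vol = M"
  using volume by (simp add: riemannian_volume_def)

lemma sets_vol: "sets vol = sets (restrict_space borel M)"
  using volume by (simp add: riemannian_volume_def)

lemma emeasure_vol:
  "c \<in> \<A> \<Longrightarrow> S \<in> sets vol \<Longrightarrow> S \<subseteq> chart_dom c \<Longrightarrow>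
    emeasure vol S = (\<integral>\<^sup>+x\<in>snd c ` S. ennreal (dens c x) \<partial>lborel)"
  using volume by (simp add: riemannian_volume_def dens_def)

lemma openin_sets_vol: "openin (top_of_set M) S \<Longrightarrow> S \<in> sets vol"
  unfolding sets_vol sets_restrict_space openin_open
  by (elim exE conjE) (rule image_eqI, assumption, simp)

lemma compact_sets_vol: "compact K \<Longrightarrow> K \<subseteq> M \<Longrightarrow> K \<in> sets vol"
  unfolding sets_vol sets_restrict_space
  by (intro image_eqI[of _ _ K]) (auto intro: borel_closed compact_imp_closed)

lemma measurable_vol_continuous: "continuous_on M f \<Longrightarrow> f \<in> borel_measurable vol"
  using borel_measurable_continuous_on_restrict[of M f] measurable_cong_sets[OF sets_vol refl] by blast

text \<open>\<open>riemannian_volume\<close> prescribes only the measure of sets. Recognising the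
  restricted measure as an image of a density on coordinate space makes the transformation rule for
  integrals available.\<close>

lemma restrict_vol_eq_distr:
  assumes c: "c \<in> \<A>"
  shows "restrict_space vol (chart_dom c) =
    distr (density (restrict_space lborel (chart_img c)) (\<lambda>x. ennreal (dens c x)))
      (restrict_space vol (chart_dom c)) (chart_inv c)" (is "?R = distr ?D ?R _")
    and "chart_inv c \<in> measurable (restrict_space lborel (chart_img c)) (restrict_space vol (chart_dom c))"
proof -
  have dV: "chart_dom c \<in> sets vol" by (rule openin_sets_vol[OF chart(1)[OF c]])
  have sR: "sets ?R = sets (restrict_space borel (chart_dom c))"
  proof -
    have "sets ?R = sets (restrict_space (restrict_space borel M) (chart_dom c))"
      by (rule sets_restrict_space_cong[OF sets_vol])
    also have "\<dots> = sets (restrict_space borel (chart_dom c))"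
      using chart_dom_subset[OF c] by (simp add: sets_restrict_restrict_space inf_absorb2)
    finally show ?thesis .
  qed
  have "chart_inv c \<in> borel_measurable (restrict_space borel (chart_img c))"
    by (rule borel_measurable_continuous_on_restrict[OF continuous_chart_inv[OF c]])
  then have "chart_inv c \<in> measurable (restrict_space borel (chart_img c)) (restrict_space borel (chart_dom c))"
    by (rule measurable_restrict_space2[rotated]) (use c in \<open>auto simp: space_restrict_space\<close>)
  moreover have "sets (restrict_space lborel (chart_img c)) = sets (restrict_space borel (chart_img c))"
    by (rule sets_restrict_space_cong) simp
  ultimately show mi: "chart_inv c \<in> measurable (restrict_space lborel (chart_img c)) ?R"
    using sR by (simp cong: measurable_cong_sets)
  have md: "(\<lambda>x. ennreal (dens c x)) \<in> borel_measurable (restrict_space lborel (chart_img c))"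
    using borel_measurable_continuous_on_restrict[OF continuous_dens[OF c]]
      measurable_cong_sets[OF sets_restrict_space_cong[OF sets_lborel] refl] by measurable
  show "?R = distr ?D ?R (chart_inv c)"
  proof (rule measure_eqI)
    fix A assume A: "A \<in> sets ?R"
    then have Ad: "A \<subseteq> chart_dom c" using sets.sets_into_space[OF A] by (simp add: space_restrict_space)
    have AV: "A \<in> sets vol" using A dV Ad by (simp add: sets_restrict_space_iff)
    have pre: "chart_inv c -` A \<inter> chart_img c = snd c ` A"
    proof
      show "chart_inv c -` A \<inter> chart_img c \<subseteq> snd c ` A"
      proof
        fix x assume "x \<in> chart_inv c -` A \<inter> chart_img c"
        then have "x = snd c (chart_inv c x)" "chart_inv c x \<in> A" using c by (simp_all del: image_iff)
        then show "x \<in> snd c ` A" by (rule image_eqI)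
      qed
      show "snd c ` A \<subseteq> chart_inv c -` A \<inter> chart_img c" using Ad c by auto
    qed
    have sA: "snd c ` A \<in> sets (restrict_space lborel (chart_img c))"
      using measurable_sets[OF mi A] pre by (simp add: space_restrict_space)
    have "emeasure (distr ?D ?R (chart_inv c)) A = emeasure ?D (chart_inv c -` A \<inter> space ?D)"
      by (rule emeasure_distr) (use mi A in auto)
    also have "\<dots> = emeasure ?D (snd c ` A)" using pre by (simp add: space_restrict_space)
    also have "\<dots> = (\<integral>\<^sup>+x. ennreal (dens c x) * indicator (snd c ` A) x \<partial>restrict_space lborel (chart_img c))"
      by (rule emeasure_density[OF md sA])
    also have "\<dots> = (\<integral>\<^sup>+x\<in>chart_img c. ennreal (dens c x) * indicator (snd c ` A) x \<partial>lborel)"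
      by (rule nn_integral_restrict_space) (use chart(2)[OF c] in simp)
    also have "\<dots> = (\<integral>\<^sup>+x\<in>snd c ` A. ennreal (dens c x) \<partial>lborel)"
      using Ad by (intro nn_integral_cong) (auto simp: indicator_def)
    also have "\<dots> = emeasure ?R A"
      using emeasure_vol[OF c AV Ad] emeasure_restrict_space[of "chart_dom c" vol A] dV Ad
      by (simp add: space_vol Int_absorb2[OF chart_dom_subset[OF c]])
    finally show "emeasure ?R A = emeasure (distr ?D ?R (chart_inv c)) A" by simp
  qed simp
qed

lemma integral_vol_chart:
  fixes F :: "'a \<Rightarrow> real"
  assumes c: "c \<in> \<A>" and F: "F \<in> borel_measurable vol" and F0: "\<And>p. p \<in> M \<Longrightarrow> p \<notin> chart_dom c \<Longrightarrow> F p = 0"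
  shows "integral\<^sup>L vol F = integral\<^sup>L lborel (\<lambda>x. indicator (chart_img c) x * (dens c x * F (chart_inv c x)))"
proof -
  let ?R = "restrict_space vol (chart_dom c)" and ?L = "restrict_space lborel (chart_img c)"
  have dV: "chart_dom c \<in> sets vol" by (rule openin_sets_vol[OF chart(1)[OF c]])
  have FR: "F \<in> borel_measurable ?R" using F by (rule measurable_restrict_space1)
  note mi = restrict_vol_eq_distr(2)[OF c]
  have md: "dens c \<in> borel_measurable ?L"
    using borel_measurable_continuous_on_restrict[OF continuous_dens[OF c]]
      measurable_cong_sets[OF sets_restrict_space_cong[OF sets_lborel] refl] by blast
  have "integral\<^sup>L vol F = integral\<^sup>L vol (\<lambda>p. indicator (chart_dom c) p *\<^sub>R F p)"
    by (rule Bochner_Integration.integral_cong) (auto simp: space_vol indicator_def F0)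
  also have "\<dots> = integral\<^sup>L ?R F"
    by (rule integral_restrict_space[symmetric]) (use dV in simp)
  also have "\<dots> = integral\<^sup>L (distr (density ?L (\<lambda>x. ennreal (dens c x))) ?R (chart_inv c)) F"
    using restrict_vol_eq_distr(1)[OF c] by simp
  also have "\<dots> = integral\<^sup>L (density ?L (\<lambda>x. ennreal (dens c x))) (\<lambda>x. F (chart_inv c x))"
    by (rule integral_distr) (use mi FR in auto)
  also have "\<dots> = integral\<^sup>L ?L (\<lambda>x. dens c x *\<^sub>R F (chart_inv c x))"
  proof (rule integral_density)
    show "(\<lambda>x. F (chart_inv c x)) \<in> borel_measurable ?L" using measurable_compose[OF mi FR] .
    show "AE x in ?L. 0 \<le> dens c x"
      using dens_pos[OF c] by (intro AE_I2) (auto simp: space_restrict_space less_imp_le)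
  qed (rule md)
  also have "\<dots> = integral\<^sup>L lborel (\<lambda>x. indicator (chart_img c) x *\<^sub>R (dens c x *\<^sub>R F (chart_inv c x)))"
    by (rule integral_restrict_space) (use chart(2)[OF c] in simp)
  finally show ?thesis by simp
qed

text \<open>The closed ball is required to lie in the chart image, so that the bump on it has its
  support in a compact subset of the chart domain.\<close>

definition coord_ball :: "('a chart \<times> (real^3) \<times> real) \<Rightarrow> bool" where
  "coord_ball z = (case z of (c, x, r) \<Rightarrow> c \<in> \<A> \<and> r > 0 \<and> cball x r \<subseteq> chart_img c)"

lemma ex_coord_ball:
  assumes c: "c \<in> \<A>" and W: "openin (top_of_set M) W" "W \<subseteq> chart_dom c" "p \<in> W"
  shows "\<exists>r. coord_ball (c, snd c p, r) \<and> chart_inv c ` cball (snd c p) r \<subseteq> W"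
proof -
  have "open (snd c ` W)" by (rule open_chart_image[OF c W(1,2)])
  then obtain r where r: "r > 0" "cball (snd c p) r \<subseteq> snd c ` W"
    using W(3) open_contains_cball by blast
  moreover have "chart_inv c ` (snd c ` W) \<subseteq> W" using W(2) c by auto
  moreover have "snd c ` W \<subseteq> chart_img c" using W(2) by auto
  ultimately show ?thesis unfolding coord_ball_def using c by (intro exI[of _ r]) auto
qed

lemma finite_coord_ball_cover:
  "\<exists>I. finite I \<and> (\<forall>z\<in>I. coord_ball z) \<and> M \<subseteq> (\<Union>(c, x, r)\<in>I. chart_inv c ` ball x r)"
proof -
  define B where "B z = (case z of (c, x, r) \<Rightarrow> chart_inv c ` ball x r)" for z :: "'a chart \<times> (real^3) \<times> real"
  have "\<exists>T. open T \<and> B z = M \<inter> T" if z: "coord_ball z" for z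
  proof -
    obtain c x r where zc: "z = (c, x, r)" using prod_cases3 by blast
    have "c \<in> \<A>" "ball x r \<subseteq> chart_img c"
      using z ball_subset_cball[of x r] unfolding zc coord_ball_def by auto
    then have "openin (top_of_set M) (B z)"
      unfolding zc B_def prod.case by (intro openin_chart_inv_image open_ball)
    then show ?thesis unfolding openin_open by blast
  qed
  then obtain T where T: "\<And>z. coord_ball z \<Longrightarrow> open (T z) \<and> B z = M \<inter> T z" by metis
  have "M \<subseteq> (\<Union>z\<in>Collect coord_ball. T z)"
  proof
    fix p assume p: "p \<in> M"
    then obtain c where c: "c \<in> \<A>" "p \<in> chart_dom c" using ex_chart by blast
    then obtain r where r: "coord_ball (c, snd c p, r)"
      using ex_coord_ball[OF c(1) chart(1)[OF c(1)] order_refl] by blast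
    then have "p \<in> B (c, snd c p, r)" using c by (auto simp: coord_ball_def B_def intro!: image_eqI[of _ _ "snd c p"])
    then show "p \<in> (\<Union>z\<in>Collect coord_ball. T z)" using T[OF r] r by blast
  qed
  then obtain I where I: "I \<subseteq> Collect coord_ball" "finite I" "M \<subseteq> (\<Union>z\<in>I. T z)"
    using compactE_image[OF compact_M, of "Collect coord_ball" T] T by blast
  have "M \<subseteq> (\<Union>z\<in>I. B z)"
  proof
    fix p assume p: "p \<in> M"
    then obtain z where "z \<in> I" "p \<in> T z" using I by blast
    then show "p \<in> (\<Union>z\<in>I. B z)" using T[of z] p I by blast
  qed
  then show ?thesis using I unfolding B_def by blast
qed

lemma emeasure_cball_finite:
  assumes "coord_ball (c, x, r)" shows "emeasure vol (chart_inv c ` cball x r) < \<infinity>"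
proof -
  have c: "c \<in> \<A>" "cball x r \<subseteq> chart_img c" using assms by (auto simp: coord_ball_def)
  let ?K = "chart_inv c ` cball x r"
  have sub: "?K \<subseteq> chart_dom c" using c chart_inv_in by blast
  have K: "?K \<in> sets vol"
    by (intro compact_sets_vol compact_chart_inv_image c) (use sub chart_dom_subset[OF c(1)] in auto)
  have sK: "snd c ` ?K = cball x r" using c by (force simp: image_image)
  have "bounded (dens c ` cball x r)"
    by (intro compact_imp_bounded compact_continuous_image continuous_on_subset[OF continuous_dens[OF c(1)] c(2)]) simp
  then obtain B where "\<forall>y\<in>cball x r. norm (dens c y) \<le> B" by (auto simp: bounded_iff)
  then have B: "dens c y \<le> B" if "y \<in> cball x r" for y using that by fastforce
  have "(\<integral>\<^sup>+y\<in>cball x r. ennreal (dens c y) \<partial>lborel) \<le> (\<integral>\<^sup>+y\<in>cball x r. ennreal B \<partial>lborel)"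
    using B by (intro nn_integral_mono) (auto simp: indicator_def intro: ennreal_leI)
  also have "\<dots> = ennreal B * emeasure lborel (cball x r)" by (simp add: nn_integral_cmult_indicator)
  also have "\<dots> < \<infinity>"
    using emeasure_bounded_finite[of "cball x r"] by (simp add: ennreal_mult_less_top)
  finally show ?thesis unfolding emeasure_vol[OF c(1) K sub] sK .
qed

text \<open>Finiteness is a consequence of compactness: finitely many closed coordinate balls cover
  \<open>M\<close>, and the continuous density is bounded on each.\<close>

lemma finite_measure_vol: "finite_measure vol"
proof
  obtain I where I: "finite I" "\<And>z. z \<in> I \<Longrightarrow> coord_ball z" "M \<subseteq> (\<Union>(c, x, r)\<in>I. chart_inv c ` ball x r)"
    using finite_coord_ball_cover by blast
  let ?K = "\<lambda>z. case z of (c, x, r) \<Rightarrow> chart_inv c ` cball x r"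
  have Ks: "?K z \<in> sets vol" if "z \<in> I" for z
  proof -
    obtain c x r where z: "z = (c, x, r)" by (cases z)
    then have c: "c \<in> \<A>" "cball x r \<subseteq> chart_img c" using I(2)[OF that] by (auto simp: coord_ball_def)
    have "chart_inv c ` cball x r \<subseteq> M" using c chart_inv_in chart_dom_subset by blast
    then show ?thesis
      unfolding z prod.case by (intro compact_sets_vol compact_chart_inv_image c compact_cball)
  qed
  have "emeasure vol M \<le> emeasure vol (\<Union>z\<in>I. ?K z)"
  proof (rule emeasure_mono)
    have "(\<Union>(c, x, r)\<in>I. chart_inv c ` ball x r) \<subseteq> (\<Union>z\<in>I. ?K z)"
      by (rule UN_mono) (simp_all add: case_prod_beta image_mono)
    then show "M \<subseteq> (\<Union>z\<in>I. ?K z)" using I(3) by order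
  qed (rule sets.finite_UN[OF I(1) Ks])
  also have "\<dots> \<le> (\<Sum>z\<in>I. emeasure vol (?K z))"
    by (rule emeasure_subadditive_finite) (use Ks I(1) in auto)
  also have "\<dots> < \<infinity>"
  proof -
    have "emeasure vol (?K z) < \<infinity>" if "z \<in> I" for z
      using I(2)[OF that] emeasure_cball_finite by (cases z rule: prod_cases3) simp
    then show ?thesis using I(1) by simp
  qed
  finally show "emeasure vol (space vol) \<noteq> \<infinity>" by (simp add: space_vol)
qed

lemma integrable_continuous:
  fixes f :: "'a \<Rightarrow> real"
  assumes "continuous_on M f" shows "integrable vol f"
proof -
  interpret finite_measure vol by (rule finite_measure_vol)
  obtain B where "\<And>p. p \<in> M \<Longrightarrow> norm (f p) \<le> B"
    using compact_imp_bounded[OF compact_continuous_image[OF assms compact_M]] by (auto simp: bounded_iff)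
  then show ?thesis
    by (intro integrable_const_bound[of _ B] AE_I2 measurable_vol_continuous assms) (simp add: space_vol)
qed

text \<open>Otherwise \<open>f\<close> is nonzero on a nonempty open subset of a chart. The density
  is positive there, so a vanishing integral would make a nonempty open subset of coordinate space a
  null set. All weak arguments below end with this lemma.\<close>

lemma integral_eq_0_imp_eq_0:
  fixes f :: "'a \<Rightarrow> real"
  assumes f: "continuous_on M f" "\<And>p. p \<in> M \<Longrightarrow> f p \<ge> 0" and i: "integral\<^sup>L vol f = 0" and p: "p \<in> M"
  shows "f p = 0"
proof (rule ccontr)
  assume fp: "f p \<noteq> 0"
  obtain c where c: "c \<in> \<A>" "p \<in> chart_dom c" using ex_chart[OF p] by blast
  let ?S = "{q \<in> chart_dom c. f q \<noteq> 0}"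
  have oS: "openin (top_of_set M) ?S"
  proof -
    have "openin (top_of_set M) (M \<inter> f -` (- {0}))"
      by (rule continuous_openin_preimage_gen[OF f(1)]) auto
    from openin_Int[OF chart(1)[OF c(1)] this]
    have "openin (top_of_set M) (chart_dom c \<inter> (M \<inter> f -` (- {0})))" .
    moreover have "chart_dom c \<inter> (M \<inter> f -` (- {0})) = ?S" using chart_dom_subset[OF c(1)] by auto
    ultimately show ?thesis by simp
  qed
  have op: "open (snd c ` ?S)" by (rule open_chart_image[OF c(1) oS]) auto
  have "AE q in vol. f q = 0"
    using integral_nonneg_eq_0_iff_AE[OF integrable_continuous[OF f(1)] AE_I2] f(2) i by (simp add: space_vol)
  then have "emeasure vol {q \<in> space vol. f q \<noteq> 0} = 0"
    using measurable_vol_continuous[OF f(1)] by (subst (asm) AE_iff_measurable[OF _ refl]) auto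
  then have "emeasure vol ?S = 0"
  proof (rule emeasure_eq_0[rotated])
    show "{q \<in> space vol. f q \<noteq> 0} \<in> sets vol" using measurable_vol_continuous[OF f(1)] by measurable
  qed (use chart_dom_subset[OF c(1)] in \<open>auto simp: space_vol\<close>)
  then have "(\<integral>\<^sup>+x. ennreal (dens c x) * indicator (snd c ` ?S) x \<partial>lborel) = 0"
    using emeasure_vol[OF c(1) openin_sets_vol[OF oS]] by auto
  moreover have "(\<lambda>x. ennreal (dens c x) * indicator (snd c ` ?S) x) \<in> borel_measurable lborel"
  proof -
    have "(\<lambda>x. indicator (snd c ` ?S) x *\<^sub>R dens c x) \<in> borel_measurable borel"
    proof (rule borel_measurable_continuous_on_indicator)
      show "continuous_on (snd c ` ?S) (dens c)"
        by (rule continuous_on_subset[OF continuous_dens[OF c(1)]]) (rule image_mono, blast)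
    qed (use op in simp)
    then have "(\<lambda>x. ennreal (indicator (snd c ` ?S) x *\<^sub>R dens c x)) \<in> borel_measurable lborel" by measurable
    then show ?thesis by (rule measurable_cong[THEN iffD1, rotated]) (auto simp: indicator_def)
  qed
  ultimately have "AE x in lborel. ennreal (dens c x) * indicator (snd c ` ?S) x = 0"
    by (simp add: nn_integral_0_iff_AE)
  then have "AE x in lborel. x \<notin> snd c ` ?S"
    by (rule AE_mp) (intro AE_I2 impI, use dens_pos[OF c(1)] in \<open>force simp: indicator_def split: if_splits\<close>)
  then have "snd c ` ?S \<in> null_sets lborel" using op by (subst AE_iff_null_sets) auto
  then have "negligible (snd c ` ?S)"
    using null_sets_completionI negligible_iff_null_sets by blast
  then have "snd c ` ?S = {}" using op open_not_negligible by blast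
  then show False using c fp by blast
qed


section \<open>Green's identity in one chart and chart invariance of the Laplacian\<close>

lemma cgrad_cong:
  assumes c: "c \<in> \<A>" and W: "openin (top_of_set M) W" "W \<subseteq> chart_dom c" "p \<in> W"
    and eq: "\<And>q. q \<in> W \<Longrightarrow> f q = f' q"
  shows "cgrad c f u p = cgrad c f' u p"
proof -
  have "partial i (in_chart c f) (snd c p) = partial i (in_chart c f') (snd c p)" for i
    by (rule partial_cong[OF open_chart_image[OF c W(1,2)]]) (use W eq c in \<open>auto simp: subset_iff\<close>)
  then show ?thesis unfolding cgrad_matrix[OF c] by simp
qed

lemma cgrad_zero: "c \<in> \<A> \<Longrightarrow> cgrad c (\<lambda>q. 0) u p = 0"
  by (simp add: cgrad_matrix zero_vec_def[symmetric])

lemma openin_chart_diff: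
  assumes "c \<in> \<A>" "compact K"
  shows "openin (top_of_set M) (chart_dom c - K)"
proof -
  from openin_Int_open[OF chart(1)[OF assms(1)] open_Compl[OF compact_imp_closed[OF assms(2)]]]
  show ?thesis by (simp add: Diff_eq)
qed

text \<open>Formulated with the Laplacian of the one chart \<open>c\<close>, because it serves to
  prove that this expression does not depend on the chart.\<close>

lemma green_chart:
  assumes c: "c \<in> \<A>" and u: "Ck_on 2 (chart_img c) (in_chart c u)" and f: "Ck 1 f"
    and K: "compact K" "K \<subseteq> chart_dom c" and f0: "\<And>p. p \<in> M \<Longrightarrow> p \<notin> K \<Longrightarrow> f p = 0"
  defines "P \<equiv> \<lambda>p. if p \<in> chart_dom c then f p * claplace c u p + cgrad c f u p else 0"
  shows "Ck 0 P" "integral\<^sup>L vol P = 0"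
proof -
  interpret coordinate_metric "chart_img c" "g c" by (rule coordinate_metric[OF c])
  let ?V = "chart_img c"
  have oV: "open ?V" by (rule chart(2)[OF c])
  note fc = CkD[OF f c]
  have u': "Ck_on (Suc (Suc 0)) ?V (in_chart c u)" using u by (simp add: numeral_2_eq_2)
  have P0: "P p = 0" if p: "p \<in> M" "p \<notin> K" for p
  proof (cases "p \<in> chart_dom c")
    case True
    have "cgrad c f u p = cgrad c (\<lambda>q. 0) u p"
      by (rule cgrad_cong[OF c openin_chart_diff[OF c K(1)]])
        (use True p f0 chart_dom_subset[OF c] in auto)
    then show ?thesis using f0 p by (simp add: P_def cgrad_zero[OF c])
  qed (simp add: P_def)
  show CP: "Ck 0 P"
  proof (rule Ck_supported[OF c chart(1)[OF c] order_refl _ K P0])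
    show "Ck_on 0 ?V (in_chart c P)"
    proof (rule Ck_on_cong[OF oV])
      show "Ck_on 0 ?V (\<lambda>x. in_chart c f x * in_chart c (claplace c u) x + in_chart c (cgrad c f u) x)"
        by (intro Ck_on_add Ck_on_mult oV Ck_on_in_chart_claplace Ck_on_in_chart_cgrad c order_refl u'
            Ck_on_lower[OF u'] fc[unfolded One_nat_def] Ck_on_le[OF fc]) simp
    qed (use c chart_inv_in[OF c] in \<open>simp add: P_def\<close>)
  qed
  have "integral\<^sup>L vol P = integral\<^sup>L lborel (\<lambda>x. indicator ?V x * (dens c x * P (chart_inv c x)))"
    by (rule integral_vol_chart[OF c measurable_vol_continuous[OF continuous_Ck[OF CP]]]) (simp add: P_def)
  also have "\<dots> = integral\<^sup>L lborel (\<lambda>x. indicator ?V x * (rho x *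
      (in_chart c f x * coord_laplacian (g c) (in_chart c u) x + grad (in_chart c f) (in_chart c u) x)))"
  proof (rule Bochner_Integration.integral_cong[OF refl])
    fix x
    show "indicator ?V x * (dens c x * P (chart_inv c x)) = indicator ?V x * (rho x *
      (in_chart c f x * coord_laplacian (g c) (in_chart c u) x + grad (in_chart c f) (in_chart c u) x))"
      using chart_inv_in[OF c, of x] snd_chart_inv[OF c, of x]
      by (cases "x \<in> ?V") (simp_all add: dens_rho[OF c] P_def claplace_def cgrad_def)
  qed
  also have "\<dots> = 0"
  proof (rule green_compact_support[OF fc u])
    show "compact (snd c ` K)"
      by (intro compact_continuous_image continuous_on_subset[OF continuous_chart[OF c]] K)
    show "snd c ` K \<subseteq> ?V" using K by auto
    show "f (chart_inv c x) = 0" if x: "x \<in> ?V" "x \<notin> snd c ` K" for x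
    proof (rule f0)
      show "chart_inv c x \<in> M" using chart_inv_in[OF c x(1)] chart_dom_subset[OF c] by blast
      show "chart_inv c x \<notin> K" using x snd_chart_inv[OF c x(1)] by (metis imageI)
    qed
  qed
  finally show "integral\<^sup>L vol P = 0" .
qed

text \<open>
  The chart expressions of the Laplacian agree since their difference \<open>h\<close> integrates to zero
  against every test function, in particular against \<open>b h\<close> for a bump function \<open>b\<close>:
  both satisfy Green's identity with the same gradient term.
\<close>

lemma claplace_invariant:
  assumes c: "c \<in> \<A>" and d: "d \<in> \<A>" and p: "p \<in> chart_dom c" "p \<in> chart_dom d" and u: "Ck 3 u"
  shows "claplace c u p = claplace d u p"
proof -
  let ?W = "chart_dom c \<inter> chart_dom d"
  have oW: "openin (top_of_set M) ?W" by (rule openin_overlap[OF c d])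
  obtain r where r: "coord_ball (c, snd c p, r)" "chart_inv c ` cball (snd c p) r \<subseteq> ?W"
    using ex_coord_ball[OF c oW, of p] p by auto
  let ?K = "chart_inv c ` cball (snd c p) r"
  have r0: "r > 0" "cball (snd c p) r \<subseteq> chart_img c" using r(1) by (auto simp: coord_ball_def)
  have K: "compact ?K" by (intro compact_chart_inv_image c r0 compact_cball)
  define b where "b = bump c (snd c p) r"
  define h where "h q = claplace c u q - claplace d u q" for q
  define f where "f q = (if q \<in> ?W then b q * h q else 0)" for q
  have b0: "b q = 0" if "q \<notin> ?K" for q unfolding b_def using bump_zero[OF c r0(1) that] .
  \<comment> \<open>Three derivatives of \<open>u\<close> are assumed because the test function
    \<open>b h\<close> contains second derivatives of \<open>u\<close> and must itself be
    \<open>C^1\<close>.\<close>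
  have u3: "Ck_on (Suc (Suc 1)) (chart_img e) (in_chart e u)" if "e \<in> \<A>" for e
    using CkD[OF u that] by (simp add: numeral_3_eq_3)
  have oO: "open (snd e ` ?W)" if "e \<in> {c, d}" for e
    by (rule open_chart_image) (use that c d oW in auto)
  have f0: "f q = 0" if "q \<in> M" "q \<notin> ?K" for q using b0[OF that(2)] by (simp add: f_def)
  have "Ck_on 1 (snd c ` ?W) (in_chart c f)"
  proof (rule Ck_on_cong[OF oO])
    have 1: "Ck_on 1 (snd c ` ?W) (in_chart c (claplace c u))"
      by (rule Ck_on_subset[OF Ck_on_in_chart_claplace[OF c chart(2)[OF c] order_refl u3[OF c]]]) auto
    have "Ck_on 1 (snd c ` ?W) (\<lambda>x. in_chart d (claplace d u) (transition c d x))"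
      by (rule Ck_on_compose[OF _ chart(2)[OF d] Ck_on_in_chart_claplace[OF d chart(2)[OF d] order_refl u3[OF d]]
            Ck_transition[OF c d]])
        (use oO transition_in[OF c d] in auto)
    then have 2: "Ck_on 1 (snd c ` ?W) (in_chart c (claplace d u))"
      by (rule Ck_on_cong[rotated 2]) (use oO c d in \<open>auto simp: transition_def\<close>)
    show "Ck_on 1 (snd c ` ?W) (\<lambda>x. in_chart c b x * (in_chart c (claplace c u) x - in_chart c (claplace d u) x))"
      unfolding b_def using oO 1 2
      by (intro Ck_on_mult Ck_on_diff Ck_on_subset[OF Ck_on_bump[OF c]]) auto
  qed (use c in \<open>auto simp: f_def h_def\<close>)
  note Cf = Ck_supported[OF c oW Int_lower1 this K r(2) f0]
  have u2: "Ck_on 2 (chart_img e) (in_chart e u)" if "e \<in> \<A>" for e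
    using Ck_on_le[OF u3[OF that], of 2] by (simp add: numeral_2_eq_2)
  have Kc: "?K \<subseteq> chart_dom c" "?K \<subseteq> chart_dom d" using r(2) by auto
  define P where "P e q = (if q \<in> chart_dom e then f q * claplace e u q + cgrad e f u q else 0)" for e q
  have Pc: "Ck 0 (P c)" "integral\<^sup>L vol (P c) = 0"
    unfolding P_def using green_chart[OF c u2[OF c] Cf K Kc(1) f0] by simp_all
  have Pd: "Ck 0 (P d)" "integral\<^sup>L vol (P d) = 0"
    unfolding P_def using green_chart[OF d u2[OF d] Cf K Kc(2) f0] by simp_all
  have Pz: "P e q = 0" if e: "e \<in> \<A>" "q \<in> M" "q \<notin> ?K" for e q
  proof (cases "q \<in> chart_dom e")
    case True
    have "cgrad e f u q = cgrad e (\<lambda>q. 0) u q"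
      by (rule cgrad_cong[OF e(1) openin_chart_diff[OF e(1) K]])
        (use True e f0 chart_dom_subset[OF e(1)] in auto)
    then show ?thesis using f0 e by (simp add: P_def cgrad_zero)
  qed (simp add: P_def)
  have eq: "P c q - P d q = b q * (h q)\<^sup>2" if q: "q \<in> M" for q
  proof (cases "q \<in> ?K")
    case True
    then have qW: "q \<in> chart_dom c" "q \<in> chart_dom d" using r(2) by auto
    have "cgrad c f u q = cgrad d f u q"
      by (rule cgrad_invariant[OF c d qW Cf Ck_le[OF u one_le_numeral]])
    then show ?thesis using qW by (simp add: P_def f_def h_def power2_eq_square algebra_simps)
  next
    case False
    then show ?thesis using Pz[OF c q False] Pz[OF d q False] b0 by simp
  qed
  have "P c p - P d p = 0"
  proof (rule integral_eq_0_imp_eq_0)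
    show "continuous_on M (\<lambda>q. P c q - P d q)"
      by (rule continuous_Ck[OF Ck_diff[OF Pc(1) Pd(1)]])
    show "0 \<le> P c q - P d q" if "q \<in> M" for q
      unfolding eq[OF that] b_def by (simp add: bump_nonneg)
    show "integral\<^sup>L vol (\<lambda>q. P c q - P d q) = 0"
      using Pc Pd by (simp add: integrable_continuous[OF continuous_Ck])
    show "p \<in> M" using p chart_dom_subset[OF c] by blast
  qed
  moreover have "b p > 0"
    unfolding b_def
    by (rule bump_pos[OF c]) (use c p r0 ball_subset_cball[of "snd c p" r] in \<open>auto intro!: image_eqI[of _ _ "snd c p"]\<close>)
  ultimately show ?thesis using eq[of p] p chart_dom_subset[OF c] by (auto simp: h_def)
qed

section \<open>The Laplacian on the manifold and the global Green identity\<close>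

abbreviation L :: "('a \<Rightarrow> real) \<Rightarrow> 'a \<Rightarrow> real" where
  "L \<equiv> laplacian \<A> g"

lemma laplacian_eq: "c \<in> \<A> \<Longrightarrow> p \<in> chart_dom c \<Longrightarrow> Ck 3 u \<Longrightarrow> L u p = claplace c u p"
  using chart_at[of p] chart_dom_subset[of c] claplace_invariant[of "chart_at \<A> p" c p u]
  by (auto simp: laplacian_def claplace_def Let_def)

text \<open>The three successors keep the order of \<open>u\<close> at least 3, as chart
  independence of the Laplacian demands.\<close>

lemma Ck_laplacian:
  assumes "Ck (Suc (Suc (Suc k))) u" shows "Ck (Suc k) (L u)"
  unfolding Ck_def
proof
  fix c assume c: "c \<in> \<A>"
  have u3: "Ck 3 u" by (rule Ck_le[OF assms]) simp
  show "Ck_on (Suc k) (chart_img c) (in_chart c (L u))"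
    by (rule Ck_on_cong[OF chart(2)[OF c] _ Ck_on_in_chart_claplace[OF c chart(2)[OF c] order_refl CkD[OF assms c]]])
      (use laplacian_eq[OF c chart_inv_in[OF c] u3] in simp)
qed

lemma smooth_laplacian: "smooth_function \<A> u \<Longrightarrow> smooth_function \<A> (L u)"
  unfolding smooth_function_Ck by (metis Ck_laplacian Ck_le le_SucI order_refl)

lemma gradient_cong:
  assumes "p \<in> M" "\<And>q. q \<in> M \<Longrightarrow> f q = f' q"
  shows "gradient f u p = gradient f' u p"
  unfolding gradient_def
  by (rule cgrad_cong[OF chart_at(1)[OF assms(1)] chart(1)[OF chart_at(1)[OF assms(1)]] order_refl])
    (use assms chart_at[OF assms(1)] chart_dom_subset in blast)+

lemma gradient_sum:
  assumes p: "p \<in> M" and f: "\<And>i. i \<in> I \<Longrightarrow> Ck 1 (f i)"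
  shows "gradient (\<lambda>q. \<Sum>i\<in>I. f i q) u p = (\<Sum>i\<in>I. gradient (f i) u p)"
proof -
  let ?c = "chart_at \<A> p"
  have c: "?c \<in> \<A>" "p \<in> chart_dom ?c" using chart_at[OF p] .
  have "partial j (\<lambda>x. \<Sum>i\<in>I. in_chart ?c (f i) x) (snd ?c p) = (\<Sum>i\<in>I. partial j (in_chart ?c (f i)) (snd ?c p))" for j
    by (rule partial_sum) (use Ck_on_differentiable[OF CkD[OF f c(1)]] c(2) in auto)
  then have "(\<chi> j. partial j (in_chart ?c (\<lambda>q. \<Sum>i\<in>I. f i q)) (snd ?c p)) =
      (\<Sum>i\<in>I. \<chi> j. partial j (in_chart ?c (f i)) (snd ?c p))"
    by (simp add: vec_eq_iff sum_component)
  then show ?thesis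
    unfolding gradient_def cgrad_matrix[OF c(1)] by (simp add: inner_sum_left)
qed

lemma Ck_gradient:
  assumes "Ck (Suc k) u" "Ck (Suc k) v" shows "Ck k (gradient u v)"
  unfolding Ck_def
proof
  fix c assume c: "c \<in> \<A>"
  show "Ck_on k (chart_img c) (in_chart c (gradient u v))"
    by (rule Ck_on_cong[OF chart(2)[OF c] _ Ck_on_in_chart_cgrad[OF c chart(2)[OF c] order_refl CkD[OF assms(1) c] CkD[OF assms(2) c]]])
      (use gradient_eq[OF c chart_inv_in[OF c] Ck_le[OF assms(1)] Ck_le[OF assms(2)]] in simp)
qed

text \<open>Bumps on a finite cover by coordinate balls, divided by their sum. They are only
  \<open>C^1\<close>, which suffices for the first-order factor in Green's identity.\<close>

lemma partition_of_unity:
  obtains I :: "('a chart \<times> (real^3) \<times> real) set" and \<rho> K where "finite I"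
    "\<And>i. i \<in> I \<Longrightarrow> fst i \<in> \<A>" "\<And>i. i \<in> I \<Longrightarrow> Ck 1 (\<rho> i)" "\<And>i. i \<in> I \<Longrightarrow> compact (K i)"
    "\<And>i. i \<in> I \<Longrightarrow> K i \<subseteq> chart_dom (fst i)" "\<And>i p. i \<in> I \<Longrightarrow> p \<in> M \<Longrightarrow> p \<notin> K i \<Longrightarrow> \<rho> i p = 0"
    "\<And>p. p \<in> M \<Longrightarrow> (\<Sum>i\<in>I. \<rho> i p) = 1"
proof -
  obtain I where I: "finite I" "\<And>z. z \<in> I \<Longrightarrow> coord_ball z" "M \<subseteq> (\<Union>(c, x, r)\<in>I. chart_inv c ` ball x r)"
    using finite_coord_ball_cover by blast
  define b where "b z = bump (fst z) (fst (snd z)) (snd (snd z))" for z :: "'a chart \<times> (real^3) \<times> real"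
  define K where "K z = chart_inv (fst z) ` cball (fst (snd z)) (snd (snd z))" for z :: "'a chart \<times> (real^3) \<times> real"
  define B where "B p = (\<Sum>z\<in>I. b z p)" for p
  have gd: "fst z \<in> \<A>" "snd (snd z) > 0" "cball (fst (snd z)) (snd (snd z)) \<subseteq> chart_img (fst z)" if "z \<in> I" for z
    using I(2)[OF that] by (auto simp: coord_ball_def split: prod.splits)
  have Cb: "Ck 1 (b z)" if "z \<in> I" for z
    unfolding b_def by (rule Ck_bump[OF gd[OF that]])
  have CB: "Ck 1 B" unfolding B_def[abs_def] by (intro Ck_sum Cb)
  have Bpos: "B p > 0" if p: "p \<in> M" for p
  proof -
    obtain z where z: "z \<in> I" "p \<in> chart_inv (fst z) ` ball (fst (snd z)) (snd (snd z))"
      using subsetD[OF I(3) p] unfolding case_prod_beta by (elim UN_E)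
    have "b z p > 0"
      unfolding b_def
      by (rule bump_pos[OF gd(1)[OF z(1)] z(2) order_trans[OF ball_subset_cball gd(3)[OF z(1)]]])
    then show ?thesis
      unfolding B_def by (intro sum_pos2[OF I(1) z(1)]) (auto simp: b_def bump_nonneg)
  qed
  show thesis
  proof (rule that[of I "\<lambda>z p. b z p / B p" K])
    fix z assume z: "z \<in> I"
    show "Ck 1 (\<lambda>p. b z p / B p)"
      by (rule Ck_divide[OF Cb[OF z] CB]) (use Bpos in force)
    show "compact (K z)"
      unfolding K_def by (intro compact_chart_inv_image gd z compact_cball)
    show "K z \<subseteq> chart_dom (fst z)"
      unfolding K_def using gd[OF z] chart_inv_in[OF gd(1)[OF z]] by blast
    show "b z p / B p = 0" if "p \<in> M" "p \<notin> K z" for p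
      using bump_zero[OF gd(1,2)[OF z]] that by (simp add: K_def b_def)
  next
    show "(\<Sum>z\<in>I. b z p / B p) = 1" if "p \<in> M" for p
      using Bpos[OF that] by (simp add: sum_divide_distrib[symmetric] B_def[symmetric])
  qed (fact I(1) gd(1))+
qed

text \<open>Only the factor \<open>u\<close> is localised. The function \<open>v\<close>, which is
  differentiated twice, is never multiplied by the \<open>C^1\<close> cutoffs.\<close>

lemma green:
  assumes u: "Ck 1 u" and v: "Ck 3 v"
  shows "integral\<^sup>L vol (\<lambda>p. u p * L v p + gradient u v p) = 0"
proof -
  obtain I :: "('a chart \<times> (real^3) \<times> real) set" and \<rho> K where I: "finite I" and
    *: "\<And>i. i \<in> I \<Longrightarrow> fst i \<in> \<A>" "\<And>i. i \<in> I \<Longrightarrow> Ck 1 (\<rho> i)" "\<And>i. i \<in> I \<Longrightarrow> compact (K i)"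
    "\<And>i. i \<in> I \<Longrightarrow> K i \<subseteq> chart_dom (fst i)" "\<And>i p. i \<in> I \<Longrightarrow> p \<in> M \<Longrightarrow> p \<notin> K i \<Longrightarrow> \<rho> i p = 0"
    and one: "\<And>p. p \<in> M \<Longrightarrow> (\<Sum>i\<in>I. \<rho> i p) = 1"
    by (rule partition_of_unity) (rule that, assumption+)
  define f where "f i p = \<rho> i p * u p" for i p
  have Cf: "Ck 1 (f i)" if "i \<in> I" for i unfolding f_def by (intro Ck_mult * u that)
  have sf: "(\<Sum>i\<in>I. f i p) = u p" if "p \<in> M" for p
    unfolding f_def using one[OF that] by (simp add: sum_distrib_right[symmetric])
  have Lv: "Ck 1 (L v)" using Ck_laplacian[of 0 v] v by (simp add: numeral_3_eq_3)
  have ci: "continuous_on M (\<lambda>p. f i p * L v p + gradient (f i) v p)" if "i \<in> I" for i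
    by (rule continuous_Ck[of 0], intro Ck_add Ck_mult Ck_gradient)
      (use Cf[OF that] Lv v in \<open>auto intro: Ck_le\<close>)
  have "integral\<^sup>L vol (\<lambda>p. f i p * L v p + gradient (f i) v p) = 0" if i: "i \<in> I" for i
  proof -
    let ?c = "fst i"
    note c = *(1)[OF i]
    let ?P = "\<lambda>p. if p \<in> chart_dom ?c then f i p * claplace ?c v p + cgrad ?c (f i) v p else 0"
    have "?P p = f i p * L v p + gradient (f i) v p" if p: "p \<in> M" for p
    proof (cases "p \<in> chart_dom ?c")
      case True
      then show ?thesis
        using laplacian_eq[OF c True v] gradient_eq[OF c True Cf[OF i] Ck_le[OF v]] by simp
    next
      case False
      let ?d = "chart_at \<A> p"
      note d = chart_at[OF p]
      have pK: "p \<notin> K i" using False *(4)[OF i] by blast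
      \<comment> \<open>Since \<open>K i\<close> is closed, \<open>f i\<close> vanishes not only at
        \<open>p\<close> but on the neighbourhood \<open>chart_dom ?d - K i\<close>, so its
        derivatives at \<open>p\<close> vanish as well.\<close>
      have "gradient (f i) v p = cgrad ?d (\<lambda>q. 0) v p"
        unfolding gradient_def
        by (rule cgrad_cong[OF d(1) openin_chart_diff[OF d(1) *(3)[OF i]]])
          (use d pK chart_dom_subset[OF d(1)] *(5)[OF i] in \<open>auto simp: f_def\<close>)
      then show ?thesis using False *(5)[OF i p pK] by (simp add: f_def cgrad_zero[OF d(1)])
    qed
    then have "integral\<^sup>L vol (\<lambda>p. f i p * L v p + gradient (f i) v p) = integral\<^sup>L vol ?P"
      by (intro Bochner_Integration.integral_cong) (auto simp: space_vol)
    also have "\<dots> = 0"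
      by (rule green_chart(2)[OF c _ Cf[OF i] *(3)[OF i] *(4)[OF i]])
        (use Ck_on_le[OF CkD[OF v c]] *(5)[OF i] in \<open>auto simp: f_def\<close>)
    finally show ?thesis .
  qed
  then have "integral\<^sup>L vol (\<lambda>p. \<Sum>i\<in>I. f i p * L v p + gradient (f i) v p) = 0"
    by (simp add: Bochner_Integration.integral_sum integrable_continuous ci)
  moreover have "(\<Sum>i\<in>I. f i p * L v p + gradient (f i) v p) = u p * L v p + gradient u v p" if p: "p \<in> M" for p
  proof -
    have "(\<Sum>i\<in>I. gradient (f i) v p) = gradient u v p"
      using gradient_sum[OF p Cf, of I "\<lambda>i. i" v] gradient_cong[OF p sf, of "\<lambda>q. q" v] by simp
    then show ?thesis using sf[OF p] by (simp add: sum.distrib sum_distrib_right[symmetric])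
  qed
  ultimately show ?thesis
    by (subst Bochner_Integration.integral_cong[where g="\<lambda>p. \<Sum>i\<in>I. f i p * L v p + gradient (f i) v p"])
      (auto simp: space_vol)
qed


section \<open>The L^2 inner product and the symmetry of the Laplacian\<close>

lemma gradient_sym:
  assumes "p \<in> M" shows "gradient u v p = gradient v u p"
proof -
  let ?c = "chart_at \<A> p"
  interpret coordinate_metric "chart_img ?c" "g ?c" by (rule coordinate_metric[OF chart_at(1)[OF assms]])
  have x: "snd ?c p \<in> chart_img ?c" using chart_at(2)[OF assms] by auto
  show ?thesis unfolding gradient_def cgrad_def grad_def
    by (subst sum.swap) (simp add: ginv_sym[OF x] mult_ac)
qed

text \<open>Raising the index turns the differential \<open>d\<close> into the gradient vector
  \<open>w\<close>, whose square with respect to the metric itself is the quantity in question; thus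
  positivity of the metric can be used in place of positivity of its inverse.\<close>

lemma gradient_nonneg:
  assumes "p \<in> M" shows "gradient u u p \<ge> 0"
proof -
  let ?c = "chart_at \<A> p" and ?x = "snd (chart_at \<A> p) p"
  have c: "?c \<in> \<A>" using chart_at(1)[OF assms] .
  interpret coordinate_metric "chart_img ?c" "g ?c" by (rule coordinate_metric[OF c])
  have x: "?x \<in> chart_img ?c" using chart_at(2)[OF assms] by auto
  define d where "d = (\<chi> i. partial i (in_chart ?c u) ?x)"
  define w where "w = matrix_inv (g ?c ?x) *v d"
  have "g ?c ?x *v w = d"
    unfolding w_def using matrix_inv_right_left(1)[of "g ?c ?x"] det_pos[OF x]
    by (simp add: matrix_vector_mul_assoc)
  then have "d \<bullet> w = w \<bullet> (g ?c ?x *v w)" by (simp add: inner_commute)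
  also have "\<dots> \<ge> 0" using posdef[OF x, of w] by (cases "w = 0") auto
  finally show ?thesis unfolding gradient_def cgrad_matrix[OF c] d_def w_def .
qed

definition ip :: "('a \<Rightarrow> real) \<Rightarrow> ('a \<Rightarrow> real) \<Rightarrow> real" where
  "ip u v = integral\<^sup>L vol (\<lambda>p. u p * v p)"

lemma ip_commute: "ip u v = ip v u"
  by (simp add: ip_def mult.commute)

lemma ip_cong: "(\<And>p. p \<in> M \<Longrightarrow> u p = u' p) \<Longrightarrow> (\<And>p. p \<in> M \<Longrightarrow> v p = v' p) \<Longrightarrow> ip u v = ip u' v'"
  unfolding ip_def by (rule Bochner_Integration.integral_cong) (auto simp: space_vol)

lemma ip_nonneg: "ip u u \<ge> 0"
  by (simp add: ip_def)

lemma ip_integrable: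
  fixes u v :: "'a \<Rightarrow> real"
  shows "continuous_on M u \<Longrightarrow> continuous_on M v \<Longrightarrow> integrable vol (\<lambda>p. u p * v p)"
  by (intro integrable_continuous continuous_on_mult)

lemma ip_linear:
  assumes "continuous_on M f" "continuous_on M u" "continuous_on M v"
  shows "ip f (\<lambda>p. a * u p + b * v p) = a * ip f u + b * ip f v"
proof -
  have "ip f (\<lambda>p. a * u p + b * v p) = integral\<^sup>L vol (\<lambda>p. a * (f p * u p) + b * (f p * v p))"
    unfolding ip_def by (simp add: algebra_simps)
  then show ?thesis
    unfolding ip_def using assms by (simp add: ip_integrable)
qed

lemma ip_definite:
  assumes "continuous_on M u" "ip u u = 0" "p \<in> M" shows "u p = 0"
  using integral_eq_0_imp_eq_0[of "\<lambda>p. u p * u p" p] assms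
  by (auto simp: ip_def intro!: continuous_intros)

lemma ip_Cauchy_Schwarz:
  assumes "continuous_on M u" "continuous_on M v"
  shows "\<bar>ip u v\<bar> \<le> sqrt (ip u u) * sqrt (ip v v)"
proof -
  have q: "0 \<le> ip u u + 2 * t * ip u v + t\<^sup>2 * ip v v" for t
  proof -
    let ?w = "\<lambda>p. 1 * u p + t * v p"
    have cw: "continuous_on M ?w" by (intro continuous_intros assms)
    have "ip ?w ?w = 1 * ip ?w u + t * ip ?w v" by (rule ip_linear[OF cw assms])
    also have "ip ?w u = 1 * ip u u + t * ip u v"
      unfolding ip_commute[of ?w] by (rule ip_linear[OF assms(1) assms])
    also have "ip ?w v = 1 * ip v u + t * ip v v"
      unfolding ip_commute[of ?w] by (rule ip_linear[OF assms(2) assms])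
    finally show ?thesis
      using ip_nonneg[of ?w] ip_commute[of v u] by (simp add: algebra_simps power2_eq_square)
  qed
  have "(ip u v)\<^sup>2 \<le> ip u u * ip v v"
  proof (cases "ip v v = 0")
    case True
    have "ip u v = 0"
    proof (rule ccontr)
      assume "ip u v \<noteq> 0"
      \<comment> \<open>With \<open>ip v v = 0\<close> the quadratic polynomial in \<open>t\<close>
        is affine, and this \<open>t\<close> gives it the value -1.\<close>
      then show False using q[of "- (ip u u + 1) / (2 * ip u v)"] True
        by (simp add: field_simps)
    qed
    then show ?thesis using True by simp
  next
    case False
    then have pos: "ip v v > 0" using ip_nonneg[of v] by simp
    have "0 \<le> (ip u u + 2 * (- ip u v / ip v v) * ip u v + (- ip u v / ip v v)\<^sup>2 * ip v v) * ip v v"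
      by (rule mult_nonneg_nonneg[OF q less_imp_le[OF pos]])
    also have "\<dots> = ip u u * ip v v - (ip u v)\<^sup>2"
      using pos by (simp add: field_simps power2_eq_square)
    finally show ?thesis by simp
  qed
  then have "sqrt ((ip u v)\<^sup>2) \<le> sqrt (ip u u * ip v v)" by (rule real_sqrt_le_mono)
  then show ?thesis by (simp add: real_sqrt_mult)
qed

abbreviation smooth :: "('a \<Rightarrow> real) \<Rightarrow> bool" where
  "smooth \<equiv> smooth_function \<A>"

lemma smooth_Ck: "smooth u \<Longrightarrow> Ck k u"
  by (simp add: smooth_function_Ck)

lemma smooth_continuous: "smooth u \<Longrightarrow> continuous_on M u"
  by (rule continuous_Ck[OF smooth_Ck])

lemma smooth_add: "smooth u \<Longrightarrow> smooth v \<Longrightarrow> smooth (\<lambda>p. u p + v p)"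
  by (simp add: smooth_function_Ck Ck_add)

lemma smooth_scale: "smooth u \<Longrightarrow> smooth (\<lambda>p. a * u p)"
  by (simp add: smooth_function_Ck Ck_mult Ck_const)

lemma smooth_laplacian_power: "smooth u \<Longrightarrow> smooth ((L ^^ n) u)"
  by (induction n) (auto intro: smooth_laplacian)

lemma ip_laplacian:
  assumes u: "smooth u" and v: "smooth v"
  shows "ip u (L v) = - integral\<^sup>L vol (gradient u v)"
proof -
  have "integrable vol (gradient u v)"
    by (intro integrable_continuous continuous_Ck[of 0] Ck_gradient smooth_Ck u v)
  moreover have "integrable vol (\<lambda>p. u p * L v p)"
    by (intro ip_integrable smooth_continuous smooth_laplacian u v)
  ultimately show ?thesis
    using green[OF smooth_Ck[OF u] smooth_Ck[OF v]] by (simp add: ip_def)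
qed

lemma ip_laplacian_sym:
  assumes "smooth u" "smooth v" shows "ip u (L v) = ip (L u) v"
proof -
  have "integral\<^sup>L vol (gradient u v) = integral\<^sup>L vol (gradient v u)"
    by (rule Bochner_Integration.integral_cong) (auto simp: space_vol intro: gradient_sym)
  then show ?thesis using ip_laplacian assms by (simp add: ip_commute[of "L u"])
qed

lemma ip_laplacian_power_sym:
  assumes "smooth u" "smooth v" shows "ip u ((L ^^ n) v) = ip ((L ^^ n) u) v"
  using assms
proof (induction n arbitrary: u)
  case (Suc n)
  have "ip u ((L ^^ Suc n) v) = ip (L u) ((L ^^ n) v)"
    using ip_laplacian_sym[OF Suc.prems(1) smooth_laplacian_power[OF Suc.prems(2)]] by simp
  also have "\<dots> = ip ((L ^^ n) (L u)) v" by (rule Suc.IH[OF smooth_laplacian[OF Suc.prems(1)] Suc.prems(2)])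
  finally show ?case by (simp add: funpow_swap1)
qed simp

lemma ip_laplacian_nonpos: "smooth u \<Longrightarrow> ip u (L u) \<le> 0"
  using ip_laplacian[of u u] integral_nonneg_AE[OF AE_I2, of vol "gradient u u"]
  by (simp add: space_vol gradient_nonneg)

text \<open>Weak argument: pair the defect \<open>?D\<close> with itself, move the Laplacian onto
  \<open>?D\<close> by symmetry, where linearity of the integral applies, and move it back. The
  coefficients 1 and -1 in \<open>?D\<close> match the form of \<open>ip_linear\<close>.\<close>

lemma laplacian_linear:
  assumes u: "smooth u" and v: "smooth v" and p: "p \<in> M"
  shows "L (\<lambda>q. a * u q + b * v q) p = a * L u p + b * L v p"
proof -
  let ?w = "\<lambda>q. a * u q + b * v q"
  have w: "smooth ?w" by (intro smooth_add smooth_scale u v)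
  let ?D = "\<lambda>q. 1 * L ?w q + (-1) * (a * L u q + b * L v q)"
  note c = smooth_continuous[OF u] smooth_continuous[OF v] smooth_continuous[OF w]
    smooth_continuous[OF smooth_laplacian[OF u]] smooth_continuous[OF smooth_laplacian[OF v]]
    smooth_continuous[OF smooth_laplacian[OF w]]
  have D: "smooth ?D" by (intro smooth_add smooth_scale smooth_laplacian u v w)
  have "ip ?D ?D = 1 * ip ?D (L ?w) + (-1) * ip ?D (\<lambda>q. a * L u q + b * L v q)"
    by (rule ip_linear) (intro smooth_continuous[OF D] c continuous_intros)+
  also have "ip ?D (\<lambda>q. a * L u q + b * L v q) = a * ip ?D (L u) + b * ip ?D (L v)"
    by (rule ip_linear) (intro smooth_continuous[OF D] c continuous_intros)+
  also have "ip ?D (L ?w) = ip (L ?D) ?w" by (rule ip_laplacian_sym[OF D w])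
  also have "\<dots> = a * ip (L ?D) u + b * ip (L ?D) v"
    by (rule ip_linear) (intro smooth_continuous[OF smooth_laplacian[OF D]] c continuous_intros)+
  also have "ip (L ?D) u = ip ?D (L u)" by (rule ip_laplacian_sym[OF D u, symmetric])
  also have "ip (L ?D) v = ip ?D (L v)" by (rule ip_laplacian_sym[OF D v, symmetric])
  finally have "ip ?D ?D = 0" by simp
  from ip_definite[OF smooth_continuous[OF D] this p] show ?thesis by simp
qed

text \<open>Identities for the iterates of the Laplacian are available on \<open>M\<close> only, not
  on the whole ambient type; this carries them through one more application.\<close>

lemma laplacian_cong:
  assumes "p \<in> M" "\<And>q. q \<in> M \<Longrightarrow> u q = v q"
  shows "L u p = L v p"
proof -
  let ?c = "chart_at \<A> p"
  have c: "?c \<in> \<A>" "p \<in> chart_dom ?c" using chart_at[OF assms(1)] .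
  have 0: "in_chart ?c u x = in_chart ?c v x" if "x \<in> chart_img ?c" for x
    using that assms(2) chart_inv_in[OF c(1)] chart_dom_subset[OF c(1)] by blast
  have x: "snd ?c p \<in> chart_img ?c" using c by auto
  have 1: "partial j (in_chart ?c u) x = partial j (in_chart ?c v) x" if "x \<in> chart_img ?c" for x j
    by (rule partial_cong[OF chart(2)[OF c(1)] that 0])
  have 2: "partial i (partial j (in_chart ?c u)) x = partial i (partial j (in_chart ?c v)) x" if "x \<in> chart_img ?c" for x i j
    by (rule partial_cong[OF chart(2)[OF c(1)] that 1])
  show ?thesis
    unfolding laplacian_def Let_def coord_laplacian_def covariant_hessian_def 1[OF x] 2[OF x] ..
qed

lemma laplacian_power_linear:
  assumes u: "smooth u" and v: "smooth v" and p: "p \<in> M"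
  shows "(L ^^ n) (\<lambda>q. a * u q + b * v q) p = a * (L ^^ n) u p + b * (L ^^ n) v p"
  using p
proof (induction n arbitrary: p)
  case (Suc n)
  have "(L ^^ Suc n) (\<lambda>q. a * u q + b * v q) p = L (\<lambda>q. a * (L ^^ n) u q + b * (L ^^ n) v q) p"
    using Suc by (auto intro: laplacian_cong)
  then show ?case
    using laplacian_linear[OF smooth_laplacian_power[OF u] smooth_laplacian_power[OF v] Suc.prems] by simp
qed simp

end


section \<open>Spacetime functions\<close>

lemma Ck_on_Pair_const:
  assumes "open S" shows "Ck_on k S (\<lambda>x. (t, x))"
proof -
  have "Ck_on k S (\<lambda>x. (t, 0) + (0, x))"
    by (intro Ck_on_add Ck_on_const Ck_on_bounded_linear[OF assms _ Ck_on_ident[OF assms]]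
        bounded_linear_Pair bounded_linear_zero bounded_linear_ident assms)
  then show ?thesis by simp
qed

context closed_riemannian
begin

abbreviation spacetime_smooth :: "(real \<Rightarrow> 'a \<Rightarrow> real) \<Rightarrow> bool" where
  "spacetime_smooth \<equiv> smooth_spacetime_function \<A>"

abbreviation in_chart2 :: "'a chart \<Rightarrow> (real \<Rightarrow> 'a \<Rightarrow> real) \<Rightarrow> real \<times> (real^3) \<Rightarrow> real" where
  "in_chart2 c U \<equiv> \<lambda>(t, x). U t (chart_inv c x)"

lemma open_cylinder: "c \<in> \<A> \<Longrightarrow> open ({0::real<..} \<times> chart_img c)"
  by (intro open_Times open_greaterThan chart)

lemma spacetime_smoothD:
  "spacetime_smooth U \<Longrightarrow> c \<in> \<A> \<Longrightarrow> Ck_on k ({0<..} \<times> chart_img c) (in_chart2 c U)"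
  by (simp add: smooth_spacetime_function_def smooth_on_def)

lemma spacetime_smoothI:
  "(\<And>c k. c \<in> \<A> \<Longrightarrow> Ck_on k ({0<..} \<times> chart_img c) (in_chart2 c U)) \<Longrightarrow> spacetime_smooth U"
  by (simp add: smooth_spacetime_function_def smooth_on_def)

lemma smooth_slice:
  assumes "spacetime_smooth U" "t > 0" shows "smooth (U t)"
  unfolding smooth_function_Ck Ck_def
proof (intro allI ballI)
  fix k c assume c: "c \<in> \<A>"
  have "Ck_on k (chart_img c) (\<lambda>x. in_chart2 c U (t, x))"
    by (rule Ck_on_compose[OF chart(2)[OF c] open_cylinder[OF c] spacetime_smoothD[OF assms(1) c]
          Ck_on_Pair_const[OF chart(2)[OF c]]]) (use assms(2) in auto)
  then show "Ck_on k (chart_img c) (in_chart c (U t))" by simp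
qed

lemma in_chart2_has_derivative:
  assumes "spacetime_smooth U" "c \<in> \<A>" "t > 0" "x \<in> chart_img c"
  shows "(in_chart2 c U has_derivative frechet_derivative (in_chart2 c U) (at (t, x))) (at (t, x))"
  by (rule Ck_on_has_derivative[OF spacetime_smoothD[OF assms(1,2), of 1]]) (use assms in auto)

lemma time_derivative_in_chart:
  assumes "spacetime_smooth U" "c \<in> \<A>" "t > 0" "x \<in> chart_img c"
  shows "((\<lambda>s. U s (chart_inv c x)) has_real_derivative
    frechet_derivative (in_chart2 c U) (at (t, x)) (1, 0)) (at t)"
proof -
  have "((\<lambda>s. in_chart2 c U ((0, x) + s *\<^sub>R (1, 0))) has_real_derivative
    frechet_derivative (in_chart2 c U) (at (t, x)) (1, 0)) (at t)"
    by (rule has_derivative_along) (use in_chart2_has_derivative[OF assms] in simp)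
  then show ?thesis by simp
qed

definition dt :: "(real \<Rightarrow> 'a \<Rightarrow> real) \<Rightarrow> real \<Rightarrow> 'a \<Rightarrow> real" where
  "dt U t p = deriv (\<lambda>s. U s p) t"

lemma has_time_derivative:
  assumes "spacetime_smooth U" "t > 0" "p \<in> M"
  shows "((\<lambda>s. U s p) has_real_derivative dt U t p) (at t)"
proof -
  obtain c where c: "c \<in> \<A>" "p \<in> chart_dom c" using ex_chart assms(3) by blast
  have "\<exists>D. ((\<lambda>s. U s p) has_real_derivative D) (at t)"
    using time_derivative_in_chart[OF assms(1) c(1) assms(2), of "snd c p"] c by auto
  then show ?thesis unfolding dt_def by (metis DERIV_imp_deriv)
qed

lemma spacetime_smooth_dt:
  assumes U: "spacetime_smooth U" shows "spacetime_smooth (dt U)"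
proof (rule spacetime_smoothI)
  fix c k assume c: "c \<in> \<A>"
  show "Ck_on k ({0<..} \<times> chart_img c) (in_chart2 c (dt U))"
    by (rule Ck_on_cong[OF open_cylinder[OF c] _ Ck_on_SucD[OF spacetime_smoothD[OF U c], of _ "(1, 0)"]])
      (auto simp: dt_def DERIV_imp_deriv[OF time_derivative_in_chart[OF U c]] simp del: image_iff)
qed

lemma Ck_on_snd_compose:
  assumes "c \<in> \<A>" "Ck_on k (chart_img c) f"
  shows "Ck_on k ({0::real<..} \<times> chart_img c) (\<lambda>z. f (snd z))"
  by (rule Ck_on_compose[OF open_cylinder[OF assms(1)] chart(2)[OF assms(1)] assms(2)
        Ck_on_bounded_linear[OF open_cylinder[OF assms(1)] bounded_linear_snd Ck_on_ident[OF open_cylinder[OF assms(1)]]]])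
    auto

text \<open>A spatial derivative at frozen time is the derivative of the joint function in the
  direction \<open>(0, axis i 1)\<close>, hence again jointly regular in time and space.\<close>

lemma Ck_on_partial_slice:
  assumes c: "c \<in> \<A>" and F: "Ck_on (Suc k) ({0::real<..} \<times> chart_img c) (\<lambda>z. F (fst z) (snd z))"
  shows "Ck_on k ({0<..} \<times> chart_img c) (\<lambda>z. partial i (F (fst z)) (snd z))"
proof (rule Ck_on_cong[OF open_cylinder[OF c] _ Ck_on_SucD[OF F, of "(0, axis i 1)"]])
  fix z :: "real \<times> (real^3)" assume z: "z \<in> {0<..} \<times> chart_img c"
  let ?F = "\<lambda>z. F (fst z) (snd z)"
  have "(?F has_derivative frechet_derivative ?F (at z)) (at (fst z, snd z))"
    using Ck_on_has_derivative[OF F _ z] by simp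
  from has_derivative_compose[OF has_derivative_Pair[OF has_derivative_const has_derivative_ident] this]
  have "(F (fst z) has_derivative (\<lambda>v. frechet_derivative ?F (at z) (0, v))) (at (snd z))" by simp
  then show "frechet_derivative ?F (at z) (0, axis i 1) = partial i (F (fst z)) (snd z)"
    by (simp add: partial_has_derivative)
qed

lemma spacetime_smooth_laplacian:
  assumes U: "spacetime_smooth U" shows "spacetime_smooth (\<lambda>t. L (U t))"
proof (rule spacetime_smoothI)
  fix c k assume c: "c \<in> \<A>"
  interpret coordinate_metric "chart_img c" "g c" by (rule coordinate_metric[OF c])
  let ?C = "{0::real<..} \<times> chart_img c"
  have oC: "open ?C" by (rule open_cylinder[OF c])
  have F: "Ck_on j ?C (\<lambda>z. in_chart c (U (fst z)) (snd z))" for j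
    using spacetime_smoothD[OF U c, of j] by (simp add: case_prod_unfold)
  have F1: "Ck_on j ?C (\<lambda>z. partial i (in_chart c (U (fst z))) (snd z))" for i j
    by (rule Ck_on_partial_slice[OF c F])
  have F2: "Ck_on j ?C (\<lambda>z. partial i (partial l (in_chart c (U (fst z)))) (snd z))" for i j l
    by (rule Ck_on_partial_slice[OF c F1])
  have gi: "Ck_on j ?C (\<lambda>z. ginv a b (snd z))" for j a b
    by (rule Ck_on_snd_compose[OF c Ck_ginv])
  have pG: "Ck_on j ?C (\<lambda>z. partial l (\<lambda>y. g c y $ a $ b) (snd z))" for a b l j
    by (rule Ck_on_snd_compose[OF c Ck_partial[OF Ck_G]])
  show "Ck_on k ?C (in_chart2 c (\<lambda>t. L (U t)))"
  proof (rule Ck_on_cong[OF oC])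
    show "Ck_on k ?C (\<lambda>z. coord_laplacian (g c) (in_chart c (U (fst z))) (snd z))"
      unfolding coord_laplacian_def covariant_hessian_def christoffel_def ginv_def[symmetric]
      by (intro Ck_on_sum Ck_on_mult Ck_on_diff Ck_on_add oC gi pG Ck_on_const F1 F2)
    show "coord_laplacian (g c) (in_chart c (U (fst z))) (snd z) = in_chart2 c (\<lambda>t. L (U t)) z" if "z \<in> ?C" for z
      using that laplacian_eq[OF c chart_inv_in[OF c] smooth_Ck[OF smooth_slice[OF U]]] snd_chart_inv[OF c]
      by (auto simp: claplace_def simp del: image_iff)
  qed
qed

lemma continuous_spacetime:
  assumes U: "spacetime_smooth U" shows "continuous_on ({0<..} \<times> M) (\<lambda>z. U (fst z) (snd z))"
proof (unfold continuous_on_eq_continuous_within, rule ballI)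
  fix z :: "real \<times> 'a" assume z: "z \<in> {0<..} \<times> M"
  then have "snd z \<in> M" by (simp add: mem_Times_iff)
  then obtain c where c: "c \<in> \<A>" "snd z \<in> chart_dom c" using ex_chart by blast
  let ?S = "{0::real<..} \<times> chart_dom c"
  have "continuous_on ?S (\<lambda>z. (fst z, snd c (snd z)))"
    by (intro continuous_intros continuous_on_compose2[OF continuous_chart[OF c(1)]]) auto
  then have "continuous_on ?S (\<lambda>z. in_chart2 c U (fst z, snd c (snd z)))"
    by (rule continuous_on_compose2[OF Ck_on_continuous[OF spacetime_smoothD[OF U c(1), of 0]]]) auto
  then have "continuous_on ?S (\<lambda>z. U (fst z) (snd z))"
    by (rule continuous_on_eq) (use c in auto)
  moreover have zS: "z \<in> ?S" using z c by (auto simp: mem_Times_iff)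
  ultimately have "continuous (at z within ?S) (\<lambda>z. U (fst z) (snd z))"
    by (metis continuous_on_eq_continuous_within)
  moreover have "openin (top_of_set ({0::real<..} \<times> M)) ?S"
    by (intro openin_Times chart c openin_subtopology_self)
  then have "at z within ?S = at z within ({0<..} \<times> M)"
    using zS by (rule at_within_openin)
  ultimately show "continuous (at z within ({0<..} \<times> M)) (\<lambda>z. U (fst z) (snd z))"
    by (simp add: continuous_within)
qed

section \<open>Differentiation under the integral sign\<close>

lemma integral_has_derivative:
  fixes F F' :: "real \<Rightarrow> 'a \<Rightarrow> real"
  assumes cF: "continuous_on ({0<..} \<times> M) (\<lambda>z. F (fst z) (snd z))"
    and cF': "continuous_on ({0<..} \<times> M) (\<lambda>z. F' (fst z) (snd z))"
    and D: "\<And>t p. t > 0 \<Longrightarrow> p \<in> M \<Longrightarrow> ((\<lambda>s. F s p) has_real_derivative F' t p) (at t)"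
    and t: "t > 0"
  shows "((\<lambda>t. integral\<^sup>L vol (F t)) has_real_derivative integral\<^sup>L vol (F' t)) (at t)"
proof -
  interpret finite_measure vol by (rule finite_measure_vol)
  have slice: "continuous_on M (H s)" if "continuous_on ({0<..} \<times> M) (\<lambda>z. H (fst z) (snd z))" "s > 0"
    for H :: "real \<Rightarrow> 'a \<Rightarrow> real" and s
  proof -
    have "continuous_on M (\<lambda>p. (s, p))" by (intro continuous_intros)
    then have "continuous_on M (\<lambda>p. H (fst (s, p)) (snd (s, p)))"
      by (rule continuous_on_compose2[OF that(1)]) (use that(2) in auto)
    then show ?thesis by simp
  qed
  \<comment> \<open>A compact window around \<open>t\<close> that stays away from time 0, so that
    \<open>F'\<close> is bounded on its product with \<open>M\<close>. The bound is the dominating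
    function.\<close>
  let ?T = "{t / 2..2 * t}"
  have "compact (?T \<times> M)" by (intro compact_Times compact_Icc compact_M)
  moreover have "?T \<times> M \<subseteq> {0<..} \<times> M" using t by auto
  ultimately have "bounded ((\<lambda>z. F' (fst z) (snd z)) ` (?T \<times> M))"
    by (intro compact_imp_bounded compact_continuous_image continuous_on_subset[OF cF'])
  then obtain B where "\<forall>z\<in>?T \<times> M. norm (F' (fst z) (snd z)) \<le> B" by (auto simp: bounded_iff)
  then have B: "norm (F' s p) \<le> B" if "s \<in> ?T" "p \<in> M" for s p using that by force
  have "(\<lambda>n. (integral\<^sup>L vol (F (t + X n)) - integral\<^sup>L vol (F t)) / X n) \<longlonglongrightarrow> integral\<^sup>L vol (F' t)"
    if X0: "\<forall>n. X n \<noteq> 0" and X: "X \<longlonglongrightarrow> 0" for X :: "nat \<Rightarrow> real"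
  proof -
    from X t have "\<forall>\<^sub>F n in sequentially. norm (X n) < t / 2"
      by (intro order_tendstoD(2)[OF tendsto_norm_zero]) auto
    then obtain N where N: "\<And>n. n \<ge> N \<Longrightarrow> \<bar>X n\<bar> < t / 2"
      by (auto simp: eventually_sequentially)
    \<comment> \<open>Dropping the first \<open>N\<close> terms keeps every \<open>t + Y n\<close>
      inside the window, so the mean value bound holds for all indices.\<close>
    define Y where "Y n = X (n + N)" for n
    have Y: "\<bar>Y n\<bar> < t / 2" "Y n \<noteq> 0" for n unfolding Y_def using N X0 by auto
    then have tY: "t + Y n > 0" "t + Y n \<in> ?T" for n using t abs_less_iff[of "Y n" "t / 2"] by (force, force)
    have YL: "Y \<longlonglongrightarrow> 0" unfolding Y_def using X by (rule LIMSEQ_ignore_initial_segment)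
    have "(\<lambda>n. integral\<^sup>L vol (\<lambda>p. (F (t + Y n) p - F t p) / Y n)) \<longlonglongrightarrow> integral\<^sup>L vol (F' t)"
    proof (rule integral_dominated_convergence[where w="\<lambda>_. B"])
      show "F' t \<in> borel_measurable vol" by (intro measurable_vol_continuous slice[OF cF'] t)
      show "(\<lambda>p. (F (t + Y n) p - F t p) / Y n) \<in> borel_measurable vol" for n
        using Y(2)[of n] by (intro measurable_vol_continuous continuous_intros slice[OF cF] t tY) auto
      show "integrable vol (\<lambda>_. B)" by simp
      show "AE p in vol. (\<lambda>n. (F (t + Y n) p - F t p) / Y n) \<longlonglongrightarrow> F' t p"
      proof (rule AE_I2)
        fix p assume "p \<in> space vol"
        then have "((\<lambda>h. (F (t + h) p - F t p) / h) \<longlongrightarrow> F' t p) (at 0)"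
          using D[OF t] by (simp add: space_vol DERIV_def)
        moreover have "filterlim Y (at 0) sequentially"
          unfolding filterlim_at using YL Y(2) by auto
        ultimately show "(\<lambda>n. (F (t + Y n) p - F t p) / Y n) \<longlonglongrightarrow> F' t p"
          by (rule filterlim_compose)
      qed
      show "AE p in vol. norm ((F (t + Y n) p - F t p) / Y n) \<le> B" for n
      proof (rule AE_I2)
        fix p assume p: "p \<in> space vol"
        have "norm (F (t + Y n) p - F t p) \<le> B * norm (t + Y n - t)"
        proof (rule field_differentiable_bound[where S="?T" and f'="\<lambda>s. F' s p"])
          show "((\<lambda>s. F s p) has_real_derivative F' z p) (at z within ?T)" if "z \<in> ?T" for z
            by (rule has_field_derivative_at_within[OF D]) (use that t p in \<open>auto simp: space_vol\<close>)
        qed (use t p tY B in \<open>auto simp: space_vol\<close>)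
        then show "norm ((F (t + Y n) p - F t p) / Y n) \<le> B"
          using Y(2)[of n] by (simp add: divide_simps)
      qed
    qed
    moreover define I where "I s = integral\<^sup>L vol (F s)" for s
    have "integral\<^sup>L vol (\<lambda>p. (F (t + Y n) p - F t p) / Y n) = (I (t + Y n) - I t) / Y n" for n
      using integrable_continuous[OF slice[OF cF tY(1)]] integrable_continuous[OF slice[OF cF t]]
      by (simp add: I_def)
    ultimately have "(\<lambda>n. (I (t + Y n) - I t) / Y n) \<longlonglongrightarrow> integral\<^sup>L vol (F' t)" by (simp only:)
    then show ?thesis
      unfolding Y_def I_def[symmetric] by (rule LIMSEQ_offset[of "\<lambda>n. (I (t + X n) - I t) / X n" N])
  qed
  then show ?thesis
    unfolding DERIV_def tendsto_at_iff_sequentially by (simp add: o_def)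
qed

lemma ip_has_derivative:
  assumes U: "spacetime_smooth U" and V: "spacetime_smooth V" and t: "t > 0"
  shows "((\<lambda>t. ip (U t) (V t)) has_real_derivative ip (U t) (dt V t) + ip (dt U t) (V t)) (at t)"
proof -
  note c = continuous_spacetime[OF U] continuous_spacetime[OF V]
    continuous_spacetime[OF spacetime_smooth_dt[OF U]] continuous_spacetime[OF spacetime_smooth_dt[OF V]]
  have "((\<lambda>t. integral\<^sup>L vol (\<lambda>p. U t p * V t p)) has_real_derivative
      integral\<^sup>L vol (\<lambda>p. U t p * dt V t p + dt U t p * V t p)) (at t)"
    by (rule integral_has_derivative[where F="\<lambda>t p. U t p * V t p" and F'="\<lambda>t p. U t p * dt V t p + dt U t p * V t p"])
      (intro continuous_intros c t | rule DERIV_mult'[OF has_time_derivative[OF U] has_time_derivative[OF V]], assumption+)+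
  also have "integral\<^sup>L vol (\<lambda>p. U t p * dt V t p + dt U t p * V t p) = ip (U t) (dt V t) + ip (dt U t) (V t)"
    unfolding ip_def
    by (intro Bochner_Integration.integral_add ip_integrable smooth_continuous smooth_slice spacetime_smooth_dt U V t)
  finally show ?thesis by (simp add: ip_def)
qed

lemma ip_has_derivative_fixed:
  assumes f: "smooth f" and V: "spacetime_smooth V" and t: "t > 0"
  shows "((\<lambda>t. ip f (V t)) has_real_derivative ip f (dt V t)) (at t)"
  unfolding ip_def
proof (rule integral_has_derivative[where F="\<lambda>t p. f p * V t p" and F'="\<lambda>t p. f p * dt V t p"])
  have cf: "continuous_on ({0<..} \<times> M) (\<lambda>z::real \<times> 'a. f (snd z))"
    by (rule continuous_on_compose2[OF smooth_continuous[OF f]]) (auto intro: continuous_intros)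
  show "continuous_on ({0<..} \<times> M) (\<lambda>z. f (snd z) * V (fst z) (snd z))"
    by (intro continuous_intros cf continuous_spacetime V)
  show "continuous_on ({0<..} \<times> M) (\<lambda>z. f (snd z) * dt V (fst z) (snd z))"
    by (intro continuous_intros cf continuous_spacetime spacetime_smooth_dt V)
  show "((\<lambda>s. f p * V s p) has_real_derivative f p * dt V s p) (at s)" if "s > 0" "p \<in> M" for s p
    by (rule DERIV_cmult[OF has_time_derivative[OF V that]])
qed (rule t)

text \<open>Both sides have the same inner product with every smooth function.\<close>

lemma dt_laplacian:
  assumes U: "spacetime_smooth U" and t: "t > 0" and p: "p \<in> M"
  shows "dt (\<lambda>t. L (U t)) t p = L (dt U t) p"
proof -
  let ?D = "\<lambda>p. 1 * dt (\<lambda>t. L (U t)) t p + (-1) * L (dt U t) p"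
  have LU: "spacetime_smooth (\<lambda>t. L (U t))" by (rule spacetime_smooth_laplacian[OF U])
  have s: "smooth (dt (\<lambda>t. L (U t)) t)" "smooth (L (dt U t))" "smooth (dt U t)"
    by (intro smooth_laplacian smooth_slice spacetime_smooth_dt LU U t)+
  have D: "smooth ?D" by (intro smooth_add smooth_scale s)
  have "((\<lambda>t. ip ?D (L (U t))) has_real_derivative ip ?D (dt (\<lambda>t. L (U t)) t)) (at t)"
    by (rule ip_has_derivative_fixed[OF D LU t])
  moreover have "((\<lambda>t. ip ?D (L (U t))) has_real_derivative ip (L ?D) (dt U t)) (at t)"
  proof (rule has_field_derivative_transform_within_open[where S="{0<..}"])
    show "((\<lambda>t. ip (L ?D) (U t)) has_real_derivative ip (L ?D) (dt U t)) (at t)"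
      by (rule ip_has_derivative_fixed[OF smooth_laplacian[OF D] U t])
    show "ip (L ?D) (U s) = ip ?D (L (U s))" if "s \<in> {0<..}" for s
      by (rule ip_laplacian_sym[symmetric]) (use D smooth_slice[OF U] that in auto)
  qed (use t in auto)
  ultimately have "ip ?D (dt (\<lambda>t. L (U t)) t) = ip (L ?D) (dt U t)" by (rule DERIV_unique)
  also have "\<dots> = ip ?D (L (dt U t))" by (rule ip_laplacian_sym[OF D s(3), symmetric])
  finally have "ip ?D ?D = 0"
    using ip_linear[OF smooth_continuous[OF D] smooth_continuous[OF s(1)] smooth_continuous[OF s(2)], of 1 "-1"]
    by simp
  from ip_definite[OF smooth_continuous[OF D] this p] show ?thesis by simp
qed

end


section \<open>Energy estimates for waves\<close>

lemma DERIV_nonneg_mono: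
  fixes f f' :: "real \<Rightarrow> real"
  assumes "s \<le> t" "\<And>x. s \<le> x \<Longrightarrow> x \<le> t \<Longrightarrow> (f has_real_derivative f' x) (at x)"
    "\<And>x. s \<le> x \<Longrightarrow> x \<le> t \<Longrightarrow> f' x \<ge> 0"
  shows "f s \<le> f t"
  by (rule DERIV_nonneg_imp_nondecreasing[OF assms(1)]) (use assms(2,3) in blast)

text \<open>A function of time alone solves the wave equation when \<open>a^3\<close> times its
  derivative is constant; \<open>X\<close> is such a solution, with constant \<open>- k\<close>.
  Leaving \<open>k\<close> open covers both normalisations of \<open>\<chi>\<close>.\<close>

locale wave = closed_riemannian M \<A> g vol
  for M :: "'a::t2_space set" and \<A> g vol +
  fixes a a' X :: "real \<Rightarrow> real" and k :: real and \<psi> :: "real \<Rightarrow> 'a \<Rightarrow> real" and A :: "'a \<Rightarrow> real"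
  assumes psi: "spacetime_smooth \<psi>"
    and eq: "t > 0 \<Longrightarrow> p \<in> M \<Longrightarrow>
      dt (dt \<psi>) t p = L (\<psi> t) p / (a t)\<^sup>2 - 3 * (a' t / a t) * dt \<psi> t p"
    and a_pos: "t > 0 \<Longrightarrow> a t > 0"
    and a_deriv: "t > 0 \<Longrightarrow> (a has_real_derivative a' t) (at t)"
    and a'_nonneg: "t > 0 \<Longrightarrow> a' t \<ge> 0"
    and k_pos: "k > 0"
    and X_deriv: "t > 0 \<Longrightarrow> (X has_real_derivative - k / (a t) ^ 3) (at t)"
    and X_pos: "t > 0 \<Longrightarrow> X t > 0"
    and A_smooth: "smooth A"
begin

definition U :: "nat \<Rightarrow> real \<Rightarrow> 'a \<Rightarrow> real" where
  "U n t = (L ^^ n) (\<psi> t)"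

lemma U_Suc: "U (Suc n) = (\<lambda>t. L (U n t))"
  by (simp add: U_def fun_eq_iff)

lemma st_U: "spacetime_smooth (U n)"
proof (induction n)
  case 0
  have "U 0 = \<psi>" by (simp add: U_def fun_eq_iff)
  then show ?case using psi by simp
qed (simp add: U_Suc spacetime_smooth_laplacian)

lemmas st_dU = spacetime_smooth_dt[OF st_U]
lemmas sU = smooth_slice[OF st_U]
lemmas sdU = smooth_slice[OF st_dU]
lemmas cU = smooth_continuous[OF sU]
lemmas cdU = smooth_continuous[OF sdU]

lemma dt_U_Suc: "t > 0 \<Longrightarrow> p \<in> M \<Longrightarrow> dt (U (Suc n)) t p = L (dt (U n) t) p"
  unfolding U_Suc by (rule dt_laplacian[OF st_U])

text \<open>The Laplacian commutes with time derivatives and the coefficients depend on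
  \<open>t\<close> alone, so every \<open>U n\<close> is again a wave.\<close>

lemma dt_dt_U:
  assumes "t > 0" "p \<in> M"
  shows "dt (dt (U n)) t p = 1 / (a t)\<^sup>2 * U (Suc n) t p + (- 3 * (a' t / a t)) * dt (U n) t p"
  using assms(2)
proof (induction n arbitrary: p)
  case 0
  have "U 0 = \<psi>" by (simp add: U_def fun_eq_iff)
  then show ?case using eq[OF assms(1) 0] by (simp add: U_Suc)
next
  case (Suc n)
  have "dt (dt (U (Suc n))) t p = dt (\<lambda>t. L (dt (U n) t)) t p"
  proof -
    have "((\<lambda>s. dt (U (Suc n)) s p) has_real_derivative dt (dt (U (Suc n))) t p) (at t)"
      by (rule has_time_derivative[OF st_dU assms(1) Suc.prems])
    then have "((\<lambda>s. L (dt (U n) s) p) has_real_derivative dt (dt (U (Suc n))) t p) (at t)"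
      by (rule has_field_derivative_transform_within_open[of _ _ _ "{0<..}"])
        (use assms(1) Suc.prems dt_U_Suc in auto)
    then show ?thesis unfolding dt_def[of "\<lambda>t. L (dt (U n) t)"] by (rule DERIV_imp_deriv[symmetric])
  qed
  also have "\<dots> = L (dt (dt (U n)) t) p" by (rule dt_laplacian[OF st_dU assms(1) Suc.prems])
  also have "\<dots> = L (\<lambda>q. 1 / (a t)\<^sup>2 * U (Suc n) t q + (- 3 * (a' t / a t)) * dt (U n) t q) p"
    by (rule laplacian_cong[OF Suc.prems Suc.IH])
  also have "\<dots> = 1 / (a t)\<^sup>2 * L (U (Suc n) t) p + (- 3 * (a' t / a t)) * L (dt (U n) t) p"
    by (rule laplacian_linear[OF sU[OF assms(1)] sdU[OF assms(1)] Suc.prems])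
  finally show ?case
    using dt_U_Suc[OF assms(1) Suc.prems, of n] by (simp add: U_Suc)
qed

lemma ip_dt_dt_U:
  assumes t: "t > 0" and f: "continuous_on M f"
  shows "ip f (dt (dt (U n)) t) =
    1 / (a t)\<^sup>2 * ip f (U (Suc n) t) + (- 3 * (a' t / a t)) * ip f (dt (U n) t)"
proof -
  have "ip f (dt (dt (U n)) t) = ip f (\<lambda>p. 1 / (a t)\<^sup>2 * U (Suc n) t p + (- 3 * (a' t / a t)) * dt (U n) t p)"
    by (rule ip_cong[OF refl dt_dt_U[OF t]])
  also have "\<dots> = 1 / (a t)\<^sup>2 * ip f (U (Suc n) t) + (- 3 * (a' t / a t)) * ip f (dt (U n) t)"
    by (rule ip_linear[OF f cU[OF t] cdU[OF t]])
  finally show ?thesis .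
qed

definition nrm :: "('a \<Rightarrow> real) \<Rightarrow> real" where
  "nrm u = sqrt (ip u u)"

lemma nrm_nonneg: "nrm u \<ge> 0"
  by (simp add: nrm_def ip_nonneg)

lemma nrm_square: "(nrm u)\<^sup>2 = ip u u"
  by (simp add: nrm_def ip_nonneg)

lemma momentum_derivative:
  assumes t: "t > 0" and f: "smooth f"
  shows "((\<lambda>t. (a t) ^ 3 * ip f (dt (U n) t)) has_real_derivative a t * ip f (U (Suc n) t)) (at t)"
proof -
  have "a t \<noteq> 0" using a_pos[OF t] by simp
  then show ?thesis
    by (auto intro!: derivative_eq_intros a_deriv[OF t] ip_has_derivative_fixed[OF f st_dU t]
        simp: ip_dt_dt_U[OF t smooth_continuous[OF f]] field_simps power2_eq_square power3_eq_cube)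
qed

text \<open>
  With the weight \<open>a\<^sup>6\<close> the energy is nondecreasing in time, hence bounded towards the singularity.
\<close>

definition E :: "nat \<Rightarrow> real \<Rightarrow> real" where
  "E n t = (a t) ^ 6 * ip (dt (U n) t) (dt (U n) t) - (a t) ^ 4 * ip (U n t) (U (Suc n) t)"

text \<open>The weight \<open>a^6\<close> is chosen so that its derivative cancels the damping term
  of the wave equation. The mixed terms \<open>R\<close> cancel by symmetry of the Laplacian. What
  survives is the derivative of \<open>a^4\<close> times a pairing that is nonpositive, so the sign
  is right for an expanding scale factor.\<close>

lemma E_derivative:
  assumes t: "t > 0"
  shows "(E n has_real_derivative - 4 * (a t) ^ 3 * a' t * ip (U n t) (U (Suc n) t)) (at t)"
proof -
  have nz: "a t \<noteq> 0" using a_pos[OF t] by simp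
  define P where "P = ip (dt (U n) t) (dt (U n) t)"
  define R where "R = ip (dt (U n) t) (U (Suc n) t)"
  define Q where "Q = ip (U n t) (U (Suc n) t)"
  have 1: "((\<lambda>t. ip (dt (U n) t) (dt (U n) t)) has_real_derivative
      2 * (1 / (a t)\<^sup>2 * R + (- 3 * (a' t / a t)) * P)) (at t)"
    using ip_has_derivative[OF st_dU st_dU t, of n n] ip_commute[of "dt (dt (U n)) t"]
    by (simp add: ip_dt_dt_U[OF t cdU[OF t]] P_def R_def)
  have "ip (U n t) (dt (U (Suc n)) t) = ip (U n t) (L (dt (U n) t))"
    by (rule ip_cong[OF refl dt_U_Suc[OF t]])
  also have "\<dots> = R"
    by (simp add: ip_laplacian_sym[OF sU[OF t] sdU[OF t]] R_def U_Suc ip_commute)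
  finally have 2: "((\<lambda>t. ip (U n t) (U (Suc n) t)) has_real_derivative R + R) (at t)"
    using ip_has_derivative[OF st_U st_U t, of n "Suc n"] by (simp add: R_def)
  have "(E n has_real_derivative
     (a t) ^ 6 * (2 * (1 / (a t)\<^sup>2 * R + (- 3 * (a' t / a t)) * P)) + (6 * (a t) ^ 5 * a' t) * P
     - ((a t) ^ 4 * (R + R) + (4 * (a t) ^ 3 * a' t) * Q)) (at t)"
    unfolding E_def[abs_def] P_def Q_def
    by (rule derivative_eq_intros 1[unfolded P_def] 2 a_deriv[OF t] refl)+ (simp add: algebra_simps)
  also have "(a t) ^ 6 * (2 * (1 / (a t)\<^sup>2 * R + (- 3 * (a' t / a t)) * P)) + (6 * (a t) ^ 5 * a' t) * P
     - ((a t) ^ 4 * (R + R) + (4 * (a t) ^ 3 * a' t) * Q) = - 4 * (a t) ^ 3 * a' t * Q"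
    using nz by (simp add: field_simps eval_nat_numeral)
  finally show ?thesis unfolding Q_def .
qed

lemma ip_U_nonpos: "t > 0 \<Longrightarrow> ip (U n t) (U (Suc n) t) \<le> 0"
  unfolding U_Suc by (rule ip_laplacian_nonpos[OF sU])

lemma momentum_bound:
  assumes "0 < t" "t \<le> 1" shows "(a t) ^ 3 * nrm (dt (U n) t) \<le> sqrt (E n 1)"
proof -
  have "E n t \<le> E n 1"
  proof (rule DERIV_nonneg_mono[OF assms(2) E_derivative])
    show "0 \<le> - 4 * a x ^ 3 * a' x * ip (U n x) (U (Suc n) x)" if "t \<le> x" for x
    proof -
      have "x > 0" using that assms by simp
      then show ?thesis using a_pos[of x] a'_nonneg[of x] ip_U_nonpos[of x n]
        by (simp add: mult_nonneg_nonpos)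
    qed
  qed (use assms in auto)
  moreover have "(a t) ^ 4 * ip (U n t) (U (Suc n) t) \<le> 0"
    using ip_U_nonpos[OF assms(1), of n] by (simp add: mult_nonneg_nonpos)
  ultimately have "((a t) ^ 3 * nrm (dt (U n) t))\<^sup>2 \<le> E n 1"
    by (simp add: E_def power_mult_distrib nrm_square power_mult[symmetric])
  then show ?thesis by (rule real_le_rsqrt)
qed

text \<open>The size of \<open>U n\<close> at time 1 plus the integrated momentum bound. The
  division by \<open>k\<close> arises because \<open>1 / a^3\<close> is the derivative of
  \<open>- X / k\<close>.\<close>

definition K :: "nat \<Rightarrow> real" where
  "K n = sqrt (1 + ip (U n 1) (U n 1)) + sqrt (E n 1) / k"

lemma sqrt_E_nonneg: "sqrt (E n 1) \<ge> 0"
  using momentum_bound[of 1 n] a_pos[of 1] nrm_nonneg[of "dt (U n) 1"]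
  by (meson less_eq_real_def mult_nonneg_nonneg order_trans zero_less_one zero_less_power)

lemma K_nonneg: "K n \<ge> 0"
  using sqrt_E_nonneg k_pos ip_nonneg[of "U n 1"] by (simp add: K_def)

text \<open>The summand \<open>1\<close> keeps the square root differentiable.\<close>

lemma nrm_U_bound:
  assumes "0 < t" "t \<le> 1" shows "nrm (U n t) \<le> K n * (1 + X t)"
proof -
  define y where "y t = sqrt (1 + ip (U n t) (U n t))" for t
  define C where "C = sqrt (E n 1)"
  have pos: "1 + ip (U n s) (U n s) > 0" for s using ip_nonneg[of "U n s"] by simp
  have ny: "nrm (U n s) \<le> y s" for s unfolding nrm_def y_def by simp
  have y0: "y s > 0" for s unfolding y_def using pos by simp
  have dy: "(y has_real_derivative ip (U n s) (dt (U n) s) / y s) (at s)" if "s > 0" for s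
    unfolding y_def[abs_def]
    using ip_has_derivative[OF st_U st_U that, of n n] pos[of s] ip_commute[of "dt (U n) s" "U n s"]
    by (auto intro!: derivative_eq_intros simp: field_simps)
  \<comment> \<open>By Cauchy-Schwarz and \<open>momentum_bound\<close> the slope of
    \<open>y\<close> is at least \<open>- C / a^3\<close>, which is the slope of
    \<open>C / k * X\<close>. So this difference is nondecreasing.\<close>
  have "y t - C / k * X t \<le> y 1 - C / k * X 1"
  proof (rule DERIV_nonneg_mono[OF assms(2), where f'="\<lambda>s. ip (U n s) (dt (U n) s) / y s + C / (a s) ^ 3"])
    fix s assume "t \<le> s" "s \<le> 1"
    then have s: "0 < s" "s \<le> 1" using assms by auto
    show "((\<lambda>s. y s - C / k * X s) has_real_derivative ip (U n s) (dt (U n) s) / y s + C / (a s) ^ 3) (at s)"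
      using k_pos by (auto intro!: derivative_eq_intros dy X_deriv s)
    have "\<bar>ip (U n s) (dt (U n) s)\<bar> \<le> nrm (U n s) * nrm (dt (U n) s)"
      unfolding nrm_def by (rule ip_Cauchy_Schwarz[OF cU[OF s(1)] cdU[OF s(1)]])
    also have "\<dots> \<le> y s * nrm (dt (U n) s)" by (intro mult_right_mono ny nrm_nonneg)
    also have "\<dots> \<le> y s * (C / (a s) ^ 3)"
    proof (rule mult_left_mono)
      show "nrm (dt (U n) s) \<le> C / (a s) ^ 3"
        using momentum_bound[OF s, of n] a_pos[OF s(1)] by (simp add: C_def field_simps)
    qed (use y0[of s] in simp)
    finally have "- (C / (a s) ^ 3) \<le> ip (U n s) (dt (U n) s) / y s"
      using y0[of s] by (simp add: field_simps)
    then show "0 \<le> ip (U n s) (dt (U n) s) / y s + C / (a s) ^ 3" by simp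
  qed
  then have "nrm (U n t) \<le> y 1 + C / k * X t"
    using ny[of t] X_pos[of 1] sqrt_E_nonneg[of n] k_pos
    by (smt (verit) C_def divide_nonneg_pos mult_nonneg_nonneg)
  also have "\<dots> \<le> (y 1 + C / k) * (1 + X t)"
  proof -
    have "0 \<le> y 1 * X t" "0 \<le> C / k"
      using y0[of 1] X_pos[OF assms(1)] sqrt_E_nonneg[of n] k_pos by (simp_all add: C_def)
    then show ?thesis by (simp only: distrib_left distrib_right mult_1_right)
  qed
  finally show ?thesis by (simp add: K_def y_def C_def)
qed

end


text \<open>\<open>H\<close> encodes the integrability of \<open>a (1 + X)\<close> near time 0
  without an integral: it vanishes at 0, and its derivative dominates that function.\<close>

locale singular_wave = wave +
  fixes H H' :: "real \<Rightarrow> real"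
  assumes X_at_top: "filterlim X at_top (at_right 0)"
    and a_lim: "(a \<longlongrightarrow> 0) (at_right 0)"
    and a2X_lim: "((\<lambda>t. (a t)\<^sup>2 * X t) \<longlongrightarrow> 0) (at_right 0)"
    and H_deriv: "t > 0 \<Longrightarrow> (H has_real_derivative H' t) (at t)"
    and H_ge: "t > 0 \<Longrightarrow> H' t \<ge> a t * (1 + X t)"
    and H_nonneg: "t > 0 \<Longrightarrow> H t \<ge> 0"
    and H_lim: "(H \<longlongrightarrow> 0) (at_right 0)"
    and A_lim: "uniform_limit M (\<lambda>t p. \<psi> t p / X t) A (at_right 0)"
begin

lemma eventually_at_right_0: "c > 0 \<Longrightarrow> (\<And>t::real. 0 < t \<Longrightarrow> t \<le> c \<Longrightarrow> P t) \<Longrightarrow> eventually P (at_right 0)"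
  unfolding eventually_at_right_field by (intro exI[of _ c]) auto

lemma pairing_limit:
  assumes f: "smooth f"
  shows "((\<lambda>t. ip f (\<psi> t) / X t) \<longlongrightarrow> ip f A) (at_right 0)"
proof (rule tendstoI)
  fix e :: real assume e: "e > 0"
  define B where "B = integral\<^sup>L vol (\<lambda>p. \<bar>f p\<bar>)"
  have B0: "B \<ge> 0" unfolding B_def by simp
  define d where "d = e / (B + 1)"
  have d: "d > 0" unfolding d_def using e B0 by simp
  have cf: "continuous_on M f" using f by (rule smooth_continuous)
  have "\<forall>\<^sub>F t in at_right 0. \<forall>p\<in>M. dist (\<psi> t p / X t) (A p) < d"
    using A_lim d by (simp add: uniform_limit_iff)
  moreover have "\<forall>\<^sub>F t::real in at_right 0. t > 0" by (rule eventually_at_right_less)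
  ultimately show "\<forall>\<^sub>F t in at_right 0. dist (ip f (\<psi> t) / X t) (ip f A) < e"
  proof eventually_elim
    case (elim t)
    have cp: "continuous_on M (\<psi> t)" by (rule smooth_continuous[OF smooth_slice[OF psi elim(2)]])
    have cA: "continuous_on M A" by (rule smooth_continuous[OF A_smooth])
    let ?w = "\<lambda>p. (1 / X t) * \<psi> t p + (-1) * A p"
    have cw: "continuous_on M ?w" by (intro continuous_intros cp cA)
    have "ip f (\<psi> t) / X t - ip f A = ip f ?w"
      using ip_linear[OF cf cp cA, of "1 / X t" "-1"] by simp
    moreover have "\<bar>ip f ?w\<bar> \<le> integral\<^sup>L vol (\<lambda>p. \<bar>f p * ?w p\<bar>)"
      unfolding ip_def by (rule integral_abs_bound)
    moreover have "\<dots> \<le> integral\<^sup>L vol (\<lambda>p. \<bar>f p\<bar> * d)"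
    proof (rule integral_mono)
      show "integrable vol (\<lambda>p. \<bar>f p * ?w p\<bar>)"
        by (intro integrable_continuous continuous_intros cf cp cA)
      show "integrable vol (\<lambda>p. \<bar>f p\<bar> * d)"
        by (intro integrable_continuous continuous_intros cf)
      show "\<bar>f p * ?w p\<bar> \<le> \<bar>f p\<bar> * d" if "p \<in> space vol" for p
      proof -
        have "\<bar>?w p\<bar> \<le> d" using elim(1) that by (force simp: space_vol dist_real_def)
        then show ?thesis unfolding abs_mult by (rule mult_left_mono) simp
      qed
    qed
    moreover have "integral\<^sup>L vol (\<lambda>p. \<bar>f p\<bar> * d) = B * d" unfolding B_def by simp
    moreover have "B * d < e" unfolding d_def using B0 e by (simp add: field_simps)
    ultimately show ?case unfolding dist_real_def by linarith
  qed
qed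

definition AN :: "nat \<Rightarrow> 'a \<Rightarrow> real" where
  "AN n = (L ^^ n) A"

lemma AN_smooth: "smooth (AN n)"
  unfolding AN_def by (rule smooth_laplacian_power[OF A_smooth])

lemma pairing_limit_U:
  assumes f: "smooth f"
  shows "((\<lambda>t. ip f (U n t) / X t) \<longlongrightarrow> ip f (AN n)) (at_right 0)"
proof -
  have "((\<lambda>t. ip ((L ^^ n) f) (\<psi> t) / X t) \<longlongrightarrow> ip f (AN n)) (at_right 0)"
    using pairing_limit[OF smooth_laplacian_power[OF f]]
    by (simp add: AN_def ip_laplacian_power_sym[OF f A_smooth])
  then show ?thesis
  proof (rule Lim_transform_eventually)
    show "\<forall>\<^sub>F t in at_right 0. ip ((L ^^ n) f) (\<psi> t) / X t = ip f (U n t) / X t"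
      by (rule eventually_at_right_0[of 1])
        (simp_all add: U_def ip_laplacian_power_sym[OF f smooth_slice[OF psi]])
  qed
qed

text \<open>The rescaled momentum of \<open>\<Delta>\<^sup>n (\<psi> - A X)\<close>.\<close>

definition V :: "nat \<Rightarrow> real \<Rightarrow> 'a \<Rightarrow> real" where
  "V n t p = (a t) ^ 3 * dt (U n) t p + k * AN n p"

lemma V_smooth: "t > 0 \<Longrightarrow> smooth (V n t)"
  unfolding V_def[abs_def] by (intro smooth_add smooth_scale sdU AN_smooth)

lemma ip_V:
  assumes "smooth f" "t > 0"
  shows "ip f (V n t) = (a t) ^ 3 * ip f (dt (U n) t) + k * ip f (AN n)"
  unfolding V_def[abs_def]
  by (rule ip_linear) (intro smooth_continuous assms sdU AN_smooth)+

text \<open>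
  Pair \<open>\<Delta>\<^sup>n (\<psi> - A X)\<close> with the fixed function \<open>f = V n t\<close>. If the norm of \<open>V n t\<close> exceeded
  \<open>K (n + 1) H(t)\<close>, the momentum would not have moved away from \<open>f\<close> on \<open>(0, t]\<close>, so the pairing
  would grow like a multiple of \<open>X\<close>, which contradicts the choice of \<open>A\<close>.
\<close>

lemma nrm_V_bound:
  assumes t: "0 < t" "t \<le> 1" shows "nrm (V n t) \<le> K (Suc n) * H t"
proof -
  define f where "f = V n t"
  define \<kappa> where "\<kappa> = ip f f - nrm f * K (Suc n) * H t"
  have f: "smooth f" unfolding f_def by (rule V_smooth[OF t(1)])
  have cf: "continuous_on M f" by (rule smooth_continuous[OF f])
  \<comment> \<open>At the end time \<open>t\<close> the pairing equals \<open>ip f f\<close>.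
    Between \<open>s\<close> and \<open>t\<close> the momentum paired with \<open>f\<close> changes
    at rate \<open>a * ip f (U (Suc n))\<close>, so by at most
    \<open>nrm f * K (Suc n) * (H t - H s)\<close>.\<close>
  have V_lower: "\<kappa> \<le> ip f (V n s)" if s: "0 < s" "s \<le> t" for s
  proof -
    have "(\<lambda>s. nrm f * K (Suc n) * H s - (a s) ^ 3 * ip f (dt (U n) s)) s
      \<le> (\<lambda>s. nrm f * K (Suc n) * H s - (a s) ^ 3 * ip f (dt (U n) s)) t"
    proof (rule DERIV_nonneg_mono[OF s(2), where
        f'="\<lambda>s. nrm f * K (Suc n) * H' s - a s * ip f (U (Suc n) s)"])
      fix r assume "s \<le> r" "r \<le> t"
      then have r: "0 < r" "r \<le> 1" using s t by auto
      show "((\<lambda>s. nrm f * K (Suc n) * H s - (a s) ^ 3 * ip f (dt (U n) s)) has_real_derivative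
         nrm f * K (Suc n) * H' r - a r * ip f (U (Suc n) r)) (at r)"
        by (intro DERIV_diff DERIV_cmult H_deriv momentum_derivative f r)
      have "ip f (U (Suc n) r) \<le> nrm f * nrm (U (Suc n) r)"
        using ip_Cauchy_Schwarz[OF cf cU[OF r(1)], of "Suc n"] unfolding nrm_def by simp
      also have "\<dots> \<le> nrm f * (K (Suc n) * (1 + X r))"
        by (intro mult_left_mono nrm_U_bound r nrm_nonneg)
      finally have "a r * ip f (U (Suc n) r) \<le> a r * (nrm f * (K (Suc n) * (1 + X r)))"
        using a_pos[OF r(1)] by (intro mult_left_mono) auto
      also have "\<dots> = nrm f * K (Suc n) * (a r * (1 + X r))" by (simp add: mult_ac)
      also have "\<dots> \<le> nrm f * K (Suc n) * H' r"
        by (intro mult_left_mono H_ge r mult_nonneg_nonneg nrm_nonneg K_nonneg)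
      finally show "0 \<le> nrm f * K (Suc n) * H' r - a r * ip f (U (Suc n) r)" by simp
    qed
    then have "ip f f - nrm f * K (Suc n) * H t + nrm f * K (Suc n) * H s \<le> ip f (V n s)"
      using ip_V[OF f t(1), of n] ip_V[OF f s(1), of n] by (simp add: f_def[symmetric])
    moreover have "0 \<le> nrm f * K (Suc n) * H s"
      by (intro mult_nonneg_nonneg nrm_nonneg K_nonneg H_nonneg s)
    ultimately show ?thesis by (simp add: \<kappa>_def)
  qed
  \<comment> \<open>The pairing of \<open>f\<close> with \<open>\<Delta>^n (\<psi> - A X)\<close>,
    corrected by a multiple of \<open>X\<close> so that its derivative is
    \<open>(ip f (V n s) - \<kappa>) / a^3\<close>, which is nonnegative by
    \<open>V_lower\<close>.\<close>
  define p where "p s = ip f (U n s) - ip f (AN n) * X s + \<kappa> / k * X s" for s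
  have p_mono: "p s \<le> p t" if s: "0 < s" "s \<le> t" for s
  proof (rule DERIV_nonneg_mono[OF s(2), where
      f'="\<lambda>s. ip f (dt (U n) s) - ip f (AN n) * (- k / (a s) ^ 3) + \<kappa> / k * (- k / (a s) ^ 3)"])
    fix r assume "s \<le> r" "r \<le> t"
    then have r: "0 < r" "r \<le> t" using s by auto
    show "(p has_real_derivative ip f (dt (U n) r) - ip f (AN n) * (- k / (a r) ^ 3) + \<kappa> / k * (- k / (a r) ^ 3)) (at r)"
      unfolding p_def[abs_def]
      by (intro DERIV_add DERIV_diff DERIV_cmult ip_has_derivative_fixed f st_U X_deriv r)
    have "ip f (dt (U n) r) - ip f (AN n) * (- k / (a r) ^ 3) + \<kappa> / k * (- k / (a r) ^ 3)
      = (ip f (V n r) - \<kappa>) / (a r) ^ 3"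
      using a_pos[OF r(1)] k_pos by (simp add: ip_V[OF f r(1)] field_simps)
    then show "0 \<le> ip f (dt (U n) r) - ip f (AN n) * (- k / (a r) ^ 3) + \<kappa> / k * (- k / (a r) ^ 3)"
      using V_lower[OF r] a_pos[OF r(1)] by simp
  qed
  \<comment> \<open>Divide \<open>p s \<le> p t\<close> by \<open>X s\<close> and let
    \<open>s\<close> tend to 0: the left side tends to \<open>\<kappa> / k\<close> by the choice of
    \<open>A\<close>, the right side to 0 because \<open>X\<close> blows up.\<close>
  have "\<kappa> / k \<le> 0"
  proof (rule tendsto_le)
    have "((\<lambda>s. ip f (U n s) / X s - ip f (AN n) + \<kappa> / k) \<longlongrightarrow> ip f (AN n) - ip f (AN n) + \<kappa> / k) (at_right 0)"
      by (intro tendsto_intros pairing_limit_U f)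
    then show "((\<lambda>s. ip f (U n s) / X s - ip f (AN n) + \<kappa> / k) \<longlongrightarrow> \<kappa> / k) (at_right 0)" by simp
    show "((\<lambda>s. p t / X s) \<longlongrightarrow> 0) (at_right 0)"
      by (rule real_tendsto_divide_at_top[OF tendsto_const X_at_top])
    show "\<forall>\<^sub>F s in at_right 0. ip f (U n s) / X s - ip f (AN n) + \<kappa> / k \<le> p t / X s"
    proof (rule eventually_at_right_0[OF t(1)])
      fix s assume s: "0 < s" "s \<le> t"
      have "ip f (U n s) / X s - ip f (AN n) + \<kappa> / k = p s / X s"
        using X_pos[OF s(1)] by (simp add: p_def field_simps)
      also have "\<dots> \<le> p t / X s" using p_mono[OF s] X_pos[OF s(1)] by (simp add: divide_right_mono)
      finally show "ip f (U n s) / X s - ip f (AN n) + \<kappa> / k \<le> p t / X s" .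
    qed
  qed simp
  then have "nrm f * nrm f \<le> nrm f * (K (Suc n) * H t)"
    using k_pos nrm_square[of f] by (simp add: \<kappa>_def field_simps power2_eq_square)
  then show ?thesis
    unfolding f_def[symmetric] using nrm_nonneg[of f] K_nonneg[of "Suc n"] H_nonneg[OF t(1)]
    by (cases "nrm f = 0") auto
qed

lemma nrm_V_tendsto: "((\<lambda>t. ip (V n t) (V n t)) \<longlongrightarrow> 0) (at_right 0)"
proof (rule tendsto_sandwich[of "\<lambda>_. 0"])
  show "\<forall>\<^sub>F t in at_right 0. 0 \<le> ip (V n t) (V n t)" by (simp add: ip_nonneg)
  show "\<forall>\<^sub>F t in at_right 0. ip (V n t) (V n t) \<le> (K (Suc n) * H t)\<^sup>2"
    unfolding nrm_square[symmetric]
    by (rule eventually_at_right_0[of 1]) (auto intro!: power_mono nrm_V_bound nrm_nonneg)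
  have "((\<lambda>t. (K (Suc n) * H t)\<^sup>2) \<longlongrightarrow> (K (Suc n) * 0)\<^sup>2) (at_right 0)"
    by (intro tendsto_intros H_lim)
  then show "((\<lambda>t. (K (Suc n) * H t)\<^sup>2) \<longlongrightarrow> 0) (at_right 0)" by simp
qed auto

text \<open>This is \<open>\<Delta>^n (\<psi> - A X)\<close>, with the factor 1 written out to match
  \<open>laplacian_linear\<close> and \<open>ip_linear\<close>.\<close>

definition Z :: "nat \<Rightarrow> real \<Rightarrow> 'a \<Rightarrow> real" where
  "Z n t p = 1 * U n t p + (- X t) * AN n p"

lemma Z_smooth: "t > 0 \<Longrightarrow> smooth (Z n t)"
  unfolding Z_def[abs_def] by (intro smooth_add smooth_scale sU AN_smooth)

lemma laplacian_Z: "t > 0 \<Longrightarrow> p \<in> M \<Longrightarrow> L (Z n t) p = Z (Suc n) t p"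
  using laplacian_linear[OF sU[of t n] AN_smooth[of n], of p 1 "- X t"]
  by (simp add: Z_def[abs_def] U_Suc AN_def)

text \<open>A crude bound that ignores the cancellation between \<open>U n\<close> and
  \<open>X\<close> times \<open>AN n\<close>; the growth \<open>(1 + X)^2\<close> is still beaten by
  the weight \<open>a^4\<close>. The triangle inequality comes from Cauchy-Schwarz applied to
  \<open>ip (Z m t) (Z m t)\<close>.\<close>

lemma nrm_Z_bound:
  assumes t: "0 < t" "t \<le> 1"
  shows "\<bar>ip (Z n t) (Z m t)\<bar> \<le> (K n + nrm (AN n)) * (K m + nrm (AN m)) * (1 + X t)\<^sup>2"
proof -
  have cZ: "continuous_on M (Z m t)" for m by (rule smooth_continuous[OF Z_smooth[OF t(1)]])
  have cA: "continuous_on M (AN m)" for m by (rule smooth_continuous[OF AN_smooth])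
  have X: "X t > 0" by (rule X_pos[OF t(1)])
  have *: "nrm (Z m t) \<le> (K m + nrm (AN m)) * (1 + X t)" for m
  proof -
    have "nrm (Z m t) * nrm (Z m t) = ip (Z m t) (Z m t)"
      using nrm_square[of "Z m t"] by (simp add: power2_eq_square)
    also have "\<dots> = 1 * ip (Z m t) (U m t) + (- X t) * ip (Z m t) (AN m)"
      unfolding Z_def[of m t, abs_def]
      by (rule ip_linear[OF cZ[of m, unfolded Z_def[abs_def]] cU[OF t(1)] cA])
    also have "\<dots> \<le> nrm (Z m t) * nrm (U m t) + X t * (nrm (Z m t) * nrm (AN m))"
    proof -
      have "ip (Z m t) (U m t) \<le> nrm (Z m t) * nrm (U m t)"
        using ip_Cauchy_Schwarz[OF cZ[of m] cU[OF t(1), of m]] unfolding nrm_def by linarith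
      moreover have "- ip (Z m t) (AN m) \<le> nrm (Z m t) * nrm (AN m)"
        using ip_Cauchy_Schwarz[OF cZ[of m] cA[of m]] unfolding nrm_def by linarith
      then have "X t * - ip (Z m t) (AN m) \<le> X t * (nrm (Z m t) * nrm (AN m))"
        using X by (intro mult_left_mono) auto
      ultimately show ?thesis by simp
    qed
    also have "\<dots> = nrm (Z m t) * (nrm (U m t) + X t * nrm (AN m))" by (simp add: algebra_simps)
    finally have "nrm (Z m t) \<le> nrm (U m t) + X t * nrm (AN m)"
      using nrm_nonneg[of "Z m t"] nrm_nonneg[of "U m t"] nrm_nonneg[of "AN m"] X
      by (cases "nrm (Z m t) = 0") auto
    also have "\<dots> \<le> K m * (1 + X t) + (1 + X t) * nrm (AN m)"
      by (intro add_mono nrm_U_bound t mult_right_mono nrm_nonneg) simp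
    finally show ?thesis by (simp add: algebra_simps)
  qed
  have "\<bar>ip (Z n t) (Z m t)\<bar> \<le> nrm (Z n t) * nrm (Z m t)"
    unfolding nrm_def by (rule ip_Cauchy_Schwarz[OF cZ cZ])
  also have "\<dots> \<le> ((K n + nrm (AN n)) * (1 + X t)) * ((K m + nrm (AN m)) * (1 + X t))"
    using X by (intro mult_mono * nrm_nonneg mult_nonneg_nonneg add_nonneg_nonneg K_nonneg) auto
  finally show ?thesis by (simp add: power2_eq_square mult_ac)
qed

text \<open>The time derivative of \<open>Z\<close> is \<open>V / a^3\<close> because
  \<open>X' = - k / a^3\<close>, and Green's identity turns the gradient energy into a pairing with
  the next level. The whole energy is thus expressed by inner products.\<close>

lemma energy_eq:
  assumes t: "t > 0"
  shows "(a t) ^ 6 * energy_N \<A> g vol a n t (\<lambda>s p. \<psi> s p - A p * X s) =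
    ip (V n t) (V n t) - (a t) ^ 4 * ip (Z n t) (Z (Suc n) t)"
proof -
  let ?\<phi> = "\<lambda>s p. \<psi> s p - A p * X s"
  have a: "a t > 0" by (rule a_pos[OF t])
  have \<phi>: "(L ^^ n) (?\<phi> s) p = Z n s p" if "s > 0" "p \<in> M" for s p
  proof -
    have "?\<phi> s = (\<lambda>q. 1 * \<psi> s q + (- X s) * A q)" by (simp add: fun_eq_iff)
    then show ?thesis
      unfolding Z_def U_def AN_def
      using laplacian_power_linear[OF smooth_slice[OF psi that(1)] A_smooth that(2), of n 1 "- X s"] by simp
  qed
  have dZ: "deriv (\<lambda>s. (L ^^ n) (?\<phi> s) p) t = V n t p / (a t) ^ 3" if p: "p \<in> M" for p
  proof (rule DERIV_imp_deriv, rule has_field_derivative_transform_within_open[where S="{0<..}"])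
    show "((\<lambda>s. 1 * U n s p + (- X s) * AN n p) has_real_derivative V n t p / (a t) ^ 3) (at t)"
      using a by (auto intro!: derivative_eq_intros has_time_derivative[OF st_U t p] X_deriv[OF t]
          simp: V_def field_simps)
  qed (use t \<phi> p in \<open>auto simp: Z_def\<close>)
  have gZ: "grad_norm2 \<A> g ((L ^^ n) (?\<phi> t)) p = gradient (Z n t) (Z n t) p" if p: "p \<in> M" for p
  proof -
    \<comment> \<open>\<open>gradient_cong\<close> replaces only the first argument; symmetry is
      what reaches the second.\<close>
    let ?w = "(L ^^ n) (?\<phi> t)"
    have "gradient ?w v p = gradient (Z n t) v p" for v by (rule gradient_cong[OF p \<phi>[OF t]])
    from this[of ?w] this[of "Z n t"] show ?thesis
      unfolding grad_norm2_eq[OF p] gradient_sym[OF p, of "Z n t" ?w] by simp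
  qed
  have "energy_N \<A> g vol a n t ?\<phi> =
      integral\<^sup>L vol (\<lambda>p. (V n t p * V n t p) / (a t) ^ 6 + gradient (Z n t) (Z n t) p / (a t)\<^sup>2)"
    unfolding energy_N_def energy_def
  proof (rule Bochner_Integration.integral_cong[OF refl])
    fix p assume "p \<in> space vol"
    then have p: "p \<in> M" by (simp add: space_vol)
    show "(deriv (\<lambda>s. (L ^^ n) (?\<phi> s) p) t)\<^sup>2 + grad_norm2 \<A> g ((L ^^ n) (?\<phi> t)) p / (a t)\<^sup>2 =
        V n t p * V n t p / a t ^ 6 + gradient (Z n t) (Z n t) p / (a t)\<^sup>2"
      unfolding dZ[OF p] gZ[OF p]
      by (simp add: power_divide power2_eq_square[of "V n t p"] power_mult[symmetric])
  qed
  also have "\<dots> = ip (V n t) (V n t) / (a t) ^ 6 + integral\<^sup>L vol (gradient (Z n t) (Z n t)) / (a t)\<^sup>2"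
  proof -
    have "integrable vol (\<lambda>p. V n t p * V n t p)"
      by (intro ip_integrable smooth_continuous V_smooth t)
    moreover have "integrable vol (gradient (Z n t) (Z n t))"
      by (intro integrable_continuous continuous_Ck[of 0] Ck_gradient smooth_Ck Z_smooth t)
    ultimately show ?thesis by (simp add: ip_def)
  qed
  also have "integral\<^sup>L vol (gradient (Z n t) (Z n t)) = - ip (Z n t) (Z (Suc n) t)"
  proof -
    have "ip (Z n t) (L (Z n t)) = ip (Z n t) (Z (Suc n) t)"
      by (rule ip_cong[OF refl laplacian_Z[OF t]])
    then show ?thesis using ip_laplacian[OF Z_smooth[OF t, of n] Z_smooth[OF t, of n]] by simp
  qed
  finally show ?thesis using a by (simp add: field_simps eval_nat_numeral)
qed

theorem energy_tendsto:
  "((\<lambda>t. (a t) ^ 6 * energy_N \<A> g vol a n t (\<lambda>s p. \<psi> s p - A p * X s)) \<longlongrightarrow> 0) (at_right 0)"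
proof -
  define C where "C = (K n + nrm (AN n)) * (K (Suc n) + nrm (AN (Suc n)))"
  have "((\<lambda>t. (a t) ^ 4 * ip (Z n t) (Z (Suc n) t)) \<longlongrightarrow> 0) (at_right 0)"
  proof (rule Lim_null_comparison)
    show "\<forall>\<^sub>F t in at_right 0. norm ((a t) ^ 4 * ip (Z n t) (Z (Suc n) t)) \<le> C * ((a t)\<^sup>2 + (a t)\<^sup>2 * X t)\<^sup>2"
    proof (rule eventually_at_right_0[of 1])
      fix t :: real assume t: "0 < t" "t \<le> 1"
      have "(a t) ^ 4 * \<bar>ip (Z n t) (Z (Suc n) t)\<bar> \<le> (a t) ^ 4 * (C * (1 + X t)\<^sup>2)"
        unfolding C_def by (intro mult_left_mono nrm_Z_bound t) simp
      also have "\<dots> = C * ((a t)\<^sup>2 + (a t)\<^sup>2 * X t)\<^sup>2"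
        by (simp add: algebra_simps eval_nat_numeral)
      finally show "norm ((a t) ^ 4 * ip (Z n t) (Z (Suc n) t)) \<le> C * ((a t)\<^sup>2 + (a t)\<^sup>2 * X t)\<^sup>2"
        by (simp add: abs_mult)
    qed simp
    have "((\<lambda>t. C * ((a t)\<^sup>2 + (a t)\<^sup>2 * X t)\<^sup>2) \<longlongrightarrow> C * (0\<^sup>2 + 0)\<^sup>2) (at_right 0)"
      by (intro tendsto_intros a_lim a2X_lim)
    then show "((\<lambda>t. C * ((a t)\<^sup>2 + (a t)\<^sup>2 * X t)\<^sup>2) \<longlongrightarrow> 0) (at_right 0)" by simp
  qed
  from tendsto_diff[OF nrm_V_tendsto[of n] this]
  have "((\<lambda>t. ip (V n t) (V n t) - (a t) ^ 4 * ip (Z n t) (Z (Suc n) t)) \<longlongrightarrow> 0) (at_right 0)" by simp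
  then show ?thesis
  proof (rule Lim_transform_eventually)
    show "\<forall>\<^sub>F t in at_right 0. ip (V n t) (V n t) - (a t) ^ 4 * ip (Z n t) (Z (Suc n) t) =
        (a t) ^ 6 * energy_N \<A> g vol a n t (\<lambda>s p. \<psi> s p - A p * X s)"
      by (rule eventually_at_right_0[of 1]) (simp_all add: energy_eq)
  qed
qed

end


section \<open>Scale factors near the singularity\<close>

lemma powr_tendsto_0:
  fixes a :: "real \<Rightarrow> real"
  assumes "(a \<longlongrightarrow> 0) (at_right 0)" "c > 0" "\<And>t. t > 0 \<Longrightarrow> a t > 0"
  shows "((\<lambda>t. a t powr c) \<longlongrightarrow> 0) (at_right 0)"
proof -
  have "\<forall>\<^sub>F t in at_right 0. 0 \<le> a t"
    using eventually_at_right_less[of "0::real"] by eventually_elim (use assms(3) less_imp_le in blast)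
  then have "((\<lambda>t. a t powr c) \<longlongrightarrow> 0 powr c) (at_right 0)"
    using assms(1,2) by (intro tendsto_powr2 tendsto_const) auto
  then show ?thesis by simp
qed

text \<open>
  With \<open>e = 3\<gamma>/2\<close> both types satisfy \<open>a' \<approx> a\<^sup>1\<^sup>-\<^sup>e\<close> near the singularity, so \<open>X\<close> is of the
  order of \<open>a\<^sup>e\<^sup>-\<^sup>3\<close>, and \<open>a X\<close> is dominated by the derivative of a combination of positive powers
  of \<open>a\<close>; this is where \<open>e > 1\<close> enters.
\<close>

locale big_bang =
  fixes a a' X :: "real \<Rightarrow> real" and k m C T e :: real
  assumes a_pos: "t > 0 \<Longrightarrow> a t > 0"
    and a_deriv: "t > 0 \<Longrightarrow> (a has_real_derivative a' t) (at t)"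
    and k_pos: "k > 0"
    and X_deriv: "t > 0 \<Longrightarrow> (X has_real_derivative - k / (a t) ^ 3) (at t)"
    and X_pos: "t > 0 \<Longrightarrow> X t > 0"
    and a_lim: "(a \<longlongrightarrow> 0) (at_right 0)"
    and e: "1 < e" "e < 3"
    and m: "m > 0" and a'_ge: "t > 0 \<Longrightarrow> a' t \<ge> m * a t powr (1 - e)"
    and C: "C > 0" and T: "T > 0" and a'_le: "0 < t \<Longrightarrow> t \<le> T \<Longrightarrow> a' t \<le> C * a t powr (1 - e)"
begin

lemma a'_nonneg: "t > 0 \<Longrightarrow> a' t \<ge> 0"
  using a'_ge[of t] m by (meson less_imp_le mult_nonneg_nonneg order_trans powr_ge_zero)

lemma powr_deriv:
  "t > 0 \<Longrightarrow> ((\<lambda>t. a t powr r) has_real_derivative r * a t powr (r - 1) * a' t) (at t)"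
  using has_real_derivative_powr[OF a_pos, of t r]
  by (auto intro!: DERIV_fun_powr[OF a_deriv a_pos, THEN DERIV_cong] simp: mult_ac)

lemma powr_split: "t > 0 \<Longrightarrow> a t powr (e - 4) * a t powr (1 - e) = 1 / (a t) ^ 3"
  using a_pos[of t] by (simp add: powr_add[symmetric] powr_minus_divide powr_numeral)

lemma X_antimono:
  assumes "0 < s" "s \<le> t" shows "X t \<le> X s"
proof (rule DERIV_nonpos_imp_nonincreasing[OF assms(2)])
  fix x assume "s \<le> x"
  then have x: "x > 0" using assms by simp
  then show "\<exists>y. (X has_real_derivative y) (at x) \<and> y \<le> 0"
    using X_deriv[OF x] a_pos[OF x] k_pos by (intro exI[of _ "- k / (a x) ^ 3"]) simp
qed

text \<open>The lower bound on \<open>a'\<close> gives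
  \<open>k / a^3 \<le> (k / m) * a powr (e - 4) * a'\<close>. Integrating this power of
  \<open>a\<close> produces the factor \<open>1 / (3 - e)\<close>.\<close>

definition c1 :: real where "c1 = k / ((3 - e) * m)"

lemma c1_pos: "c1 > 0"
  unfolding c1_def using k_pos m e by simp

lemma X_le: 
  assumes t: "t > 0" shows "X t \<le> X 1 + c1 * a t powr (e - 3)"
proof (cases "t \<le> 1")
  case True
  have "X t - c1 * a t powr (e - 3) \<le> X 1 - c1 * a 1 powr (e - 3)"
  proof (rule DERIV_nonneg_mono[OF True, where f'="\<lambda>s. - k / (a s) ^ 3 - c1 * ((e - 3) * a s powr (e - 3 - 1) * a' s)"])
    fix s assume "t \<le> s"
    then have s: "s > 0" using t by simp
    show "((\<lambda>s. X s - c1 * a s powr (e - 3)) has_real_derivative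
        - k / (a s) ^ 3 - c1 * ((e - 3) * a s powr (e - 3 - 1) * a' s)) (at s)"
      by (intro DERIV_diff DERIV_cmult X_deriv powr_deriv s)
    have "k / (a s) ^ 3 = c1 * (3 - e) * (a s powr (e - 4) * (m * a s powr (1 - e)))"
      using powr_split[OF s] e m by (simp add: c1_def mult.left_commute)
    also have "\<dots> \<le> c1 * (3 - e) * (a s powr (e - 4) * a' s)"
      using c1_pos e by (intro mult_left_mono a'_ge s) auto
    finally show "0 \<le> - k / (a s) ^ 3 - c1 * ((e - 3) * a s powr (e - 3 - 1) * a' s)"
      by (simp add: algebra_simps)
  qed
  moreover have "c1 * a 1 powr (e - 3) \<ge> 0" using c1_pos by simp
  ultimately show ?thesis by simp
next
  case False
  \<comment> \<open>Times beyond 1 are included because \<open>H_ge\<close> is claimed for all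
    positive times; there \<open>X\<close> is already below \<open>X 1\<close>.\<close>
  have "c1 * a t powr (e - 3) \<ge> 0" using c1_pos by simp
  then show ?thesis using X_antimono[of 1 t] False by simp
qed

lemma X_at_top: "filterlim X at_top (at_right 0)"
proof -
  \<comment> \<open>The counterpart of \<open>c1\<close> with the upper constant \<open>C\<close> in
    place of \<open>m\<close>; it yields a lower bound for \<open>X\<close> on
    \<open>(0, T]\<close>, where the upper bound on \<open>a'\<close> holds.\<close>
  define c2 where "c2 = k / ((3 - e) * C)"
  have c2: "c2 > 0" unfolding c2_def using k_pos C e by simp
  have lower: "c2 * a t powr (e - 3) + (X T - c2 * a T powr (e - 3)) \<le> X t" if t: "0 < t" "t \<le> T" for t
  proof -
    have "c2 * a t powr (e - 3) - X t \<le> c2 * a T powr (e - 3) - X T"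
    proof (rule DERIV_nonneg_mono[OF t(2), where f'="\<lambda>s. c2 * ((e - 3) * a s powr (e - 3 - 1) * a' s) - - k / (a s) ^ 3"])
      fix s assume "t \<le> s" "s \<le> T"
      then have s: "0 < s" "s \<le> T" using t by auto
      show "((\<lambda>s. c2 * a s powr (e - 3) - X s) has_real_derivative
          c2 * ((e - 3) * a s powr (e - 3 - 1) * a' s) - - k / (a s) ^ 3) (at s)"
        by (intro DERIV_diff DERIV_cmult X_deriv powr_deriv s)
      have "c2 * (3 - e) * (a s powr (e - 4) * a' s) \<le> c2 * (3 - e) * (a s powr (e - 4) * (C * a s powr (1 - e)))"
        using c2 e by (intro mult_left_mono a'_le s) auto
      also have "\<dots> = k / (a s) ^ 3"
        using powr_split[OF s(1)] e C by (simp add: c2_def mult.left_commute)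
      finally show "0 \<le> c2 * ((e - 3) * a s powr (e - 3 - 1) * a' s) - - k / (a s) ^ 3"
        by (simp add: algebra_simps)
    qed
    then show ?thesis by simp
  qed
  have "filterlim (\<lambda>t. a t powr (3 - e)) (at_right 0) (at_right 0)"
    unfolding filterlim_at
    using powr_tendsto_0[OF a_lim _ a_pos, of "3 - e"] e eventually_at_right_less[of "0::real"]
    by (auto elim!: eventually_mono dest: a_pos)
  then have "filterlim (\<lambda>t. inverse (a t powr (3 - e))) at_top (at_right 0)"
    by (rule filterlim_compose[OF filterlim_inverse_at_top_right])
  then have "filterlim (\<lambda>t. c2 * a t powr (e - 3)) at_top (at_right 0)"
    using c2 by (intro filterlim_tendsto_pos_mult_at_top[OF tendsto_const]) (simp_all add: powr_minus[symmetric])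
  then have "filterlim (\<lambda>t. c2 * a t powr (e - 3) + (X T - c2 * a T powr (e - 3))) at_top (at_right 0)"
    by (subst add.commute) (intro filterlim_tendsto_add_at_top[OF tendsto_const])
  then show ?thesis
    by (rule filterlim_at_top_mono) (use lower T in \<open>auto simp: eventually_at_right_field\<close>)
qed

lemma a2X_lim: "((\<lambda>t. (a t)\<^sup>2 * X t) \<longlongrightarrow> 0) (at_right 0)"
proof (rule Lim_null_comparison)
  show "\<forall>\<^sub>F t in at_right 0. norm ((a t)\<^sup>2 * X t) \<le> X 1 * (a t)\<^sup>2 + c1 * a t powr (e - 1)"
    using eventually_at_right_less[of "0::real"]
  proof eventually_elim
    case (elim t)
    have "(a t)\<^sup>2 * X t \<le> (a t)\<^sup>2 * (X 1 + c1 * a t powr (e - 3))"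
      by (intro mult_left_mono X_le elim) simp
    also have "(a t)\<^sup>2 * a t powr (e - 3) = a t powr (e - 1)"
      using a_pos[OF elim] by (simp add: powr_numeral[symmetric] powr_add[symmetric] del: powr_numeral)
    then have "(a t)\<^sup>2 * (X 1 + c1 * a t powr (e - 3)) = X 1 * (a t)\<^sup>2 + c1 * a t powr (e - 1)"
      by (simp add: algebra_simps)
    finally show ?case using X_pos[OF elim] by (simp add: abs_mult)
  qed
  have "((\<lambda>t. X 1 * (a t)\<^sup>2 + c1 * a t powr (e - 1)) \<longlongrightarrow> X 1 * 0\<^sup>2 + c1 * 0) (at_right 0)"
    by (intro tendsto_intros a_lim powr_tendsto_0 a_pos) (use e in auto)
  then show "((\<lambda>t. X 1 * (a t)\<^sup>2 + c1 * a t powr (e - 1)) \<longlongrightarrow> 0) (at_right 0)" by simp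
qed

text \<open>By \<open>X_le\<close>, \<open>a (1 + X)\<close> is at most
  \<open>(1 + X 1) a + c1 * a powr (e - 2)\<close>. Multiplying by
  \<open>a' / (m * a powr (1 - e))\<close>, which is at least 1, turns the two powers into
  \<open>a powr e * a'\<close> and \<open>a powr (2 * e - 3) * a'\<close> up to constants, with the
  primitives used here. The exponent \<open>2 * e - 2\<close> is positive because
  \<open>e > 1\<close>.\<close>

definition H :: "real \<Rightarrow> real" where
  "H t = (1 + X 1) / m / (e + 1) * a t powr (e + 1) + c1 / m / (2 * e - 2) * a t powr (2 * e - 2)"

definition H' :: "real \<Rightarrow> real" where
  "H' t = (1 + X 1) / m * (a t powr e * a' t) + c1 / m * (a t powr (2 * e - 3) * a' t)"

lemma H_deriv: "t > 0 \<Longrightarrow> (H has_real_derivative H' t) (at t)"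
proof -
  assume t: "t > 0"
  have "(H has_real_derivative (1 + X 1) / m / (e + 1) * ((e + 1) * a t powr (e + 1 - 1) * a' t) +
      c1 / m / (2 * e - 2) * ((2 * e - 2) * a t powr (2 * e - 2 - 1) * a' t)) (at t)"
    unfolding H_def[abs_def] by (intro DERIV_add DERIV_cmult powr_deriv t)
  then show ?thesis using e by (simp add: H'_def)
qed

lemma H_nonneg: "t > 0 \<Longrightarrow> H t \<ge> 0"
  unfolding H_def using e m c1_pos X_pos[of 1] by simp

lemma H_lim: "(H \<longlongrightarrow> 0) (at_right 0)"
proof -
  have "(H \<longlongrightarrow> (1 + X 1) / m / (e + 1) * 0 + c1 / m / (2 * e - 2) * 0) (at_right 0)"
    unfolding H_def[abs_def] by (intro tendsto_intros powr_tendsto_0 a_lim a_pos) (use e in auto)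
  then show ?thesis by simp
qed

lemma H_ge:
  assumes t: "t > 0" shows "H' t \<ge> a t * (1 + X t)"
proof -
  have a: "a t > 0" by (rule a_pos[OF t])
  have p: "a t powr r * (m * a t powr (1 - e)) = m * a t powr (r + 1 - e)" for r
    by (simp add: mult.left_commute powr_add[symmetric] add_diff_eq)
  have "a t * (1 + X t) \<le> a t * (1 + (X 1 + c1 * a t powr (e - 3)))"
    using X_le[OF t] a by (intro mult_left_mono add_mono) auto
  also have "\<dots> = (1 + X 1) * a t + c1 * (a t powr 1 * a t powr (e - 3))"
    using a by (simp add: algebra_simps)
  also have "\<dots> = (1 + X 1) / m * (a t powr e * (m * a t powr (1 - e))) +
      c1 / m * (a t powr (2 * e - 3) * (m * a t powr (1 - e)))"
    unfolding p powr_add[symmetric] using m a by simp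
  also have "\<dots> \<le> H' t"
    unfolding H'_def using m c1_pos X_pos[of 1]
    by (intro add_mono mult_left_mono a'_ge t) auto
  finally show ?thesis .
qed

end

section \<open>Application to the two types of spacetime\<close>

lemma energy_tendsto_big_bang:
  assumes "closed_riemannian_3manifold M \<A> g" "riemannian_volume M \<A> g vol"
    and wave: "smooth_wave M \<A> g a \<psi>"
    and bb: "big_bang a a' X k m C T e"
    and lead: "leading_coefficient M \<A> X \<psi> A"
  shows "((\<lambda>t. (a t) ^ 6 * energy_N \<A> g vol a N t (\<lambda>s p. \<psi> s p - A p * X s)) \<longlongrightarrow> 0) (at_right 0)"
proof -
  interpret big_bang a a' X k m C T e by (rule bb)
  interpret closed_riemannian M \<A> g vol by standard (use assms in auto)
  have psi: "spacetime_smooth \<psi>" using wave by (simp add: smooth_wave_def)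
  have A: "smooth_function \<A> A" "uniform_limit M (\<lambda>t p. \<psi> t p / X t) A (at_right 0)"
    using lead by (simp_all add: leading_coefficient_def)
  have eq: "dt (dt \<psi>) t p = laplacian \<A> g (\<psi> t) p / (a t)\<^sup>2 - 3 * (a' t / a t) * dt \<psi> t p"
    if "t > 0" "p \<in> M" for t p
    using wave that DERIV_imp_deriv[OF a_deriv[OF that(1)]]
    by (auto simp: smooth_wave_def dt_def[abs_def] algebra_simps)
  interpret singular_wave M \<A> g vol a a' X k \<psi> A H H'
    by standard (fact psi eq a_pos a_deriv a'_nonneg k_pos X_deriv X_pos A X_at_top a_lim a2X_lim
        H_deriv H_ge H_nonneg H_lim)+
  show ?thesis by (rule energy_tendsto)
qed

text \<open>For a pure power, \<open>a'\<close> is exactly \<open>2 / (3 * \<gamma>)\<close> times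
  \<open>a powr (1 - e)\<close>, so the lower and upper constants coincide and any \<open>T\<close>
  works. The exponent of \<open>\<chi>\<close> is \<open>- k\<close> with
  \<open>k = 2 / \<gamma> - 1\<close>, positive since \<open>\<gamma> < 2\<close>.\<close>

lemma big_bang_type_zero:
  assumes \<gamma>: "2 / 3 < \<gamma>" "\<gamma> < 2" and a: "type_zero \<gamma> a"
  shows "big_bang a (\<lambda>t. 2 / (3 * \<gamma>) * t powr (2 / (3 * \<gamma>) - 1)) (chi_type_zero \<gamma>) (2 / \<gamma> - 1)
    (2 / (3 * \<gamma>)) (2 / (3 * \<gamma>)) 1 (3 * \<gamma> / 2)"
proof
  have at: "a t = t powr (2 / (3 * \<gamma>))" if "t > 0" for t using a that by (simp add: type_zero_def)
  have g: "\<gamma> > 0" using \<gamma> by simp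
  show "0 < a t" if "0 < t" for t using at[OF that] that by simp
  show "(a has_real_derivative 2 / (3 * \<gamma>) * t powr (2 / (3 * \<gamma>) - 1)) (at t)" if t: "0 < t" for t
    by (rule has_field_derivative_transform_within_open[OF has_real_derivative_powr[OF t], of "{0<..}"])
      (use t at in auto)
  show "0 < 2 / \<gamma> - 1" using \<gamma> by (simp add: field_simps)
  show "(chi_type_zero \<gamma> has_real_derivative - (2 / \<gamma> - 1) / a t ^ 3) (at t)" if t: "0 < t" for t
  proof -
    have "a t ^ 3 = t powr (2 / \<gamma>)"
      using t g by (simp add: at powr_numeral[symmetric] powr_powr del: powr_numeral)
    moreover have "t powr (1 - 2 / \<gamma> - 1) = 1 / t powr (2 / \<gamma>)"
      by (simp add: powr_minus_divide)
    ultimately show ?thesis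
      unfolding chi_type_zero_def[abs_def]
      using has_real_derivative_powr[OF t, of "1 - 2 / \<gamma>"] by (simp add: algebra_simps)
  qed
  show "0 < chi_type_zero \<gamma> t" if "0 < t" for t using that by (simp add: chi_type_zero_def)
  have "((\<lambda>t::real. t powr (2 / (3 * \<gamma>))) \<longlongrightarrow> 0) (at_right 0)"
    using g by (intro powr_tendsto_0 tendsto_ident_at) auto
  then show "(a \<longlongrightarrow> 0) (at_right 0)"
    by (rule Lim_transform_eventually)
      (use eventually_at_right_less[of "0::real"] in \<open>auto elim!: eventually_mono simp: at\<close>)
  have p: "a t powr (1 - 3 * \<gamma> / 2) = t powr (2 / (3 * \<gamma>) - 1)" if "0 < t" for t
  proof -
    have "2 / (3 * \<gamma>) * (1 - 3 * \<gamma> / 2) = 2 / (3 * \<gamma>) - 1" using g by (simp add: field_simps)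
    then show ?thesis using at[OF that] by (simp add: powr_powr)
  qed
  show "2 / (3 * \<gamma>) * a t powr (1 - 3 * \<gamma> / 2) \<le> 2 / (3 * \<gamma>) * t powr (2 / (3 * \<gamma>) - 1)" if "0 < t" for t
    using p[OF that] by simp
  show "2 / (3 * \<gamma>) * t powr (2 / (3 * \<gamma>) - 1) \<le> 2 / (3 * \<gamma>) * a t powr (1 - 3 * \<gamma> / 2)" if "0 < t" for t
    using p[OF that] by simp
qed (use \<gamma> in auto)

lemma big_bang_type_minus_one:
  assumes \<gamma>: "2 / 3 < \<gamma>" "\<gamma> < 2" and a: "type_minus_one \<gamma> a"
  shows "\<exists>a' m C T. big_bang a a' (chi_type_minus_one a) 1 m C T (3 * \<gamma> / 2)"
proof -
  obtain B where B: "B > 0" and cont: "continuous_on {0..} a" and a0: "a 0 = 0"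
    and pos: "\<And>t. t > 0 \<Longrightarrow> a t > 0"
    and deriv: "\<And>t. t > 0 \<Longrightarrow> (a has_real_derivative sqrt (8 * pi * B / 3 * a t powr (2 - 3 * \<gamma>) + 1)) (at t)"
    using a unfolding type_minus_one_def by blast
  define b where "b = 8 * pi * B / 3"
  define a' where "a' t = sqrt (b * a t powr (2 - 3 * \<gamma>) + 1)" for t
  have b: "b > 0" unfolding b_def using B by simp
  have da: "(a has_real_derivative a' t) (at t)" if "t > 0" for t
    using deriv[OF that] by (simp add: a'_def b_def)
  have sq: "sqrt (a t powr (2 - 3 * \<gamma>)) = a t powr (1 - 3 * \<gamma> / 2)" if "t > 0" for t
    using pos[OF that] by (simp add: powr_half_sqrt[symmetric] powr_powr algebra_simps)
  have lower: "sqrt b * a t powr (1 - 3 * \<gamma> / 2) \<le> a' t" if "t > 0" for t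
    unfolding sq[OF that, symmetric] real_sqrt_mult[symmetric] a'_def by simp
  have a'1: "a' t \<ge> 1" for t unfolding a'_def using b by simp
  have lim: "(a \<longlongrightarrow> 0) (at_right 0)"
  proof -
    have "(a \<longlongrightarrow> a 0) (at 0 within {0..})" using cont by (simp add: continuous_on_def)
    then show ?thesis unfolding a0 by (rule tendsto_within_subset) auto
  qed
  then have "\<forall>\<^sub>F t in at_right 0. a t < 1" by (rule order_tendstoD) simp
  then obtain T0 where T0: "T0 > 0" "\<And>t. 0 < t \<Longrightarrow> t < T0 \<Longrightarrow> a t < 1"
    by (auto simp: eventually_at_right_field)
  define T where "T = T0 / 2"
  have upper: "a' t \<le> sqrt (b + 1) * a t powr (1 - 3 * \<gamma> / 2)" if t: "0 < t" "t \<le> T" for t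
  proof -
    have "a t < 1" using T0(2)[of t] t T0(1) by (simp add: T_def)
    \<comment> \<open>While \<open>a < 1\<close>, the summand 1 under the root is at most
      \<open>a powr (2 - 3 * \<gamma>)\<close>, whose exponent is negative because
      \<open>\<gamma> > 2 / 3\<close>. It can be absorbed at the cost of replacing \<open>b\<close>
      by \<open>b + 1\<close>.\<close>
    then have "a t powr 0 \<le> a t powr (2 - 3 * \<gamma>)"
      using pos[OF t(1)] \<gamma> by (intro powr_mono') auto
    then have "b * a t powr (2 - 3 * \<gamma>) + 1 \<le> (b + 1) * a t powr (2 - 3 * \<gamma>)"
      using pos[OF t(1)] by (simp add: algebra_simps)
    then show ?thesis unfolding sq[OF t(1), symmetric] real_sqrt_mult[symmetric] a'_def
      by (rule real_sqrt_le_mono)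
  qed
  \<comment> \<open>The summand 1 under the root now helps: \<open>a' \<ge> 1\<close> and
    \<open>a\<close> tends to 0, so \<open>a\<close> grows at least linearly.\<close>
  have a_ge: "t \<le> a t" if t: "t > 0" for t
  proof -
    have "((\<lambda>s. a s - s) \<longlongrightarrow> 0 - 0) (at_right 0)"
      by (intro tendsto_diff lim tendsto_ident_at)
    moreover have "\<forall>\<^sub>F s in at_right 0. a s - s \<le> a t - t"
      unfolding eventually_at_right_field
    proof (intro exI[of _ t] conjI allI impI t)
      fix s assume s: "0 < s" "s < t"
      show "a s - s \<le> a t - t"
      proof (rule DERIV_nonneg_mono[where f="\<lambda>s. a s - s" and f'="\<lambda>r. a' r - 1"])
        show "((\<lambda>s. a s - s) has_real_derivative a' x - 1) (at x)" if "s \<le> x" for x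
          using that s by (intro DERIV_diff da DERIV_ident) simp
      qed (use s a'1 in auto)
    qed
    ultimately have "0 - 0 \<le> a t - t" by (rule tendsto_upperbound) simp
    then show ?thesis by simp
  qed
  define f where "f s = 1 / (a s) ^ 3" for s
  have cf: "continuous_on {s..} f" if s: "s > 0" for s
  proof -
    have "continuous_on {s..} a" by (rule continuous_on_subset[OF cont]) (use s in auto)
    moreover have "(a x) ^ 3 \<noteq> 0" if "x \<in> {s..}" for x using pos[of x] that s by simp
    ultimately show ?thesis unfolding f_def by (intro continuous_intros) auto
  qed
  \<comment> \<open>Linear growth makes \<open>1 / a^3\<close> integrable at infinity. Thus
    \<open>chi_type_minus_one\<close> is a genuine tail integral and not the default value of
    \<open>integral\<close>.\<close>
  have intf: "f integrable_on {s..}" if s: "s > 0" for s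
  proof (rule measurable_bounded_by_integrable_imp_integrable)
    show "f \<in> borel_measurable (lebesgue_on {s..})"
      by (rule continuous_imp_measurable_on_sets_lebesgue[OF cf[OF s]]) simp
    show "(\<lambda>x. x powr (- 3)) integrable_on {s..}"
      using has_integral_powr_to_inf[of "- 3" s] s by (auto intro: has_integral_integrable)
    show "norm (f x) \<le> x powr (- 3)" if "x \<in> {s..}" for x
    proof -
      have x: "0 < x" using that s by simp
      then have "x ^ 3 \<le> (a x) ^ 3" using a_ge by (intro power_mono) auto
      then show ?thesis
        unfolding f_def using x pos[OF x] by (simp add: powr_minus_divide powr_numeral frac_le)
    qed
  qed simp
  define X where "X = chi_type_minus_one a"
  have X_eq: "X s = integral {s..} f" for s
    unfolding X_def chi_type_minus_one_def f_def ..
  have dX: "(X has_real_derivative - 1 / (a t) ^ 3) (at t)" if t: "t > 0" for t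
  proof -
    \<comment> \<open>Writing the tail from \<open>s\<close> as a constant minus an integral over a
      bounded interval makes the fundamental theorem of calculus applicable. The base point
      \<open>t / 2\<close> leaves room on both sides of \<open>t\<close>.\<close>
    have split: "X (t / 2) - integral {t / 2..s} f = X s" if s: "s \<in> {t / 2<..}" for s
    proof -
      have "integral ({t / 2..s} \<union> {s..}) f = integral {t / 2..s} f + integral {s..} f"
      proof (rule Henstock_Kurzweil_Integration.integral_Un)
        show "f integrable_on {t / 2..s}"
          by (intro integrable_continuous_real continuous_on_subset[OF cf[of "t / 2"]]) (use t in auto)
        show "f integrable_on {s..}" using s t by (intro intf) auto
        have "{t / 2..s} \<inter> {s..} = {s}" using s by auto
        then show "negligible ({t / 2..s} \<inter> {s..})" by simp
      qed
      moreover have "{t / 2..s} \<union> {s..} = {t / 2..}" using s by auto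
      ultimately show ?thesis by (simp add: X_eq)
    qed
    have "((\<lambda>s. integral {t / 2..s} f) has_real_derivative f t) (at t within {t / 2..2 * t})"
      by (rule integral_has_real_derivative[OF continuous_on_subset[OF cf[of "t / 2"]]]) (use t in auto)
    then have "((\<lambda>s. integral {t / 2..s} f) has_real_derivative f t) (at t)"
      using t by (simp add: at_within_Icc_at)
    then have "((\<lambda>s. X (t / 2) - integral {t / 2..s} f) has_real_derivative - f t) (at t)"
      by (auto intro!: derivative_eq_intros)
    then have "(X has_real_derivative - f t) (at t)"
      by (rule has_field_derivative_transform_within_open[where S="{t / 2<..}"]) (use t split in auto)
    then show ?thesis by (simp add: f_def)
  qed
  \<comment> \<open>Strict positivity comes from strict decrease: \<open>X (t + 1)\<close> is
    nonnegative as an integral and smaller than \<open>X t\<close>.\<close>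
  have X_pos: "X t > 0" if t: "t > 0" for t
  proof -
    have "0 \<le> X (t + 1)"
      unfolding X_eq using t pos
      by (intro Henstock_Kurzweil_Integration.integral_nonneg intf) (auto simp: f_def less_imp_le)
    also have "X (t + 1) < X t"
    proof (rule DERIV_neg_imp_decreasing[of t "t + 1" X])
      fix x assume "t \<le> x" "x \<le> t + 1"
      then have x: "x > 0" using t by simp
      then show "\<exists>y. (X has_real_derivative y) (at x) \<and> y < 0"
        using dX[OF x] pos[OF x] by (intro exI[of _ "- 1 / (a x) ^ 3"]) simp
    qed simp
    finally show ?thesis .
  qed
  have "big_bang a a' X 1 (sqrt b) (sqrt (b + 1)) T (3 * \<gamma> / 2)"
    by standard (use pos da dX X_pos lim \<gamma> b lower upper T0(1) in \<open>auto simp: T_def\<close>)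
  then show ?thesis unfolding X_def by blast
qed

theorem proposition5p3:
  fixes M :: "'a::t2_space set"
    and \<A> :: "'a chart set"
    and g :: "'a metric"
    and vol :: "'a measure"
    and \<gamma> :: real
    and a :: "real \<Rightarrow> real"
    and \<psi> :: "real \<Rightarrow> 'a \<Rightarrow> real"
    and A :: "'a \<Rightarrow> real"
    and N :: nat
  assumes manifold: "closed_riemannian_3manifold M \<A> g"
    and volume: "riemannian_volume M \<A> g vol"
    and gamma: "2 / 3 < \<gamma>" "\<gamma> < 2"
    and wave: "smooth_wave M \<A> g a \<psi>"
  shows
    "(type_minus_one \<gamma> a \<and> leading_coefficient M \<A> (chi_type_minus_one a) \<psi> A \<longrightarrow>
        ((\<lambda>t. (a t) ^ 6 *
            energy_N \<A> g vol a N t (\<lambda>s p. \<psi> s p - A p * chi_type_minus_one a s))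
          \<longlongrightarrow> 0) (at_right 0)) \<and>
     (type_zero \<gamma> a \<and> leading_coefficient M \<A> (chi_type_zero \<gamma>) \<psi> A \<longrightarrow>
        ((\<lambda>t. t powr (4 / \<gamma>) *
            energy_N \<A> g vol a N t (\<lambda>s p. \<psi> s p - A p * s powr (1 - 2 / \<gamma>)))
          \<longlongrightarrow> 0) (at_right 0))"
proof (intro conjI impI; elim conjE)
  assume "type_minus_one \<gamma> a" and lead: "leading_coefficient M \<A> (chi_type_minus_one a) \<psi> A"
  then show "((\<lambda>t. (a t) ^ 6 *
      energy_N \<A> g vol a N t (\<lambda>s p. \<psi> s p - A p * chi_type_minus_one a s)) \<longlongrightarrow> 0) (at_right 0)"
    using big_bang_type_minus_one[OF gamma] energy_tendsto_big_bang[OF manifold volume wave _ lead] by blast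
next
  assume a: "type_zero \<gamma> a" and lead: "leading_coefficient M \<A> (chi_type_zero \<gamma>) \<psi> A"
  have "((\<lambda>t. (a t) ^ 6 *
      energy_N \<A> g vol a N t (\<lambda>s p. \<psi> s p - A p * s powr (1 - 2 / \<gamma>))) \<longlongrightarrow> 0) (at_right 0)"
    using energy_tendsto_big_bang[OF manifold volume wave big_bang_type_zero[OF gamma a] lead]
    unfolding chi_type_zero_def .
  moreover have "(a t) ^ 6 = t powr (4 / \<gamma>)" if "t > 0" for t
    using a that gamma
    by (simp add: type_zero_def powr_numeral[symmetric] powr_powr field_simps del: powr_numeral)
  then have "\<forall>\<^sub>F t in at_right 0. (a t) ^ 6 *
      energy_N \<A> g vol a N t (\<lambda>s p. \<psi> s p - A p * s powr (1 - 2 / \<gamma>)) = t powr (4 / \<gamma>) *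
      energy_N \<A> g vol a N t (\<lambda>s p. \<psi> s p - A p * s powr (1 - 2 / \<gamma>))"
    using eventually_at_right_less[of "0::real"] by (auto elim!: eventually_mono)
  ultimately show "((\<lambda>t. t powr (4 / \<gamma>) *
      energy_N \<A> g vol a N t (\<lambda>s p. \<psi> s p - A p * s powr (1 - 2 / \<gamma>))) \<longlongrightarrow> 0) (at_right 0)"
    by (rule Lim_transform_eventually)
qed

end
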